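(* Let $\mathfrak{M}=(V,\langle\cdot,\cdot\rangle,A)$ be a model of signature $(2,2)$. Then $\mathfrak{M}$ is null Jordan Osserman if and only if $A$ is of Type Ia and one of the following holds: (1) There exists a constant $\kappa_0$ so that $A=\kappa_0A^0$. (2) There exist constants $\kappa_0$ and $\kappa_J$ with $\kappa_J\neq0$ so that $A=\kappa_0A^0+\kappa_JA^J$, where $J$ is an orthogonal complex structure on $V$. (3) There exists a constant $\kappa_P\neq0$ so that $A=\kappa_PA^P$, where $P$ is an adapted paracomplex structure on $V$. (4) There exist constants $\kappa_1,\kappa_2,\kappa_3$ so that $\kappa_2\kappa_3(\kappa_2+\kappa_1)(\kappa_3+\kappa_1)>0$, so that the associated eigenvalues $\{3\kappa_1,-3\kappa_2,-3\kappa_3\}$ are all distinct, and so that $A=\kappa_1A^{\Psi_1}+\kappa_2A^{\Psi_2}+\kappa_3A^{\Psi_3}$, where $(\Psi_1,\Psi_2,\Psi_3)$ is a paraquaternionic structure on $V$.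
   Context: A model of signature $(2,2)$ is a triple $\mathfrak{M}=(V,\langle\cdot,\cdot\rangle,A)$, where $V$ is a $4$-dimensional real vector space, $\langle\cdot,\cdot\rangle$ is a non-degenerate symmetric bilinear form on $V$ of signature $(2,2)$, and $A\in\otimes^4(V^* )$ is an algebraic curvature tensor, i.e. for all $x,y,z,v$: $A(x,y,z,v)=-A(y,x,z,v)=A(z,v,x,y)$ and $A(x,y,z,v)+A(y,z,x,v)+A(z,x,y,v)=0$. The Jacobi operator $\mathcal{J}_A(x):V\to V$ is characterized by $\langle\mathcal{J}_A(x)y,z\rangle=A(y,x,x,z)$. A vector $v$ is spacelike, timelike or null if $\langle v,v\rangle>0$, $<0$, or $=0$. $\mathfrak{M}$ is null Jordan Osserman if the Jordan normal form of $\mathcal{J}_A(v)$ is the same for all non-zero null vectors $v$. $\mathfrak{M}$ is spacelike (resp. timelike, null) Osserman if the (complex) eigenvalues of $\mathcal{J}_A(v)$, counted with multiplicity, are the same for all $v$ with $\langle v,v\rangle=1$ (resp. for all $v$ with $\langle v,v\rangle=-1$, for all non-zero null $v$); in signature $(2,2)$ these three conditions are equivalent, and they imply that the Jordan normal form of $\mathcal{J}_A$ is constant on the spacelike unit vectors and constant on the timelike unit vectors. Type Ia: for $x$ spacelike or timelike, $\mathcal{J}_A(x)$ preserves $x^\perp$. $A$ is of Type Ia if $\mathfrak{M}$ is spacelike, timelike or null Osserman and the restriction of $\mathcal{J}_A(x)$ to the $3$-dimensional space $x^\perp$ is diagonalizable over $\mathbb{R}$ for unit spacelike and unit timelike $x$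 (i.e. its Jordan normal form is $\operatorname{diag}(\alpha,\beta,\gamma)$ with $\alpha,\beta,\gamma\in\mathbb{R}$). The tensor $A^0$ is $A^0(x,y,z,v)=\langle y,z\rangle\langle x,v\rangle-\langle x,z\rangle\langle y,v\rangle$. For a skew-adjoint endomorphism $\Psi$ of $V$ (with respect to $\langle\cdot,\cdot\rangle$), $$A^\Psi(x,y,z,v)=\langle\Psi y,z\rangle\langle\Psi x,v\rangle-\langle\Psi x,z\rangle\langle\Psi y,v\rangle-2\langle\Psi x,y\rangle\langle\Psi z,v\rangle.$$ An orthogonal complex structure is a skew-adjoint endomorphism $J$ with $J^2=-\mathrm{id}$. An adapted paracomplex structure is a skew-adjoint endomorphism $P$ with $P^2=\mathrm{id}$. A paraquaternionic structure is a triple of skew-adjoint endomorphisms $(\Psi_1,\Psi_2,\Psi_3)$ with $\Psi_1^2=-\mathrm{id}$, $\Psi_2^2=\Psi_3^2=\mathrm{id}$, and $\Psi_i\Psi_j+\Psi_j\Psi_i=0$ for $i\neq j$. *)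

theory Defs
  imports "HOL-Analysis.Linear_Algebra" "Jordan_Normal_Form.Jordan_Normal_Form"
begin

section \<open>Models of signature (2,2)\<close>

definition nondegenerate :: "('a::real_vector \<Rightarrow> 'a \<Rightarrow> real) \<Rightarrow> bool" where
  "nondegenerate g \<longleftrightarrow> (\<forall>x. (\<forall>y. g x y = 0) \<longrightarrow> x = 0)"

text \<open>Signature \<open>(p, q)\<close>: an orthonormal basis of the whole space has \<open>p\<close> timelike and
  \<open>q\<close> spacelike vectors.\<close>

definition has_signature :: "('a::real_vector \<Rightarrow> 'a \<Rightarrow> real) \<Rightarrow> nat \<Rightarrow> nat \<Rightarrow> bool" where
  "has_signature g p q \<longleftrightarrow>
     (\<exists>B. finite B \<and> independent B \<and> span B = UNIV \<and>
        (\<forall>b\<in>B. \<forall>c\<in>B. b \<noteq> c \<longrightarrow> g b c = 0) \<and>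
        (\<forall>b\<in>B. g b b = 1 \<or> g b b = -1) \<and>
        card {b\<in>B. g b b = -1} = p \<and> card {b\<in>B. g b b = 1} = q)"

definition multilinear4 :: "('a::real_vector \<Rightarrow> 'a \<Rightarrow> 'a \<Rightarrow> 'a \<Rightarrow> real) \<Rightarrow> bool" where
  "multilinear4 A \<longleftrightarrow>
     (\<forall>y z v. linear (\<lambda>x. A x y z v)) \<and> (\<forall>x z v. linear (\<lambda>y. A x y z v)) \<and>
     (\<forall>x y v. linear (\<lambda>z. A x y z v)) \<and> (\<forall>x y z. linear (\<lambda>v. A x y z v))"

definition algebraic_curvature_tensor ::
    "('a::real_vector \<Rightarrow> 'a \<Rightarrow> 'a \<Rightarrow> 'a \<Rightarrow> real) \<Rightarrow> bool" where
  "algebraic_curvature_tensor A \<longleftrightarrow> multilinear4 A \<and>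
     (\<forall>x y z v. A x y z v = - A y x z v) \<and>
     (\<forall>x y z v. A x y z v = A z v x y) \<and>
     (\<forall>x y z v. A x y z v + A y z x v + A z x y v = 0)"

text \<open>The vector space is the whole type; \<open>dim UNIV = 4\<close> also forces finite dimension,
  since the library's \<open>dim\<close> of an infinite-dimensional space is \<open>0\<close>.\<close>

definition model22 ::
    "('a::real_vector \<Rightarrow> 'a \<Rightarrow> real) \<Rightarrow> ('a \<Rightarrow> 'a \<Rightarrow> 'a \<Rightarrow> 'a \<Rightarrow> real) \<Rightarrow> bool" where
  "model22 g A \<longleftrightarrow> dim (UNIV :: 'a set) = 4 \<and>
     bilinear g \<and> (\<forall>x y. g x y = g y x) \<and> nondegenerate g \<and> has_signature g 2 2 \<and>
     algebraic_curvature_tensor A"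

definition jacobi ::
    "('a::real_vector \<Rightarrow> 'a \<Rightarrow> real) \<Rightarrow> ('a \<Rightarrow> 'a \<Rightarrow> 'a \<Rightarrow> 'a \<Rightarrow> real) \<Rightarrow> 'a \<Rightarrow> 'a \<Rightarrow> 'a" where
  "jacobi g A x y = (THE w. \<forall>z. g w z = A y x x z)"

section \<open>Jordan normal form and eigenvalues of an endomorphism\<close>

definition ordered_basis :: "'a::real_vector list \<Rightarrow> bool" where
  "ordered_basis bs \<longleftrightarrow> distinct bs \<and> independent (set bs) \<and> span (set bs) = UNIV"

text \<open>The matrix of \<open>T\<close> (acting on columns) with respect to a basis, with its real entries
  regarded as complex numbers, so that it has a Jordan normal form.\<close>

definition complex_matrix_of :: "'a::real_vector list \<Rightarrow> ('a \<Rightarrow> 'a) \<Rightarrow> complex mat" where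
  "complex_matrix_of bs T = mat (length bs) (length bs)
     (\<lambda>(i, j). complex_of_real (representation (set bs) (T (bs ! j)) (bs ! i)))"

text \<open>Neither predicate depends on the basis chosen. A Jordan normal form is a list of pairs
  (block size, eigenvalue), and every reordering of the list is also a Jordan normal form of
  the same endomorphism.\<close>

definition has_jordan_nf :: "('a::real_vector \<Rightarrow> 'a) \<Rightarrow> (nat \<times> complex) list \<Rightarrow> bool" where
  "has_jordan_nf T n_as \<longleftrightarrow> (\<exists>bs. ordered_basis bs \<and> jordan_nf (complex_matrix_of bs T) n_as)"

definition has_eigenvalues :: "('a::real_vector \<Rightarrow> 'a) \<Rightarrow> complex multiset \<Rightarrow> bool" where
  "has_eigenvalues T M \<longleftrightarrow>
     (\<exists>bs. ordered_basis bs \<and> proots (char_poly (complex_matrix_of bs T)) = M)"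

definition diagonalizable_on :: "('a::real_vector \<Rightarrow> 'a) \<Rightarrow> 'a set \<Rightarrow> bool" where
  "diagonalizable_on T W \<longleftrightarrow>
     (\<exists>B. independent B \<and> span B = W \<and> (\<forall>b\<in>B. \<exists>c::real. T b = c *\<^sub>R b))"

section \<open>Osserman conditions\<close>

definition null_jordan_osserman ::
    "('a::real_vector \<Rightarrow> 'a \<Rightarrow> real) \<Rightarrow> ('a \<Rightarrow> 'a \<Rightarrow> 'a \<Rightarrow> 'a \<Rightarrow> real) \<Rightarrow> bool" where
  "null_jordan_osserman g A \<longleftrightarrow>
     (\<exists>n_as. \<forall>v. v \<noteq> 0 \<and> g v v = 0 \<longrightarrow> has_jordan_nf (jacobi g A v) n_as)"

definition spacelike_osserman ::
    "('a::real_vector \<Rightarrow> 'a \<Rightarrow> real) \<Rightarrow> ('a \<Rightarrow> 'a \<Rightarrow> 'a \<Rightarrow> 'a \<Rightarrow> real) \<Rightarrow> bool" where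
  "spacelike_osserman g A \<longleftrightarrow>
     (\<exists>M. \<forall>v. g v v = 1 \<longrightarrow> has_eigenvalues (jacobi g A v) M)"

definition timelike_osserman ::
    "('a::real_vector \<Rightarrow> 'a \<Rightarrow> real) \<Rightarrow> ('a \<Rightarrow> 'a \<Rightarrow> 'a \<Rightarrow> 'a \<Rightarrow> real) \<Rightarrow> bool" where
  "timelike_osserman g A \<longleftrightarrow>
     (\<exists>M. \<forall>v. g v v = -1 \<longrightarrow> has_eigenvalues (jacobi g A v) M)"

definition null_osserman ::
    "('a::real_vector \<Rightarrow> 'a \<Rightarrow> real) \<Rightarrow> ('a \<Rightarrow> 'a \<Rightarrow> 'a \<Rightarrow> 'a \<Rightarrow> real) \<Rightarrow> bool" where
  "null_osserman g A \<longleftrightarrow>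
     (\<exists>M. \<forall>v. v \<noteq> 0 \<and> g v v = 0 \<longrightarrow> has_eigenvalues (jacobi g A v) M)"

definition type_Ia ::
    "('a::real_vector \<Rightarrow> 'a \<Rightarrow> real) \<Rightarrow> ('a \<Rightarrow> 'a \<Rightarrow> 'a \<Rightarrow> 'a \<Rightarrow> real) \<Rightarrow> bool" where
  "type_Ia g A \<longleftrightarrow>
     (spacelike_osserman g A \<or> timelike_osserman g A \<or> null_osserman g A) \<and>
     (\<forall>x. g x x = 1 \<or> g x x = -1 \<longrightarrow> diagonalizable_on (jacobi g A x) {y. g x y = 0})"

section \<open>The tensors and structures in the classification\<close>

definition curv0 :: "('a::real_vector \<Rightarrow> 'a \<Rightarrow> real) \<Rightarrow> 'a \<Rightarrow> 'a \<Rightarrow> 'a \<Rightarrow> 'a \<Rightarrow> real" where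
  "curv0 g x y z v = g y z * g x v - g x z * g y v"

definition curv_endo ::
    "('a::real_vector \<Rightarrow> 'a \<Rightarrow> real) \<Rightarrow> ('a \<Rightarrow> 'a) \<Rightarrow> 'a \<Rightarrow> 'a \<Rightarrow> 'a \<Rightarrow> 'a \<Rightarrow> real" where
  "curv_endo g \<Psi> x y z v =
     g (\<Psi> y) z * g (\<Psi> x) v - g (\<Psi> x) z * g (\<Psi> y) v - 2 * g (\<Psi> x) y * g (\<Psi> z) v"

definition skew_adjoint :: "('a::real_vector \<Rightarrow> 'a \<Rightarrow> real) \<Rightarrow> ('a \<Rightarrow> 'a) \<Rightarrow> bool" where
  "skew_adjoint g \<Psi> \<longleftrightarrow> linear \<Psi> \<and> (\<forall>x y. g (\<Psi> x) y = - g x (\<Psi> y))"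

definition orthogonal_complex_structure ::
    "('a::real_vector \<Rightarrow> 'a \<Rightarrow> real) \<Rightarrow> ('a \<Rightarrow> 'a) \<Rightarrow> bool" where
  "orthogonal_complex_structure g J \<longleftrightarrow> skew_adjoint g J \<and> (\<forall>x. J (J x) = - x)"

definition adapted_paracomplex_structure ::
    "('a::real_vector \<Rightarrow> 'a \<Rightarrow> real) \<Rightarrow> ('a \<Rightarrow> 'a) \<Rightarrow> bool" where
  "adapted_paracomplex_structure g P \<longleftrightarrow> skew_adjoint g P \<and> (\<forall>x. P (P x) = x)"

definition paraquaternionic_structure ::
    "('a::real_vector \<Rightarrow> 'a \<Rightarrow> real) \<Rightarrow> ('a \<Rightarrow> 'a) \<Rightarrow> ('a \<Rightarrow> 'a) \<Rightarrow> ('a \<Rightarrow> 'a) \<Rightarrow> bool" where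
  "paraquaternionic_structure g \<Psi>1 \<Psi>2 \<Psi>3 \<longleftrightarrow>
     skew_adjoint g \<Psi>1 \<and> skew_adjoint g \<Psi>2 \<and> skew_adjoint g \<Psi>3 \<and>
     (\<forall>x. \<Psi>1 (\<Psi>1 x) = - x) \<and> (\<forall>x. \<Psi>2 (\<Psi>2 x) = x) \<and> (\<forall>x. \<Psi>3 (\<Psi>3 x) = x) \<and>
     (\<forall>x. \<Psi>1 (\<Psi>2 x) + \<Psi>2 (\<Psi>1 x) = 0) \<and>
     (\<forall>x. \<Psi>1 (\<Psi>3 x) + \<Psi>3 (\<Psi>1 x) = 0) \<and>
     (\<forall>x. \<Psi>2 (\<Psi>3 x) + \<Psi>3 (\<Psi>2 x) = 0)"

end

theory Submission
  imports Defs
begin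

text \<open>
  Two observations carry the proof. First, replacing a null vector \<open>v\<close> by \<open>2 v\<close> multiplies its Jacobi
  operator by \<open>4\<close>, so a Jordan normal form that is constant on the null cone has only the eigenvalue \<open>0\<close>,
  and the null Jacobi operators are nilpotent (\<open>jordan_nf_scaling_nilpotent\<close>). Second, a space of signature
  \<open>(2,2)\<close> is a tensor product of two planes, its null vectors being the pure tensors \<open>s \<otimes> t\<close>. For such a
  \<open>v\<close>, with \<open>s'\<close> and \<open>t'\<close> completing \<open>s\<close> and \<open>t\<close> to unimodular bases, the quotient of the orthogonal
  complement of \<open>v\<close> by \<open>v\<close> is spanned by \<open>s \<otimes> t'\<close> and \<open>s' \<otimes> t\<close>, and there the Jacobi operator has
  equal diagonal entries \<open>p\<close> and off-diagonal entries \<open>q\<close>, \<open>r\<close>. Nilpotency says \<open>p = 0\<close> and \<open>q r = 0\<close>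
  (\<open>nilpotent_frame\<close>). As \<open>v\<close> varies, \<open>p\<close> is the trace-free Ricci tensor, \<open>q\<close> is a quartic form in \<open>s\<close>
  alone and \<open>r\<close> a quartic form in \<open>t\<close> alone: the two halves of the Weyl tensor. Hence \<open>A\<close> is Einstein
  and one of the halves vanishes.

  What is left of \<open>A\<close> is a quadratic form \<open>Q\<close> in the three numbers \<open>g y (I x)\<close>, \<open>g y (J x)\<close>,
  \<open>g y (K x)\<close>, where \<open>(I, J, K)\<close> is a paraquaternionic structure acting on one tensor factor
  (\<open>half_curvature\<close>). For null \<open>v \<noteq> 0\<close> one has \<open>I v = \<sigma> J v + \<tau> K v\<close> with \<open>\<sigma>\<^sup>2 + \<tau>\<^sup>2 = 1\<close>, so the
  Jacobi operator of \<open>v\<close> maps into the totally isotropic plane spanned by \<open>J v\<close> and \<open>K v\<close>; it squares to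
  zero and its Jordan form is determined by its rank, the rank of a symmetric \<open>2 \<times> 2\<close> matrix depending on
  \<open>(\<sigma>, \<tau>)\<close>. Every point of the circle occurs, so this rank is constant on the circle
  (\<open>null_jordan_osserman_constant_rank\<close>).

  Constant rank forces \<open>Q\<close> to be diagonal for a suitable paraquaternionic structure
  (\<open>null_jordan_osserman_diagonal\<close>). The freedom consists of the rotations and boosts that preserve
  \<open>- u\<^sup>2 + v\<^sup>2 + w\<^sup>2\<close>, and \<open>Q\<close> has a real eigenvector relative to this form because a cubic has a real root. A
  timelike eigenvector leaves a definite block; a spacelike one leaves a Lorentzian block, and if this block
  could not be diagonalised, the determinant of the \<open>2 \<times> 2\<close> matrix would vanish at some but not all points of the circle,
  or the matrix itself would; a null eigenvector only occurs together with a spacelike one or when \<open>Q\<close> is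
  already diagonal. For \<open>Q = p u\<^sup>2 + q v\<^sup>2 + r w\<^sup>2\<close> the determinant is
  \<open>\<sigma>\<^sup>2 r (q + p) + \<tau>\<^sup>2 q (r + p)\<close>, which is either nowhere zero or identically zero. These alternatives
  give the four cases, the constant curvature tensor entering through \<open>lagrange_identity\<close>, and \<open>I x\<close>,
  \<open>J x\<close>, \<open>K x\<close> are eigenvectors of the Jacobi operator of \<open>x\<close>, which gives Type Ia.

  Conversely, each of the four formulas shows that the null Jacobi operators square to zero and have
  constant rank.
\<close>

section \<open>Matrices and Jordan normal forms of linear maps\<close>

text \<open>
  Using different bases for source and target makes composition a product of matrices with no mention of
  inverses; the identity map then gives the change of basis.
\<close>

definition basis_change_mat :: "'a::real_vector list \<Rightarrow> 'a list \<Rightarrow> ('a \<Rightarrow> 'a) \<Rightarrow> complex mat" where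
  "basis_change_mat bs cs T = mat (length bs) (length cs)
     (\<lambda>(i, j). complex_of_real (representation (set bs) (T (cs ! j)) (bs ! i)))"

lemma complex_matrix_of_eq: "complex_matrix_of bs T = basis_change_mat bs bs T"
  by (simp add: complex_matrix_of_def basis_change_mat_def)

lemma basis_change_mat_carrier [simp]:
  "basis_change_mat bs cs T \<in> carrier_mat (length bs) (length cs)"
  by (simp add: basis_change_mat_def)

lemma representation_linear:
  assumes "ordered_basis bs" "linear T"
  shows "linear (\<lambda>x. representation (set bs) (T x) b)"
  using assms unfolding ordered_basis_def
  by (intro linearI) (auto simp: representation_add representation_scale linear_add linear_scale)

lemma sum_representation_ordered:
  assumes "ordered_basis bs"
  shows "(\<Sum>k<length bs. representation (set bs) x (bs ! k) *\<^sub>R (bs ! k)) = x"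
proof -
  have bij: "bij_betw ((!) bs) {..<length bs} (set bs)"
    using assms by (auto simp: ordered_basis_def intro!: bij_betw_nth)
  have "(\<Sum>k<length bs. representation (set bs) x (bs ! k) *\<^sub>R (bs ! k))
      = (\<Sum>b\<in>set bs. representation (set bs) x b *\<^sub>R b)"
    by (rule sum.reindex_bij_betw[OF bij, of "\<lambda>b. representation (set bs) x b *\<^sub>R b"])
  also have "\<dots> = x"
    using assms by (intro sum_representation_eq) (auto simp: ordered_basis_def)
  finally show ?thesis .
qed

lemma linear_expand_ordered:
  fixes f :: "'a::real_vector \<Rightarrow> 'b::real_vector"
  assumes "ordered_basis bs" "linear f"
  shows "f x = (\<Sum>k<length bs. representation (set bs) x (bs ! k) *\<^sub>R f (bs ! k))"
proof -
  have "f x = f (\<Sum>k<length bs. representation (set bs) x (bs ! k) *\<^sub>R (bs ! k))"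
    by (simp add: sum_representation_ordered[OF assms(1)])
  then show ?thesis
    using assms(2) by (simp add: linear_sum linear_scale)
qed

lemma basis_change_mat_mult:
  assumes "ordered_basis as" "ordered_basis bs" "linear S"
  shows "basis_change_mat as bs S * basis_change_mat bs cs T = basis_change_mat as cs (S \<circ> T)"
proof (rule eq_matI)
  fix i j
  assume ij: "i < dim_row (basis_change_mat as cs (S \<circ> T))" "j < dim_col (basis_change_mat as cs (S \<circ> T))"
  let ?r = "\<lambda>k. representation (set bs) (T (cs ! j)) (bs ! k)"
  have "representation (set as) (S (T (cs ! j))) (as ! i)
      = (\<Sum>k<length bs. ?r k *\<^sub>R representation (set as) (S (bs ! k)) (as ! i))"
    by (rule linear_expand_ordered[OF assms(2) representation_linear[OF assms(1,3)]])
  then show "(basis_change_mat as bs S * basis_change_mat bs cs T) $$ (i, j) = basis_change_mat as cs (S \<circ> T) $$ (i, j)"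
    using ij by (auto simp: basis_change_mat_def scalar_prod_def lessThan_atLeast0 mult.commute intro!: sum.cong)
qed (auto simp: basis_change_mat_def)

lemma basis_change_mat_id:
  assumes "ordered_basis bs"
  shows "basis_change_mat bs bs (\<lambda>x. x) = 1\<^sub>m (length bs)"
  using assms unfolding ordered_basis_def
  by (intro eq_matI) (auto simp: basis_change_mat_def representation_basis nth_eq_iff_index_eq)

lemma ordered_basis_length:
  assumes "ordered_basis (bs :: 'a::real_vector list)"
  shows "length bs = dim (UNIV :: 'a set)"
  using assms unfolding ordered_basis_def
  by (metis dim_eq_card distinct_card span_UNIV)

lemma complex_matrix_of_similar:
  assumes "ordered_basis (bs :: 'a::real_vector list)" "ordered_basis cs" "linear T"
  shows "similar_mat (complex_matrix_of bs T) (complex_matrix_of cs T)"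
proof -
  have id: "linear (\<lambda>x::'a. x)" by (simp add: linear_id[unfolded id_def])
  have len: "length cs = length bs"
    using assms(1,2) by (simp add: ordered_basis_length)
  let ?P = "basis_change_mat bs cs (\<lambda>x. x)" and ?Q = "basis_change_mat cs bs (\<lambda>x. x)"
  have "?P * ?Q = 1\<^sub>m (length bs)" "?Q * ?P = 1\<^sub>m (length bs)"
    using assms id by (simp_all add: basis_change_mat_mult o_def basis_change_mat_id len)
  moreover have "complex_matrix_of bs T = ?P * complex_matrix_of cs T * ?Q"
    using assms id by (simp add: complex_matrix_of_eq basis_change_mat_mult o_def)
  moreover have "{complex_matrix_of bs T, complex_matrix_of cs T, ?P, ?Q} \<subseteq> carrier_mat (length bs) (length bs)"
    using len by (auto simp: complex_matrix_of_eq basis_change_mat_def)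
  ultimately show ?thesis
    by (intro similar_matI)
qed

lemma complex_matrix_of_scale:
  assumes "ordered_basis bs"
  shows "complex_matrix_of bs (\<lambda>x. c *\<^sub>R T x) = complex_of_real c \<cdot>\<^sub>m complex_matrix_of bs T"
  using assms unfolding ordered_basis_def
  by (intro eq_matI) (auto simp: complex_matrix_of_def representation_scale)

lemma complex_matrix_of_pow:
  assumes "ordered_basis bs" "linear T"
  shows "complex_matrix_of bs T ^\<^sub>m k = complex_matrix_of bs (T ^^ k)"
proof (induction k)
  case 0
  have "dim_row (complex_matrix_of bs T) = length bs" by (simp add: complex_matrix_of_def)
  then show ?case
    using basis_change_mat_id[OF assms(1)] by (simp add: complex_matrix_of_eq id_def)
next
  case (Suc k)
  have "linear (T ^^ k)"
  proof (induction k)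
    case (Suc k)
    then show ?case using linear_compose[OF Suc assms(2)] by (simp add: o_def)
  qed (simp add: linear_id id_def[symmetric])
  then show ?case
    using Suc assms by (simp add: complex_matrix_of_eq basis_change_mat_mult funpow_swap1 o_def fun_eq_iff)
qed

lemma complex_matrix_of_eq_0D:
  assumes "ordered_basis bs" "linear T" "complex_matrix_of bs T = 0\<^sub>m n m"
  shows "T x = 0"
proof -
  have nm: "n = length bs" "m = length bs"
    using arg_cong[OF assms(3), of dim_row] arg_cong[OF assms(3), of dim_col]
    by (auto simp: complex_matrix_of_def)
  have z: "representation (set bs) (T (bs ! j)) (bs ! i) = 0" if "i < length bs" "j < length bs" for i j
  proof -
    have "complex_matrix_of bs T $$ (i, j) = 0"
      unfolding assms(3) using that nm by simp
    then show ?thesis using that by (simp add: complex_matrix_of_def)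
  qed
  have "T (bs ! j) = 0" if "j < length bs" for j
    using sum_representation_ordered[OF assms(1), of "T (bs ! j)"] z[OF _ that] by simp
  then show ?thesis
    using linear_expand_ordered[OF assms(1,2), of x] by simp
qed

text \<open>
  An element of maximal modulus cannot be multiplied by \<open>4\<close> inside the set unless it is \<open>0\<close>.
\<close>

lemma finite_scaling_closed_eq_0:
  fixes S :: "complex set"
  assumes "finite S" "(\<lambda>a. 4 * a) ` S = S" "a \<in> S"
  shows "a = 0"
proof (rule ccontr)
  assume "a \<noteq> 0"
  have ne: "norm ` S \<noteq> {}" and fin: "finite (norm ` S)" using assms by auto
  define m where "m = Max (norm ` S)"
  have "m \<in> norm ` S" unfolding m_def using fin ne by (rule Max_in)
  then obtain b where b: "b \<in> S" "norm b = m" by auto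
  have "4 * b \<in> S" using b assms(2) by blast
  then have "norm (4 * b) \<le> m" unfolding m_def using fin by (intro Max_ge imageI)
  moreover have "norm a \<le> m" unfolding m_def using fin assms(3) by (intro Max_ge) auto
  moreover have "norm a > 0" using \<open>a \<noteq> 0\<close> by simp
  ultimately show False using b(2) by (simp add: norm_mult)
qed

lemma jordan_nf_linear_factors_root:
  fixes n_as :: "(nat \<times> complex) list"
  assumes "0 \<notin> fst ` set n_as"
  shows "poly (\<Prod>(n, a) \<leftarrow> n_as. [:- a, 1:] ^ n) x = 0 \<longleftrightarrow> x \<in> snd ` set n_as"
  using assms by (induction n_as) (auto)

lemma diag_block_mat_zero:
  assumes "\<And>A. A \<in> set As \<Longrightarrow> \<exists>n. A = 0\<^sub>m n n"
  shows "\<exists>n. diag_block_mat As = (0\<^sub>m n n :: 'b::zero mat)"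
  using assms
proof (induction As)
  case (Cons A As)
  obtain n where n: "A = 0\<^sub>m n n" using Cons.prems[of A] by auto
  obtain m where m: "diag_block_mat As = 0\<^sub>m m m" using Cons by auto
  have "diag_block_mat (A # As) = 0\<^sub>m (n + m) (n + m)"
    unfolding diag_block_mat.simps Let_def n m by (intro eq_matI) auto
  then show ?case by blast
qed auto

text \<open>
  The eigenvalues of \<open>4 T\<close> are those of \<open>T\<close> multiplied by \<open>4\<close>, and a finite set of complex numbers stable
  under this scaling is contained in \<open>{0}\<close>. All Jordan blocks are therefore nilpotent, of size at most \<open>d\<close>.
\<close>

lemma jordan_nf_scaling_nilpotent:
  assumes T: "linear (T :: 'a::real_vector \<Rightarrow> 'a)"
    and d: "dim (UNIV :: 'a set) = d"
    and j: "has_jordan_nf T n_as" "has_jordan_nf (\<lambda>x. 4 *\<^sub>R T x) n_as"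
  shows "(T ^^ d) x = 0"
proof -
  obtain bs where bs: "ordered_basis bs" "jordan_nf (complex_matrix_of bs T) n_as"
    using j(1) unfolding has_jordan_nf_def by auto
  obtain cs where cs: "ordered_basis cs" "jordan_nf (complex_matrix_of cs (\<lambda>x. 4 *\<^sub>R T x)) n_as"
    using j(2) unfolding has_jordan_nf_def by auto
  let ?M = "complex_matrix_of bs T"
  have len: "length bs = d" using ordered_basis_length[OF bs(1)] d by simp
  have M: "?M \<in> carrier_mat d d" using len by (simp add: complex_matrix_of_eq basis_change_mat_def)
  have T4: "linear (\<lambda>x. 4 *\<^sub>R T x)"
    using T by (rule linear_compose_scale_right)
  have nz: "0 \<notin> fst ` set n_as" using bs(2) unfolding jordan_nf_def by auto
  have "jordan_nf (4 \<cdot>\<^sub>m ?M) (map (\<lambda>(n, a). (n, 4 * a)) n_as)"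
    by (rule jordan_nf_smult[OF bs(2)]) simp
  moreover have "complex_matrix_of bs (\<lambda>x. 4 *\<^sub>R T x) = 4 \<cdot>\<^sub>m ?M"
    using complex_matrix_of_scale[OF bs(1), of 4 T] by simp
  ultimately have "jordan_nf (complex_matrix_of bs (\<lambda>x. 4 *\<^sub>R T x)) (map (\<lambda>(n, a). (n, 4 * a)) n_as)"
    by (simp only:)
  then have "char_poly (complex_matrix_of bs (\<lambda>x. 4 *\<^sub>R T x)) = (\<Prod>(n, a) \<leftarrow> map (\<lambda>(n, a). (n, 4 * a)) n_as. [:- a, 1:] ^ n)"
    by (rule jordan_nf_char_poly)
  moreover have "char_poly (complex_matrix_of bs (\<lambda>x. 4 *\<^sub>R T x)) = char_poly (complex_matrix_of cs (\<lambda>x. 4 *\<^sub>R T x))"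
    by (rule char_poly_similar[OF complex_matrix_of_similar[OF bs(1) cs(1) T4]])
  ultimately have eq: "(\<Prod>(n, a) \<leftarrow> map (\<lambda>(n, a). (n, 4 * a)) n_as. [:- a, 1:] ^ n) = (\<Prod>(n, a) \<leftarrow> n_as. [:- a, 1:] ^ n)"
    using jordan_nf_char_poly[OF cs(2)] by simp
  have nz': "0 \<notin> fst ` set (map (\<lambda>(n, a). (n, 4 * a)) n_as)" using nz by force
  have "(\<lambda>a. 4 * a) ` (snd ` set n_as) = snd ` set (map (\<lambda>(n, a). (n, 4 * a)) n_as)"
    by (force simp: image_iff)
  also have "\<dots> = snd ` set n_as"
    using jordan_nf_linear_factors_root[OF nz'] jordan_nf_linear_factors_root[OF nz] unfolding eq by blast
  finally have zero: "a = 0" if "(n, a) \<in> set n_as" for n a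
    using finite_scaling_closed_eq_0[of "snd ` set n_as" a] that by force
  have sim: "similar_mat ?M (jordan_matrix n_as)" using bs(2) unfolding jordan_nf_def by auto
  have dims: "sum_list (map fst n_as) = d"
  proof -
    obtain m P Q where "{?M, jordan_matrix n_as, P, Q} \<subseteq> carrier_mat m m"
      using similar_matD[OF sim] by blast
    then have "?M \<in> carrier_mat m m" "jordan_matrix n_as \<in> carrier_mat m m" by auto
    then have "m = d" "m = sum_list (map fst n_as)"
      using M jordan_matrix_dim(1)[of n_as] by (metis carrier_matD(1))+
    then show ?thesis by simp
  qed
  have "jordan_block n a ^\<^sub>m d = 0\<^sub>m n n" if "(n, a) \<in> set n_as" for n a
  proof -
    have "n \<le> d" using dims that member_le_sum_list[of n "map fst n_as"] by force
    then show ?thesis unfolding zero[OF that] jordan_block_zero_pow by (intro eq_matI) auto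
  qed
  then have "\<exists>n. jordan_matrix n_as ^\<^sub>m d = 0\<^sub>m n n"
    unfolding jordan_matrix_pow by (intro diag_block_mat_zero) auto
  moreover have "jordan_matrix n_as ^\<^sub>m d \<in> carrier_mat d d"
    using dims by (auto intro!: pow_carrier_mat)
  ultimately have Jz: "jordan_matrix n_as ^\<^sub>m d = 0\<^sub>m d d" by auto
  obtain P Q where "similar_mat_wit ?M (jordan_matrix n_as) P Q"
    using sim unfolding similar_mat_def by auto
  then have "?M ^\<^sub>m d = P * jordan_matrix n_as ^\<^sub>m d * Q" and PQ: "P \<in> carrier_mat d d" "Q \<in> carrier_mat d d"
    using similar_mat_wit_pow_id similar_mat_wit_def M by (blast, auto simp: similar_mat_wit_def Let_def)
  then have "?M ^\<^sub>m d = 0\<^sub>m d d" unfolding Jz by simp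
  then have "complex_matrix_of bs (T ^^ d) = 0\<^sub>m d d"
    using complex_matrix_of_pow[OF bs(1) T] by simp
  moreover have "linear (T ^^ d)"
  proof (induction d)
    case (Suc k)
    then show ?case using linear_compose[OF Suc T] by (simp add: o_def)
  qed (simp add: linear_id id_def[symmetric])
  ultimately show ?thesis by (intro complex_matrix_of_eq_0D[OF bs(1)])
qed

lemma jordan_nf_similar:
  assumes "jordan_nf A n_as" "jordan_nf B n_as"
  shows "similar_mat A B"
  using assms unfolding jordan_nf_def by (meson similar_mat_sym similar_mat_trans)

text \<open>
  Rank at most one is a property of the Jordan normal form: the matrix of \<open>T\<close> is a column times a row,
  hence so is the similar matrix of \<open>T'\<close>, over the complex numbers. In terms of real data this is the
  vanishing of all \<open>2 \<times> 2\<close> minors, which is the form stated here, with arbitrary linear functionals in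
  place of coordinates.
\<close>

lemma jordan_nf_rank_le_one:
  fixes T T' :: "'a::real_vector \<Rightarrow> 'a"
  assumes T': "linear T'"
    and j: "has_jordan_nf T n_as" "has_jordan_nf T' n_as"
    and r: "\<And>y. T y = l y *\<^sub>R w"
    and fh: "linear f" "linear h"
  shows "f (T' x) * h (T' y) = f (T' y) * (h (T' x) :: real)"
proof -
  obtain bs where bs: "ordered_basis bs" "jordan_nf (complex_matrix_of bs T) n_as"
    using j(1) unfolding has_jordan_nf_def by auto
  obtain cs where cs: "ordered_basis cs" "jordan_nf (complex_matrix_of cs T') n_as"
    using j(2) unfolding has_jordan_nf_def by auto
  define n where "n = length bs"
  have len: "length cs = n"
    using bs(1) cs(1) by (simp add: ordered_basis_length n_def)
  have "similar_mat (complex_matrix_of cs T') (complex_matrix_of bs T)"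
    using jordan_nf_similar bs(2) cs(2) by blast
  then obtain P Q where "similar_mat_wit (complex_matrix_of cs T') (complex_matrix_of bs T) P Q"
    unfolding similar_mat_def by auto
  then have PQ: "P \<in> carrier_mat n n" "Q \<in> carrier_mat n n"
    and eq: "complex_matrix_of cs T' = P * complex_matrix_of bs T * Q"
    using len by (auto simp: similar_mat_wit_def Let_def complex_matrix_of_def)
  define a where "a i = (\<Sum>k<n. P $$ (i, k) * complex_of_real (representation (set bs) w (bs ! k)))" for i
  define b where "b j = (\<Sum>k<n. complex_of_real (l (bs ! k)) * Q $$ (k, j))" for j
  have ent: "complex_of_real (representation (set cs) (T' (cs ! j)) (cs ! i)) = a i * b j" if "i < n" "j < n" for i j
  proof -
    have "complex_matrix_of cs T' $$ (i, j)
        = (\<Sum>x<n. \<Sum>y<n. P $$ (i, y) * complex_of_real (representation (set bs) w (bs ! y))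
              * (complex_of_real (l (bs ! x)) * Q $$ (x, j)))"
      unfolding eq using that PQ bs(1) unfolding ordered_basis_def
      by (auto simp: complex_matrix_of_def scalar_prod_def r representation_scale n_def[symmetric]
          lessThan_atLeast0 sum_distrib_left sum_distrib_right mult_ac intro!: sum.cong)
    also have "\<dots> = a i * b j"
      unfolding a_def b_def sum_product by (rule sum.swap)
    finally have "complex_matrix_of cs T' $$ (i, j) = a i * b j" .
    then show ?thesis using that len by (simp add: complex_matrix_of_def)
  qed
  define F where "F = (\<lambda>f::'a \<Rightarrow> real. \<Sum>i<n. complex_of_real (f (cs ! i)) * a i)"
  define B where "B = (\<lambda>x. \<Sum>j<n. complex_of_real (representation (set cs) x (cs ! j)) * b j)"
  have key: "complex_of_real (f (T' x)) = F f * B x" if "linear f" for f :: "'a \<Rightarrow> real" and x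
  proof -
    have "linear (\<lambda>x. f (T' x))" using linear_compose[OF T' that] by (simp add: o_def)
    then have "f (T' x) = (\<Sum>j<n. representation (set cs) x (cs ! j) * f (T' (cs ! j)))"
      using linear_expand_ordered[OF cs(1), of "\<lambda>x. f (T' x)" x] len by simp
    also have "\<dots> = (\<Sum>j<n. representation (set cs) x (cs ! j) * (\<Sum>i<n. representation (set cs) (T' (cs ! j)) (cs ! i) * f (cs ! i)))"
      by (simp only: linear_expand_ordered[OF cs(1) that, symmetric, unfolded len real_scaleR_def])
    finally have e: "f (T' x) = \<dots>" .
    have "complex_of_real (f (T' x)) = (\<Sum>j<n. \<Sum>i<n. complex_of_real (representation (set cs) x (cs ! j)) * (a i * b j * complex_of_real (f (cs ! i))))"
      unfolding e of_real_sum of_real_mult sum_distrib_left using ent by (intro sum.cong) auto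
    also have "\<dots> = (\<Sum>j<n. \<Sum>i<n. complex_of_real (f (cs ! i)) * a i * (complex_of_real (representation (set cs) x (cs ! j)) * b j))"
      by (intro sum.cong refl) (simp only: mult_ac)
    also have "\<dots> = F f * B x"
      unfolding F_def B_def sum_product by (rule sum.swap)
    finally show ?thesis .
  qed
  have "complex_of_real (f (T' x) * h (T' y)) = complex_of_real (f (T' y) * h (T' x))"
    by (simp only: of_real_mult key[OF fh(1)] key[OF fh(2)] mult_ac)
  then show ?thesis by (simp only: of_real_eq_iff)
qed

lemma jordan_nf_zero:
  fixes T T' :: "'a::real_vector \<Rightarrow> 'a"
  assumes T': "linear T'"
    and j: "has_jordan_nf T n_as" "has_jordan_nf T' n_as"
    and z: "\<And>y. T y = 0"
  shows "T' x = 0"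
proof -
  obtain bs where bs: "ordered_basis bs" "jordan_nf (complex_matrix_of bs T) n_as"
    using j(1) unfolding has_jordan_nf_def by auto
  obtain cs where cs: "ordered_basis cs" "jordan_nf (complex_matrix_of cs T') n_as"
    using j(2) unfolding has_jordan_nf_def by auto
  have "complex_matrix_of bs T = 0\<^sub>m (length bs) (length bs)"
    using bs(1) unfolding ordered_basis_def
    by (intro eq_matI) (auto simp: complex_matrix_of_def z representation_zero)
  moreover have "length cs = length bs"
    using bs(1) cs(1) by (simp add: ordered_basis_length)
  moreover obtain P Q where "similar_mat_wit (complex_matrix_of cs T') (complex_matrix_of bs T) P Q"
    using jordan_nf_similar bs(2) cs(2) unfolding similar_mat_def by blast
  ultimately have "complex_matrix_of cs T' = 0\<^sub>m (length bs) (length bs)"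
    by (auto simp: similar_mat_wit_def Let_def complex_matrix_of_def)
  then show ?thesis by (intro complex_matrix_of_eq_0D[OF cs(1) T'])
qed

lemma has_jordan_nf_eigenvalues:
  assumes "has_jordan_nf T n_as"
  shows "has_eigenvalues T (proots (\<Prod>(n, a) \<leftarrow> n_as. [:- a, 1:] ^ n))"
  using assms jordan_nf_char_poly unfolding has_jordan_nf_def has_eigenvalues_def by metis

section \<open>Jordan normal forms of endomorphisms of square zero\<close>

lemma independent_four_iff:
  fixes w x y z :: "'a::real_vector"
  shows "distinct [w, x, y, z] \<and> independent {w, x, y, z} \<longleftrightarrow>
    (\<forall>a b c d. a *\<^sub>R w + b *\<^sub>R x + c *\<^sub>R y + d *\<^sub>R z = 0 \<longrightarrow> a = 0 \<and> b = 0 \<and> c = 0 \<and> d = 0)"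
    (is "?L \<longleftrightarrow> ?R")
proof
  assume L: ?L
  show ?R
  proof (intro allI impI)
    fix a b c d :: real
    assume e: "a *\<^sub>R w + b *\<^sub>R x + c *\<^sub>R y + d *\<^sub>R z = 0"
    have ne: "w \<noteq> x" "w \<noteq> y" "w \<noteq> z" "x \<noteq> y" "x \<noteq> z" "y \<noteq> z"
      using L by auto
    define u where "u v = (if v = w then a else if v = x then b else if v = y then c else d)" for v
    have "(\<Sum>v\<in>{w, x, y, z}. u v *\<^sub>R v) = 0"
      using ne ne[symmetric] e by (simp add: u_def add.assoc)
    then have "\<forall>v\<in>{w, x, y, z}. u v = 0"
      using L unfolding independent_explicit_finite_subsets by blast
    then show "a = 0 \<and> b = 0 \<and> c = 0 \<and> d = 0"
      using L by (auto simp: u_def)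
  qed
next
  assume R: ?R
  have d: "distinct [w, x, y, z]"
  proof -
    have "w \<noteq> x" using R[rule_format, of 1 "-1" 0 0] by auto
    moreover have "w \<noteq> y" using R[rule_format, of 1 0 "-1" 0] by auto
    moreover have "w \<noteq> z" using R[rule_format, of 1 0 0 "-1"] by auto
    moreover have "x \<noteq> y" using R[rule_format, of 0 1 "-1" 0] by auto
    moreover have "x \<noteq> z" using R[rule_format, of 0 1 0 "-1"] by auto
    moreover have "y \<noteq> z" using R[rule_format, of 0 0 1 "-1"] by auto
    ultimately show ?thesis by simp
  qed
  have "independent {w, x, y, z}"
  proof (rule independent_if_scalars_zero)
    fix f v
    assume s: "(\<Sum>v\<in>{w, x, y, z}. f v *\<^sub>R v) = 0" and v: "v \<in> {w, x, y, z}"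
    have "f w *\<^sub>R w + f x *\<^sub>R x + f y *\<^sub>R y + f z *\<^sub>R z = 0"
      using s d by (simp add: add.assoc)
    from R[rule_format, OF this] show "f v = 0" using v by auto
  qed simp
  with d show ?L by blast
qed

lemma independent_card_dim_spans:
  assumes "dim (UNIV :: 'a::real_vector set) = n" "n > 0"
    and "independent S" "finite S" "card S = n"
  shows "span S = (UNIV :: 'a set)"
proof (rule ccontr)
  obtain B :: "'a set" where B: "independent B" "span B = UNIV" "card B = n"
    using basis_exists[of "UNIV :: 'a set"] assms(1) by (metis UNIV_I span_UNIV subset_antisym subsetI)
  have "finite B" using B(3) assms(2) by (metis card.infinite less_not_refl)
  assume "span S \<noteq> UNIV"
  then obtain v where v: "v \<notin> span S" by blast
  then have "independent (insert v S)" "v \<notin> S"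
    using assms(3) by (auto simp: independent_insert intro: span_base)
  then have "card (insert v S) \<le> card B"
    using independent_span_bound[OF \<open>finite B\<close>, of "insert v S"] B by auto
  then show False using B(3) assms(4,5) \<open>v \<notin> S\<close> by simp
qed

lemma ordered_basis_four:
  assumes "dim (UNIV :: 'a::real_vector set) = 4"
    and "\<And>a b c d. a *\<^sub>R w + b *\<^sub>R x + c *\<^sub>R y + d *\<^sub>R z = 0 \<Longrightarrow> a = 0 \<and> b = 0 \<and> c = 0 \<and> d = 0"
  shows "ordered_basis [w, x, y, z :: 'a]"
proof -
  have "distinct [w, x, y, z]" "independent {w, x, y, z}"
    using assms(2) independent_four_iff[of w x y z] by blast+
  then show ?thesis
    using independent_card_dim_spans[OF assms(1), of "{w, x, y, z}"]
    by (auto simp: ordered_basis_def)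
qed

lemma has_jordan_nf_basis:
  assumes "ordered_basis bs" "complex_matrix_of bs T = jordan_matrix n_as" "0 \<notin> fst ` set n_as"
  shows "has_jordan_nf T n_as"
  using assms similar_mat_refl[OF jordan_matrix_carrier[of n_as]]
  unfolding has_jordan_nf_def jordan_nf_def by auto

lemma jordan_nf_zero_map:
  assumes "dim (UNIV :: 'a::real_vector set) = 4"
  shows "has_jordan_nf (\<lambda>x::'a. 0) [(1, 0), (1, 0), (1, 0), (1, 0)]"
proof -
  obtain B :: "'a set" where B: "independent B" "span B = UNIV" "card B = 4"
    using basis_exists[of "UNIV :: 'a set"] assms by (metis UNIV_I span_UNIV subset_antisym subsetI)
  then obtain bs where bs: "distinct bs" "set bs = B" "length bs = 4"
    by (metis card.infinite distinct_card finite_distinct_list zero_neq_numeral)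
  show ?thesis
  proof (rule has_jordan_nf_basis)
    show "ordered_basis bs" using B bs by (simp add: ordered_basis_def)
    show "complex_matrix_of bs (\<lambda>x. 0) = jordan_matrix [(1, 0), (1, 0), (1, 0), (1, 0)]"
      using bs B by (intro eq_matI) (auto simp: complex_matrix_of_def representation_zero jordan_matrix_def
          jordan_block_def Let_def numeral_eq_Suc less_Suc_eq)
  qed auto
qed

text \<open>
  The basis \<open>T x, x, T y, y\<close> exhibits two Jordan blocks: applying \<open>T\<close> to a linear relation between these
  vectors first kills the coefficients of \<open>x\<close> and \<open>y\<close>.
\<close>

lemma jordan_nf_square_zero_rank_two:
  fixes T :: "'a::real_vector \<Rightarrow> 'a"
  assumes d: "dim (UNIV :: 'a set) = 4" and T: "linear T" "\<And>x. T (T x) = 0"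
    and ind: "\<And>a b. a *\<^sub>R T x + b *\<^sub>R T y = 0 \<Longrightarrow> a = 0 \<and> b = 0"
  shows "has_jordan_nf T [(2, 0), (2, 0)]"
proof (rule has_jordan_nf_basis)
  show ob: "ordered_basis [T x, x, T y, y]"
  proof (rule ordered_basis_four[OF d])
    fix a b c e assume e: "a *\<^sub>R T x + b *\<^sub>R x + c *\<^sub>R T y + e *\<^sub>R y = 0"
    have "T (a *\<^sub>R T x + b *\<^sub>R x + c *\<^sub>R T y + e *\<^sub>R y) = b *\<^sub>R T x + e *\<^sub>R T y"
      using T by (simp add: linear_add linear_scale)
    with e have "b *\<^sub>R T x + e *\<^sub>R T y = 0" using T(1) by (simp add: linear_0)
    then have be: "b = 0" "e = 0" using ind by blast+
    with e have "a *\<^sub>R T x + c *\<^sub>R T y = 0" by simp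
    with be show "a = 0 \<and> b = 0 \<and> c = 0 \<and> e = 0" using ind by blast
  qed
  have b: "independent {T x, x, T y, y}" "T x \<noteq> x" "T x \<noteq> T y" "T x \<noteq> y" "x \<noteq> T y" "x \<noteq> y" "T y \<noteq> y"
    using ob by (auto simp: ordered_basis_def)
  show "complex_matrix_of [T x, x, T y, y] T = jordan_matrix [(2, 0), (2, 0)]"
    by (rule eq_matI)
      (use b b(2-)[symmetric] T in \<open>auto simp: complex_matrix_of_def representation_zero representation_basis jordan_matrix_def
          jordan_block_def Let_def numeral_eq_Suc less_Suc_eq\<close>)
qed auto

text \<open>
  Extend \<open>w, x\<close> to a basis and subtract multiples of \<open>x\<close> so that the two further vectors lie in the
  kernel of \<open>l\<close>.
\<close>

lemma jordan_nf_square_zero_rank_one: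
  fixes T :: "'a::real_vector \<Rightarrow> 'a"
  assumes d: "dim (UNIV :: 'a set) = 4" and l: "linear l" "l x = 1" "l w = 0" and w: "w \<noteq> 0"
    and T: "\<And>y. T y = l y *\<^sub>R w"
  shows "has_jordan_nf T [(2, 0), (1, 0), (1, 0)]"
proof -
  have "x \<notin> span {w}"
  proof
    assume "x \<in> span {w}"
    then obtain k where "x = k *\<^sub>R w" by (auto simp: span_singleton)
    then show False using l by (simp add: linear_scale)
  qed
  then have "independent {x, w}" and wx: "w \<noteq> x"
    using w by (auto simp: independent_insert span_base)
  then have iwx: "independent {w, x}" by (simp add: insert_commute)
  define B where "B = extend_basis {w, x}"
  have B: "{w, x} \<subseteq> B" "independent B" "span B = UNIV"
    using extend_basis_superset independent_extend_basis span_extend_basis iwx unfolding B_def by blast+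
  have cB: "card B = 4" using dim_eq_card[of B UNIV] B d by (metis dim_eq_card span_UNIV)
  then have "finite B" by (metis card.infinite zero_neq_numeral)
  then have "card (B - {w, x}) = 2" using cB B(1) wx by (simp add: card_Diff_subset)
  then obtain y z where yz: "B - {w, x} = {y, z}" "y \<noteq> z" by (auto simp: card_2_iff)
  then have Beq: "B = {w, x, y, z}" using B(1) by blast
  have "distinct [w, x, y, z]" using wx yz by auto
  then have ind: "a = 0 \<and> b = 0 \<and> c = 0 \<and> e = 0" if "a *\<^sub>R w + b *\<^sub>R x + c *\<^sub>R y + e *\<^sub>R z = 0" for a b c e
    using independent_four_iff[of w x y z] B(2) that unfolding Beq by blast
  define y' z' where "y' = y - l y *\<^sub>R x" and "z' = z - l z *\<^sub>R x"
  have l': "l y' = 0" "l z' = 0" using l by (simp_all add: y'_def z'_def linear_diff linear_scale)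
  have ob: "ordered_basis [w, x, y', z']"
  proof (rule ordered_basis_four[OF d])
    fix a b c e assume "a *\<^sub>R w + b *\<^sub>R x + c *\<^sub>R y' + e *\<^sub>R z' = 0"
    then have "a *\<^sub>R w + (b - c * l y - e * l z) *\<^sub>R x + c *\<^sub>R y + e *\<^sub>R z = 0"
      by (simp add: y'_def z'_def algebra_simps)
    from ind[OF this] show "a = 0 \<and> b = 0 \<and> c = 0 \<and> e = 0" by auto
  qed
  have b: "independent {w, x, y', z'}" "w \<noteq> x" "w \<noteq> y'" "w \<noteq> z'" "x \<noteq> y'" "x \<noteq> z'" "y' \<noteq> z'"
    using ob by (auto simp: ordered_basis_def)
  show ?thesis
  proof (rule has_jordan_nf_basis[OF ob])
    show "complex_matrix_of [w, x, y', z'] T = jordan_matrix [(2, 0), (1, 0), (1, 0)]"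
      by (rule eq_matI)
        (use b b(2-)[symmetric] l l' T in \<open>auto simp: complex_matrix_of_def representation_zero representation_basis jordan_matrix_def
          jordan_block_def Let_def numeral_eq_Suc less_Suc_eq\<close>)
  qed auto
qed

section \<open>Forms of signature (2,2)\<close>

text \<open>
  The cross product of the two coordinate rows is a relation, unless the rows are proportional.
\<close>

lemma plane_relation:
  fixes p1 p2 q1 q2 r1 r2 :: real
  obtains a b c where "a \<noteq> 0 \<or> b \<noteq> 0 \<or> c \<noteq> 0" "a * p1 + b * q1 + c * r1 = 0" "a * p2 + b * q2 + c * r2 = 0"
proof (cases "q1 * r2 - r1 * q2 = 0 \<and> r1 * p2 - p1 * r2 = 0 \<and> p1 * q2 - q1 * p2 = 0")
  case False
  then show ?thesis
    by (intro that[of "q1 * r2 - r1 * q2" "r1 * p2 - p1 * r2" "p1 * q2 - q1 * p2"]) (auto simp: algebra_simps)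
next
  case True
  show ?thesis
  proof (cases "p1 = 0 \<and> p2 = 0")
    case True
    then show ?thesis by (intro that[of 1 0 0]) auto
  next
    case False
    then consider "p1 \<noteq> 0" | "p2 \<noteq> 0" by blast
    then show ?thesis
    proof cases
      case 1
      with True show ?thesis by (intro that[of "- q1" p1 0]) (auto simp: algebra_simps)
    next
      case 2
      with True show ?thesis by (intro that[of "- q2" p2 0]) (auto simp: algebra_simps)
    qed
  qed
qed

locale neutral_form =
  fixes g :: "'a::real_vector \<Rightarrow> 'a \<Rightarrow> real"
  assumes bil: "bilinear g" and sym: "g x y = g y x"
    and nondeg: "nondegenerate g" and sig: "has_signature g 2 2"
begin

lemma g_linear: "linear (g x)" "linear (\<lambda>x. g x y)"
  using bil unfolding bilinear_def by auto

lemma g_simps [simp]: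
  "g (x + y) z = g x z + g y z" "g z (x + y) = g z x + g z y"
  "g (k *\<^sub>R x) y = k * g x y" "g x (k *\<^sub>R y) = k * g x y"
  "g (- x) y = - g x y" "g x (- y) = - g x y"
  "g (x - y) z = g x z - g y z" "g z (x - y) = g z x - g z y"
  "g 0 y = 0" "g y 0 = 0"
  using bil by (simp_all add: bilinear_ladd bilinear_radd bilinear_lmul bilinear_rmul bilinear_lneg
      bilinear_rneg bilinear_lsub bilinear_rsub bilinear_lzero bilinear_rzero)

lemma g_eqI: "x = y" if "\<And>z. g x z = g y z"
proof -
  have "\<forall>z. g (x - y) z = 0" using that by simp
  then have "x - y = 0" using nondeg unfolding nondegenerate_def by blast
  then show ?thesis by simp
qed

lemma g_eq_0_spanning: "x = 0" if "span S = UNIV" "\<And>z. z \<in> S \<Longrightarrow> g x z = 0"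
proof -
  have "subspace {z. g x z = 0}" by (auto simp: subspace_def)
  then have "span S \<subseteq> {z. g x z = 0}" using that(2) by (intro span_minimal) auto
  then show ?thesis using that(1) by (intro g_eqI) auto
qed

lemma orthonormal_frame:
  obtains e1 e2 e3 e4 where
    "g e1 e1 = -1" "g e2 e2 = -1" "g e3 e3 = 1" "g e4 e4 = 1"
    "g e1 e2 = 0" "g e1 e3 = 0" "g e1 e4 = 0" "g e2 e3 = 0" "g e2 e4 = 0" "g e3 e4 = 0"
    "independent {e1, e2, e3, e4}" "distinct [e1, e2, e3, e4]" "span {e1, e2, e3, e4} = UNIV"
proof -
  obtain B where B: "finite B" "independent B" "span B = UNIV"
    "\<And>b c. b \<in> B \<Longrightarrow> c \<in> B \<Longrightarrow> b \<noteq> c \<Longrightarrow> g b c = 0"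
    "\<And>b. b \<in> B \<Longrightarrow> g b b = 1 \<or> g b b = -1"
    "card {b\<in>B. g b b = -1} = 2" "card {b\<in>B. g b b = 1} = 2"
    using sig unfolding has_signature_def by blast
  obtain e1 e2 where e12: "{b\<in>B. g b b = -1} = {e1, e2}" "e1 \<noteq> e2" using B(6) unfolding card_2_iff by blast
  obtain e3 e4 where e34: "{b\<in>B. g b b = 1} = {e3, e4}" "e3 \<noteq> e4" using B(7) unfolding card_2_iff by blast
  have Beq: "B = {e1, e2, e3, e4}" using e12(1) e34(1) B(5) by blast
  have n: "g e1 e1 = -1" "g e2 e2 = -1" "g e3 e3 = 1" "g e4 e4 = 1" using e12 e34 by blast+
  then have ne: "e1 \<noteq> e3" "e1 \<noteq> e4" "e2 \<noteq> e3" "e2 \<noteq> e4" by auto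
  show ?thesis
    by (rule that[of e1 e2 e3 e4]) (use n ne e12(2) e34(2) B(2,3,4) in \<open>auto simp: Beq\<close>)
qed

lemma dim_four: "dim (UNIV :: 'a set) = 4"
proof -
  obtain e1 e2 e3 e4 where e: "independent {e1, e2, e3, e4}" "distinct [e1, e2, e3, e4]" "span {e1, e2, e3, e4} = (UNIV :: 'a set)"
    by (rule orthonormal_frame)
  have "card {e1, e2, e3, e4} = 4" using e(2) by simp
  then show ?thesis using e dim_eq_card[of "{e1, e2, e3, e4}" UNIV] by simp
qed

text \<open>
  The prototype is the frame of pure tensors \<open>e\<^sub>1 \<otimes> f\<^sub>1, e\<^sub>1 \<otimes> f\<^sub>2, e\<^sub>2 \<otimes> f\<^sub>1, e\<^sub>2 \<otimes> f\<^sub>2\<close> in a product of two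
  planes with area forms, on which \<open>g\<close> is the product of the area forms. The last clause is
  the resulting expansion of a vector.
\<close>

definition null_frame :: "'a \<Rightarrow> 'a \<Rightarrow> 'a \<Rightarrow> 'a \<Rightarrow> bool" where
  "null_frame a b c d \<longleftrightarrow>
     g a a = 0 \<and> g b b = 0 \<and> g c c = 0 \<and> g d d = 0 \<and>
     g a b = 0 \<and> g a c = 0 \<and> g b d = 0 \<and> g c d = 0 \<and> g a d = 1 \<and> g b c = -1 \<and>
     (\<forall>x. x = g x d *\<^sub>R a - g x c *\<^sub>R b - g x b *\<^sub>R c + g x a *\<^sub>R d)"

lemma null_frameI:
  assumes "g a a = 0" "g b b = 0" "g c c = 0" "g d d = 0"
    "g a b = 0" "g a c = 0" "g b d = 0" "g c d = 0" "g a d = 1" "g b c = -1"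
  shows "null_frame a b c d"
proof -
  note f = assms assms(5-)[THEN trans[OF sym]]
  have ob: "ordered_basis [a, b, c, d]"
  proof (rule ordered_basis_four[OF dim_four])
    fix i j k l
    assume "i *\<^sub>R a + j *\<^sub>R b + k *\<^sub>R c + l *\<^sub>R d = 0"
    then have "g (i *\<^sub>R a + j *\<^sub>R b + k *\<^sub>R c + l *\<^sub>R d) z = 0" for z by simp
    from this[of a] this[of b] this[of c] this[of d] show "i = 0 \<and> j = 0 \<and> k = 0 \<and> l = 0"
      using f by simp
  qed
  have "x - (g x d *\<^sub>R a - g x c *\<^sub>R b - g x b *\<^sub>R c + g x a *\<^sub>R d) = 0" for x
    by (rule g_eq_0_spanning[of "{a, b, c, d}"]) (use ob f in \<open>auto simp: ordered_basis_def\<close>)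
  then show ?thesis using assms unfolding null_frame_def by simp
qed

lemma null_frame_exists: obtains a b c d where "null_frame a b c d"
proof -
  obtain e1 e2 e3 e4 where e: "g e1 e1 = -1" "g e2 e2 = -1" "g e3 e3 = 1" "g e4 e4 = 1"
    "g e1 e2 = 0" "g e1 e3 = 0" "g e1 e4 = 0" "g e2 e3 = 0" "g e2 e4 = 0" "g e3 e4 = 0"
    by (rule orthonormal_frame)
  note e' = e e(5-)[THEN trans[OF sym]]
  have "null_frame (e1 + e3) (e2 + e4) ((1/2) *\<^sub>R (e2 - e4)) ((1/2) *\<^sub>R (e3 - e1))"
    by (rule null_frameI) (use e' in simp_all)
  then show ?thesis by (rule that)
qed

lemma null_frame_simps:
  assumes "null_frame a b c d"
  shows "g a a = 0" "g b b = 0" "g c c = 0" "g d d = 0"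
    "g a b = 0" "g a c = 0" "g b d = 0" "g c d = 0" "g a d = 1" "g b c = -1"
    "g b a = 0" "g c a = 0" "g d b = 0" "g d c = 0" "g d a = 1" "g c b = -1"
proof -
  show f: "g a a = 0" "g b b = 0" "g c c = 0" "g d d = 0"
    "g a b = 0" "g a c = 0" "g b d = 0" "g c d = 0" "g a d = 1" "g b c = -1"
    using assms unfolding null_frame_def by blast+
  show "g b a = 0" "g c a = 0" "g d b = 0" "g d c = 0" "g d a = 1" "g c b = -1"
    using f(5-)[THEN trans[OF sym]] by blast+
qed

lemma null_frame_expand:
  assumes "null_frame a b c d"
  shows "x = g x d *\<^sub>R a - g x c *\<^sub>R b - g x b *\<^sub>R c + g x a *\<^sub>R d"
  using assms unfolding null_frame_def by blast

text \<open>
  Unimodular changes of basis in the two tensor factors preserve null frames. This is what turns a condition on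
  all null frames into polynomial identities in \<open>s\<close> and \<open>t\<close>.
\<close>

lemma null_frame_tensor:
  fixes s1 s2 :: real
  assumes f: "null_frame a b c d" and s: "s1 * s2' - s2 * s1' = 1" and t: "t1 * t2' - t2 * t1' = 1"
  defines "T \<equiv> \<lambda>s1 s2 t1 t2. (s1 * t1) *\<^sub>R a + (s1 * t2) *\<^sub>R b + (s2 * t1) *\<^sub>R c + (s2 * t2) *\<^sub>R d"
  shows "null_frame (T s1 s2 t1 t2) (T s1 s2 t1' t2') (T s1' s2' t1 t2) (T s1' s2' t1' t2')"
proof -
  have gT: "g (T p q u v) (T p' q' u' v') = (p * q' - q * p') * (u * v' - v * u')" for p q u v p' q' u' v'
    using null_frame_simps[OF f] by (simp add: T_def algebra_simps)
  show ?thesis by (rule null_frameI) (use s t in \<open>simp_all add: gT algebra_simps\<close>)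
qed

text \<open>
  In the tensor picture these are the traceless \<open>2 \<times> 2\<close> matrices acting on the first factor: a quarter turn, a
  reflection with eigenvectors \<open>e\<^sub>1, e\<^sub>2\<close>, and the reflection that exchanges them.
\<close>

lemma frame_structure:
  assumes f: "null_frame a b c d"
  defines "I \<equiv> \<lambda>x. g x d *\<^sub>R c - g x c *\<^sub>R d + g x b *\<^sub>R a - g x a *\<^sub>R b"
    and "J \<equiv> \<lambda>x. g x d *\<^sub>R a - g x c *\<^sub>R b + g x b *\<^sub>R c - g x a *\<^sub>R d"
    and "K \<equiv> \<lambda>x. g x d *\<^sub>R c - g x c *\<^sub>R d - g x b *\<^sub>R a + g x a *\<^sub>R b"
  shows "paraquaternionic_structure g I J K"
proof -
  note n = null_frame_simps[OF f]
  have skew: "skew_adjoint g I" "skew_adjoint g J" "skew_adjoint g K"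
    unfolding skew_adjoint_def I_def J_def K_def
    by (auto intro!: linearI simp: algebra_simps sym[of a] sym[of b] sym[of c] sym[of d])
  have e: "g x d *\<^sub>R a - g x c *\<^sub>R b - g x b *\<^sub>R c + g x a *\<^sub>R d = x" for x
    by (rule null_frame_expand[OF f, symmetric])
  have "I (I x) = - (g x d *\<^sub>R a - g x c *\<^sub>R b - g x b *\<^sub>R c + g x a *\<^sub>R d)"
    "J (J x) = g x d *\<^sub>R a - g x c *\<^sub>R b - g x b *\<^sub>R c + g x a *\<^sub>R d"
    "K (K x) = g x d *\<^sub>R a - g x c *\<^sub>R b - g x b *\<^sub>R c + g x a *\<^sub>R d" for x
    by (simp_all add: I_def J_def K_def n)
  moreover have "I (J x) + J (I x) = 0" "I (K x) + K (I x) = 0" "J (K x) + K (J x) = 0" for x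
    by (simp_all add: I_def J_def K_def n)
  ultimately show ?thesis
    unfolding paraquaternionic_structure_def e using skew by blast
qed

text \<open>
  A totally isotropic subspace has dimension at most \<open>2\<close>: among three vectors, some nontrivial combination has no
  component in the two negative directions, and an isotropic vector of the positive plane is \<open>0\<close>.
\<close>

lemma isotropic_dependent:
  assumes "g p p = 0" "g q q = 0" "g r r = 0" "g p q = 0" "g p r = 0" "g q r = 0"
  obtains a b c where "a \<noteq> 0 \<or> b \<noteq> 0 \<or> c \<noteq> 0" "a *\<^sub>R p + b *\<^sub>R q + c *\<^sub>R r = 0"
proof -
  obtain e1 e2 e3 e4 where e: "g e1 e1 = -1" "g e2 e2 = -1" "g e3 e3 = 1" "g e4 e4 = 1"
    "g e1 e2 = 0" "g e1 e3 = 0" "g e1 e4 = 0" "g e2 e3 = 0" "g e2 e4 = 0" "g e3 e4 = 0"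
    and s: "span {e1, e2, e3, e4} = UNIV"
    by (rule orthonormal_frame)
  note e' = e e(5-)[THEN trans[OF sym]]
  obtain a b c where abc: "a \<noteq> 0 \<or> b \<noteq> 0 \<or> c \<noteq> 0"
    "a * g p e1 + b * g q e1 + c * g r e1 = 0" "a * g p e2 + b * g q e2 + c * g r e2 = 0"
    by (rule plane_relation)
  define w where "w = a *\<^sub>R p + b *\<^sub>R q + c *\<^sub>R r"
  have we: "g w e1 = 0" "g w e2 = 0" using abc by (auto simp: w_def)
  have "w - (g w e3 *\<^sub>R e3 + g w e4 *\<^sub>R e4) = 0"
    by (rule g_eq_0_spanning[OF s]) (use e' we in auto)
  then have w: "w = g w e3 *\<^sub>R e3 + g w e4 *\<^sub>R e4" by simp
  have "g w w = 0" using assms by (simp add: w_def sym[of q p] sym[of r p] sym[of r q])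
  moreover have "g w w = (g w e3)\<^sup>2 + (g w e4)\<^sup>2"
    by (subst (2) w) (simp add: power2_eq_square)
  ultimately have "g w e3 = 0" "g w e4 = 0" by (simp_all add: sum_power2_eq_zero_iff)
  with w have "w = 0" by simp
  with abc(1) show ?thesis using that unfolding w_def by blast
qed

text \<open>
  Otherwise the functional of \<open>p\<close> would vanish on the kernel of that of \<open>r\<close>, making \<open>p\<close> a multiple
  of \<open>r\<close>.
\<close>

lemma dual_vector_exists:
  assumes "\<And>a b. a *\<^sub>R p + b *\<^sub>R r = 0 \<Longrightarrow> a = 0 \<and> b = 0"
  obtains y where "g y p = 1" "g y r = 0"
proof (cases "\<exists>y. g y r = 0 \<and> g y p \<noteq> 0")
  case True
  then obtain y where "g y r = 0" "g y p \<noteq> 0" by blast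
  then show ?thesis by (intro that[of "(1 / g y p) *\<^sub>R y"]) auto
next
  case False
  have "r \<noteq> 0" using assms[of 0 1] by auto
  then obtain y0 where y0: "g r y0 \<noteq> 0" using nondeg unfolding nondegenerate_def by blast
  have proportional: "g p y = (g p y0 / g r y0) * g r y" for y
  proof -
    have "g (y - (g r y / g r y0) *\<^sub>R y0) r = 0" using y0 by (simp add: sym[of _ r])
    then have "g (y - (g r y / g r y0) *\<^sub>R y0) p = 0" using False by blast
    then show ?thesis using y0 by (simp add: sym[of _ p] field_simps)
  qed
  have "p = (g p y0 / g r y0) *\<^sub>R r"
    by (rule g_eqI) (simp only: g_simps proportional[symmetric])
  then have "1 *\<^sub>R p + (- (g p y0 / g r y0)) *\<^sub>R r = 0" by simp
  from assms[OF this] show ?thesis by simp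
qed

lemma null_partner_exists:
  assumes "x \<noteq> 0" "g x x = 0"
  obtains y where "g y y = 0" "g x y = 1"
proof -
  obtain z where z: "g x z \<noteq> 0" using assms nondeg unfolding nondegenerate_def by blast
  define y where "y = (1 / g x z) *\<^sub>R (z - (g z z / (2 * g x z)) *\<^sub>R x)"
  have "g x y = 1" using z assms by (simp add: y_def)
  moreover have "g y y = 0" using z assms by (simp add: y_def sym[of z x] field_simps)
  ultimately show ?thesis by (rule that[rotated])
qed

end

section \<open>Paraquaternionic structures\<close>

locale paraquaternionic = neutral_form +
  fixes I J K :: "'a \<Rightarrow> 'a"
  assumes triple: "paraquaternionic_structure g I J K"
begin

lemma lin: "linear I" "linear J" "linear K"
  using triple unfolding paraquaternionic_structure_def skew_adjoint_def by blast+

lemma triple_simps [simp]: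
  "I (x + y) = I x + I y" "J (x + y) = J x + J y" "K (x + y) = K x + K y"
  "I (x - y) = I x - I y" "J (x - y) = J x - J y" "K (x - y) = K x - K y"
  "I (c *\<^sub>R x) = c *\<^sub>R I x" "J (c *\<^sub>R x) = c *\<^sub>R J x" "K (c *\<^sub>R x) = c *\<^sub>R K x"
  "I (- x) = - I x" "J (- x) = - J x" "K (- x) = - K x"
  "I 0 = 0" "J 0 = 0" "K 0 = 0"
  "I (I x) = - x" "J (J x) = x" "K (K x) = x"
  "J (I x) = - I (J x)" "K (I x) = - I (K x)" "K (J x) = - J (K x)"
  using lin triple unfolding paraquaternionic_structure_def
  by (simp_all add: linear_add linear_diff linear_scale linear_neg linear_0 eq_neg_iff_add_eq_0 add.commute)

lemma skew: "g (I x) y = - g x (I y)" "g (J x) y = - g x (J y)" "g (K x) y = - g x (K y)"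
  using triple unfolding paraquaternionic_structure_def skew_adjoint_def by blast+

lemma g_self [simp]: "g x (I x) = 0" "g x (J x) = 0" "g x (K x) = 0"
  "g (I x) x = 0" "g (J x) x = 0" "g (K x) x = 0"
  using skew[of x x] sym[of x "I x"] sym[of x "J x"] sym[of x "K x"] by auto

lemma g_images [simp]:
  "g (I x) (I x) = g x x" "g (J x) (J x) = - g x x" "g (K x) (K x) = - g x x"
  "g (I x) (J x) = 0" "g (I x) (K x) = 0" "g (J x) (K x) = 0"
  "g (J x) (I x) = 0" "g (K x) (I x) = 0" "g (K x) (J x) = 0"
proof -
  show 1: "g (I x) (I x) = g x x" "g (J x) (J x) = - g x x" "g (K x) (K x) = - g x x" by (simp_all add: skew)
  have "g x (I (J x)) = g (J (I x)) x" by (simp add: skew)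
  then have "g x (I (J x)) = 0" by (simp add: sym[of _ x])
  then show "g (I x) (J x) = 0" "g (J x) (I x) = 0" by (simp_all add: skew)
  have "g x (I (K x)) = g (K (I x)) x" by (simp add: skew)
  then have "g x (I (K x)) = 0" by (simp add: sym[of _ x])
  then show "g (I x) (K x) = 0" "g (K x) (I x) = 0" by (simp_all add: skew)
  have "g x (J (K x)) = g (K (J x)) x" by (simp add: skew)
  then have "g x (J (K x)) = 0" by (simp add: sym[of _ x])
  then show "g (J x) (K x) = 0" "g (K x) (J x) = 0" by (simp_all add: skew)
qed

text \<open>
  The four vectors are pairwise orthogonal, and none of them is null.
\<close>

lemma nonnull_expansion:
  assumes "g x x \<noteq> 0"
  shows "ordered_basis [x, I x, J x, K x]"
    and "g x x *\<^sub>R y = g y x *\<^sub>R x + g y (I x) *\<^sub>R I x - g y (J x) *\<^sub>R J x - g y (K x) *\<^sub>R K x"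
proof -
  show ob: "ordered_basis [x, I x, J x, K x]"
  proof (rule ordered_basis_four[OF dim_four])
    fix a b c d
    assume "a *\<^sub>R x + b *\<^sub>R I x + c *\<^sub>R J x + d *\<^sub>R K x = 0"
    then have "g (a *\<^sub>R x + b *\<^sub>R I x + c *\<^sub>R J x + d *\<^sub>R K x) z = 0" for z by simp
    from this[of x] this[of "I x"] this[of "J x"] this[of "K x"] show "a = 0 \<and> b = 0 \<and> c = 0 \<and> d = 0"
      using assms by simp
  qed
  have "g x x *\<^sub>R y - (g y x *\<^sub>R x + g y (I x) *\<^sub>R I x - g y (J x) *\<^sub>R J x - g y (K x) *\<^sub>R K x) = 0"
    by (rule g_eq_0_spanning[of "{x, I x, J x, K x}"]) (use ob in \<open>auto simp: ordered_basis_def\<close>)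
  then show "g x x *\<^sub>R y = g y x *\<^sub>R x + g y (I x) *\<^sub>R I x - g y (J x) *\<^sub>R J x - g y (K x) *\<^sub>R K x" by simp
qed

text \<open>
  For nonnull \<open>x\<close> this is the expansion of \<open>y\<close> in the orthogonal basis \<open>x, I x, J x, K x\<close>. Both sides are
  quadratic in \<open>x\<close>, so the identity extends to a null \<open>x\<close> along a line through \<open>x\<close> that meets the null
  cone in \<open>x\<close> alone. It expresses the tensor of constant curvature by the three tensors of the structure.
\<close>

lemma lagrange_identity:
  "g x x * g y y = (g y x)\<^sup>2 + (g y (I x))\<^sup>2 - (g y (J x))\<^sup>2 - (g y (K x))\<^sup>2"
proof (cases "x = 0")
  case False
  define F where "F x = g x x * g y y - ((g y x)\<^sup>2 + (g y (I x))\<^sup>2 - (g y (J x))\<^sup>2 - (g y (K x))\<^sup>2)" for x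
  have nonnull: "F x = 0" if "g x x \<noteq> 0" for x
    using arg_cong[OF nonnull_expansion(2)[OF that, of y], of "g y"] by (simp add: F_def power2_eq_square)
  have "F x = 0"
  proof (cases "g x x = 0")
    case True
    obtain z where z: "g z z = 0" "g x z = 1" by (rule null_partner_exists[OF False True])
    have "F (x + z) = 0" "F (x - z) = 0" "F (x + 2 *\<^sub>R z) = 0"
      using True z by (auto intro!: nonnull simp: sym[of z x])
    \<comment> \<open>The function \<open>F\<close> is quadratic, so its values at three other points of the line give its value at \<open>x\<close>.\<close>
    moreover have "2 * F (x + 2 *\<^sub>R z) - 6 * F (x + z) - 2 * F (x - z) = - 6 * F x"
      unfolding F_def by (simp add: power2_eq_square algebra_simps)
    ultimately show ?thesis by simp
  qed (rule nonnull)
  then show ?thesis by (simp add: F_def)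
qed simp

lemma JK_independent:
  assumes "v \<noteq> 0" "a *\<^sub>R J v + b *\<^sub>R K v = 0"
  shows "a = 0 \<and> b = 0"
proof -
  have "(a * a + b * b) *\<^sub>R v = a *\<^sub>R J (a *\<^sub>R J v + b *\<^sub>R K v) + b *\<^sub>R K (a *\<^sub>R J v + b *\<^sub>R K v)"
    by (simp add: algebra_simps)
  also have "\<dots> = 0" unfolding assms(2) by simp
  finally have "a * a + b * b = 0" using assms(1) by simp
  then show ?thesis using sum_squares_eq_zero_iff by blast
qed

text \<open>
  The vectors \<open>I v, J v, K v\<close> span a totally isotropic space, and \<open>J v, K v\<close> are independent. Applying \<open>I\<close>
  twice to \<open>v\<close> puts the two coefficients on the unit circle.
\<close>

lemma null_direction:
  assumes "v \<noteq> 0" "g v v = 0"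
  obtains s t where "s\<^sup>2 + t\<^sup>2 = 1" "I v = s *\<^sub>R J v + t *\<^sub>R K v"
proof -
  obtain a b c where abc: "a \<noteq> 0 \<or> b \<noteq> 0 \<or> c \<noteq> 0" "a *\<^sub>R J v + b *\<^sub>R K v + c *\<^sub>R I v = 0"
    by (rule isotropic_dependent[of "J v" "K v" "I v"]) (use assms in auto)
  have "c \<noteq> 0"
  proof
    assume "c = 0"
    with abc JK_independent[OF assms(1), of a b] show False by simp
  qed
  define s t where "s = - a / c" and "t = - b / c"
  have "c *\<^sub>R I v = c *\<^sub>R (s *\<^sub>R J v + t *\<^sub>R K v)"
    using abc(2) \<open>c \<noteq> 0\<close> by (simp add: s_def t_def algebra_simps eq_neg_iff_add_eq_0)
  then have Iv: "I v = s *\<^sub>R J v + t *\<^sub>R K v" using \<open>c \<noteq> 0\<close> by simp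
  have "v + I (I v) = 0" by simp
  have "I (I v) = s *\<^sub>R I (J v) + t *\<^sub>R I (K v)" using arg_cong[OF Iv, of I] by simp
  also have "\<dots> = - (s *\<^sub>R J (I v) + t *\<^sub>R K (I v))" by simp
  also have "\<dots> = - (s *\<^sub>R J (s *\<^sub>R J v + t *\<^sub>R K v) + t *\<^sub>R K (s *\<^sub>R J v + t *\<^sub>R K v))"
    unfolding Iv ..
  also have "\<dots> = - (s\<^sup>2 + t\<^sup>2) *\<^sub>R v" by (simp add: algebra_simps power2_eq_square)
  finally have "(s\<^sup>2 + t\<^sup>2 - 1) *\<^sub>R v = 0" by (simp add: algebra_simps)
  then have "s\<^sup>2 + t\<^sup>2 = 1" using assms(1) by simp
  then show ?thesis using Iv by (rule that)
qed

text \<open>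
  The operator \<open>N = I - s J - t K\<close> squares to zero and is skew-adjoint, so its image is null and is annihilated by
  \<open>N\<close>.
\<close>

lemma null_vector_with_direction:
  assumes "s\<^sup>2 + t\<^sup>2 = 1"
  obtains v where "v \<noteq> 0" "g v v = 0" "I v = s *\<^sub>R J v + t *\<^sub>R K v"
proof -
  define N where "N x = I x - s *\<^sub>R J x - t *\<^sub>R K x" for x
  have NN: "N (N x) = 0" for x
  proof -
    have "N (N x) = (s\<^sup>2 + t\<^sup>2 - 1) *\<^sub>R x" by (simp add: N_def algebra_simps power2_eq_square)
    then show ?thesis using assms by simp
  qed
  obtain e where e: "e \<noteq> (0::'a)" using orthonormal_frame by (metis g_simps(9) zero_neq_neg_one)
  have "\<exists>x. N x \<noteq> 0"
  proof (rule ccontr)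
    assume "\<nexists>x. N x \<noteq> 0"
    then have Ix: "I x = s *\<^sub>R J x + t *\<^sub>R K x" for x by (simp add: N_def algebra_simps)
    have "- e = I (I e)" by simp
    also have "\<dots> = s *\<^sub>R J (s *\<^sub>R J e + t *\<^sub>R K e) + t *\<^sub>R K (s *\<^sub>R J e + t *\<^sub>R K e)"
      by (simp only: Ix)
    also have "\<dots> = (s\<^sup>2 + t\<^sup>2) *\<^sub>R e" by (simp add: algebra_simps power2_eq_square)
    finally have "- e = e" using assms by simp
    then show False using e by (metis add_eq_0_iff scaleR_2 scaleR_eq_0_iff zero_neq_numeral)
  qed
  then obtain x where x: "N x \<noteq> 0" by blast
  have "g (N x) y = - g x (N y)" for y by (simp add: N_def skew)
  then have "g (N x) (N x) = 0" by (simp add: NN)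
  moreover have "I (N x) = s *\<^sub>R J (N x) + t *\<^sub>R K (N x)"
    using NN[of x] unfolding N_def[of "N x"] by (simp add: algebra_simps)
  ultimately show ?thesis using x by (intro that[of "N x"])
qed

end

section \<open>Algebraic curvature tensors\<close>

lemma curvature_tensor_linear:
  assumes "algebraic_curvature_tensor A"
  shows "linear (\<lambda>x. A x y z v)" "linear (\<lambda>y. A x y z v)" "linear (\<lambda>z. A x y z v)" "linear (\<lambda>v. A x y z v)"
proof -
  have "multilinear4 A" using assms unfolding algebraic_curvature_tensor_def by blast
  then show "linear (\<lambda>x. A x y z v)" "linear (\<lambda>y. A x y z v)" "linear (\<lambda>z. A x y z v)" "linear (\<lambda>v. A x y z v)"
    by (auto simp: multilinear4_def)
qed

lemma curvature_tensor_symmetries: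
  assumes "algebraic_curvature_tensor A"
  shows "A x y z v = - A y x z v" "A x y z v = A z v x y" "A x y z v + A y z x v + A z x y v = 0"
proof -
  note h = assms[unfolded algebraic_curvature_tensor_def, THEN conjunct2]
  show "A x y z v = - A y x z v" by (rule h[THEN conjunct1, rule_format])
  show "A x y z v = A z v x y" by (rule h[THEN conjunct2, THEN conjunct1, rule_format])
  show "A x y z v + A y z x v + A z x y v = 0" by (rule h[THEN conjunct2, THEN conjunct2, rule_format])
qed

text \<open>
  Polarising the vanishing of \<open>D y x x y\<close> makes the difference \<open>D\<close> alternate in its middle arguments. Then cyclic
  permutations of the first three arguments leave \<open>D\<close> unchanged, and the Bianchi identity reads
  \<open>3 D = 0\<close>.
\<close>

lemma curvature_determined:
  assumes "algebraic_curvature_tensor A" "algebraic_curvature_tensor B"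
    and eq: "\<And>x y. A y x x y = B y x x y"
  shows "A x y z v = B x y z v"
proof -
  define D where "D x y z v = A x y z v - B x y z v" for x y z v
  have lin: "D (x + x') y z v = D x y z v + D x' y z v" "D x (y + y') z v = D x y z v + D x y' z v"
    "D x y (z + z') v = D x y z v + D x y z' v" "D x y z (v + v') = D x y z v + D x y z v'" for x x' y y' z z' v v'
    using curvature_tensor_linear[OF assms(1), THEN linear_add] curvature_tensor_linear[OF assms(2), THEN linear_add]
    by (simp_all add: D_def)
  have a12: "D x y z v = - D y x z v" and pr: "D x y z v = D z v x y"
    and bi: "D x y z v + D y z x v + D z x y v = 0" for x y z v
  proof -
    note sa = curvature_tensor_symmetries[OF assms(1)] and sb = curvature_tensor_symmetries[OF assms(2)]
    show "D x y z v = - D y x z v" unfolding D_def using sa(1)[of x y z v] sb(1)[of x y z v] by linarith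
    show "D x y z v = D z v x y" unfolding D_def using sa(2)[of x y z v] sb(2)[of x y z v] by linarith
    show "D x y z v + D y z x v + D z x y v = 0" unfolding D_def using sa(3)[of x y z v] sb(3)[of x y z v] by linarith
  qed
  have sec: "D y x x y = 0" for x y by (simp add: D_def eq)
  have alternating: "D y x x z = 0" for x y z
  proof -
    have "D z x x y = D y x x z" using a12[of z x x y] pr[of x z x y] a12[of x y x z] by linarith
    moreover have "D (y + z) x x (y + z) = D y x x y + D y x x z + D z x x y + D z x x z"
      by (simp add: lin)
    ultimately show ?thesis using sec[of "y + z" x] sec[of y x] sec[of z x] by linarith
  qed
  have a23: "D y x w z = - D y w x z" for x y z w
  proof -
    have "D y (x + w) (x + w) z = D y x x z + D y x w z + D y w x z + D y w w z"
      by (simp add: lin)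
    then show ?thesis using alternating[of y "x + w" z] alternating[of y x z] alternating[of y w z] by linarith
  qed
  have "D y z x v = D x y z v" using a23[of y z x v] a12[of y x z v] by linarith
  moreover have "D z x y v = D x y z v" using a12[of z x y v] a23[of x z y v] by linarith
  ultimately have "D x y z v = 0" using bi[of x y z v] by linarith
  then show ?thesis by (simp add: D_def)
qed

locale curvature_model = neutral_form +
  fixes A :: "'a \<Rightarrow> 'a \<Rightarrow> 'a \<Rightarrow> 'a \<Rightarrow> real"
  assumes curv: "algebraic_curvature_tensor A"
begin

lemmas A_linear = curvature_tensor_linear[OF curv]

lemma A_simps [simp]:
  "A (x + x') y z v = A x y z v + A x' y z v" "A x (y + y') z v = A x y z v + A x y' z v"
  "A x y (z + z') v = A x y z v + A x y z' v" "A x y z (v + v') = A x y z v + A x y z v'"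
  "A (x - x') y z v = A x y z v - A x' y z v" "A x (y - y') z v = A x y z v - A x y' z v"
  "A x y (z - z') v = A x y z v - A x y z' v" "A x y z (v - v') = A x y z v - A x y z v'"
  "A (k *\<^sub>R x) y z v = k * A x y z v" "A x (k *\<^sub>R y) z v = k * A x y z v"
  "A x y (k *\<^sub>R z) v = k * A x y z v" "A x y z (k *\<^sub>R v) = k * A x y z v"
  by (simp_all add: A_linear[THEN linear_add] A_linear[THEN linear_diff] A_linear[THEN linear_scale])

lemmas A_swap12 = curvature_tensor_symmetries(1)[OF curv]
lemmas A_pair = curvature_tensor_symmetries(2)[OF curv]

lemma A_swap34: "A x y z v = - A x y v z"
  using A_pair[of x y z v] A_swap12[of z v x y] A_pair[of v z x y] by linarith

lemma A_diag [simp]: "A x x z v = 0" "A z v x x = 0"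
  using A_swap12[of x x z v] A_swap34[of z v x x] by auto

lemma jacobi_char: "g (jacobi g A x y) z = A y x x z"
proof -
  obtain a b c d where f: "null_frame a b c d" by (rule null_frame_exists)
  define w where "w = A y x x d *\<^sub>R a - A y x x c *\<^sub>R b - A y x x b *\<^sub>R c + A y x x a *\<^sub>R d"
  have w: "g w z = A y x x z" for z
  proof -
    have z: "z = g z d *\<^sub>R a - g z c *\<^sub>R b - g z b *\<^sub>R c + g z a *\<^sub>R d"
      using f unfolding null_frame_def by blast
    have "A y x x z = A y x x (g z d *\<^sub>R a - g z c *\<^sub>R b - g z b *\<^sub>R c + g z a *\<^sub>R d)"
      using arg_cong[OF z, of "A y x x"] .
    then show ?thesis by (simp add: w_def sym[of _ z])
  qed
  have "jacobi g A x y = w"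
    unfolding jacobi_def by (rule the_equality) (auto simp: w intro!: g_eqI)
  then show ?thesis using w by simp
qed

lemma jacobi_linear: "linear (jacobi g A x)"
  by (intro linearI g_eqI) (simp_all add: jacobi_char)

lemma jacobi_scale: "jacobi g A (k *\<^sub>R x) y = k\<^sup>2 *\<^sub>R jacobi g A x y"
  by (intro g_eqI) (simp add: jacobi_char power2_eq_square)

section \<open>Nilpotent null Jacobi operators\<close>

text \<open>
  Modulo \<open>a\<close>, the Jacobi operator of \<open>a\<close> acts on the span of \<open>b\<close> and \<open>c\<close> with equal diagonal entries \<open>p\<close>
  and off-diagonal entries \<open>q\<close> and \<open>r\<close>. Such a matrix is nilpotent only if its trace \<open>2 p\<close> and its determinant
  \<open>p\<^sup>2 - q r\<close> vanish.
\<close>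

lemma nilpotent_frame:
  assumes f: "null_frame a b c d" and nil: "\<And>x. (jacobi g A a ^^ 4) x = 0"
  shows "A b a a c = 0" and "A b a a b * A c a a c = 0"
proof -
  let ?T = "jacobi g A a"
  define p q r where "p = - A b a a c" and "q = - A b a a b" and "r = - A c a a c"
  have T: "?T (x + y) = ?T x + ?T y" "?T (k *\<^sub>R x) = k *\<^sub>R ?T x" for x y k
    using jacobi_linear by (simp_all add: linear_add linear_scale)
  have sy: "A c a a b = A b a a c"
    using A_swap12[of c a a b] A_pair[of a c a b] A_swap12[of a b a c] by linarith
  have Ta: "?T a = 0" by (rule g_eqI) (simp add: jacobi_char)
  have Tb: "?T b = A b a a d *\<^sub>R a + p *\<^sub>R b + q *\<^sub>R c"
    by (subst null_frame_expand[OF f]) (simp add: jacobi_char p_def q_def)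
  have Tc: "?T c = A c a a d *\<^sub>R a + r *\<^sub>R b + p *\<^sub>R c"
    by (subst null_frame_expand[OF f]) (simp add: jacobi_char p_def r_def sy)
  have powers: "?T (?T (?T (?T x))) = 0" for x
    using nil[of x] by (simp add: numeral_eq_Suc)
  have "g (?T (?T (?T (?T b)))) c = 0" "g (?T (?T (?T (?T b)))) b = 0" "g (?T (?T (?T (?T c)))) c = 0"
    by (simp_all add: powers)
  \<comment> \<open>Entries of the fourth power of the \<open>2 \<times> 2\<close> matrix.\<close>
  then have e: "(p * p + q * r)\<^sup>2 + 4 * p * p * q * r = 0" "p * q * (p * p + q * r) = 0" "p * r * (p * p + q * r) = 0"
    using null_frame_simps[OF f] by (simp_all add: T Ta Tb Tc power2_eq_square algebra_simps)
  have "p = 0 \<and> q * r = 0"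
  proof (cases "p * p + q * r = 0")
    case True
    then have qr: "q * r = - (p * p)" by simp
    have "4 * (p * p) * (q * r) = 0" using e(1) True by simp
    then show ?thesis using qr by auto
  next
    case False
    then have pq: "p * q = 0" "p * r = 0" using e(2,3) by simp_all
    show ?thesis
    proof (cases "p = 0")
      case True
      then show ?thesis using e(1) by simp
    next
      case False
      then show ?thesis using pq e(1) by simp
    qed
  qed
  then show "A b a a c = 0" "A b a a b * A c a a c = 0" by (auto simp: p_def q_def r_def)
qed

text \<open>
  The bivector \<open>(s \<otimes> t) \<and> (s \<otimes> t')\<close> does not depend on the unimodular pair \<open>t, t'\<close>, and it is quadratic in \<open>s\<close>.
\<close>

lemma first_factor_wedge:
  assumes t: "t1 * t2' - t2 * t1' = 1"
  shows "A ((s1 * t1) *\<^sub>R a + (s1 * t2) *\<^sub>R b + (s2 * t1) *\<^sub>R c + (s2 * t2) *\<^sub>R d)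
      ((s1 * t1') *\<^sub>R a + (s1 * t2') *\<^sub>R b + (s2 * t1') *\<^sub>R c + (s2 * t2') *\<^sub>R d) z w
    = s1\<^sup>2 * A a b z w + s1 * s2 * (A a d z w - A b c z w) + s2\<^sup>2 * A c d z w" (is "?L = ?R")
proof -
  have "?L = (t1 * t2' - t2 * t1') * ?R"
    using A_swap12[of b a z w] A_swap12[of c a z w] A_swap12[of d a z w] A_swap12[of c b z w]
      A_swap12[of d b z w] A_swap12[of d c z w]
    by (simp add: power2_eq_square algebra_simps)
  then show ?thesis using t by simp
qed

text \<open>
  Up to sign, the numbers \<open>p e e' x y\<close> are the Pluecker coordinates of \<open>x \<and> y\<close> in the frame. The coordinates of
  a vector along \<open>a, b, c, d\<close> are its products with \<open>d, -c, -b, a\<close>, which explains the exchange of indices and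
  the signs.
\<close>

lemma bivector_expand:
  assumes f: "null_frame a b c d"
  defines "p \<equiv> \<lambda>e e' x y. g x e * g y e' - g x e' * g y e"
  shows "A x y z w = - p d c x y * A a b z w - p d b x y * A a c z w + p d a x y * A a d z w
    + p c b x y * A b c z w - p c a x y * A b d z w - p b a x y * A c d z w"
proof -
  have "A x y z w = A (g x d *\<^sub>R a - g x c *\<^sub>R b - g x b *\<^sub>R c + g x a *\<^sub>R d)
      (g y d *\<^sub>R a - g y c *\<^sub>R b - g y b *\<^sub>R c + g y a *\<^sub>R d) z w"
    using null_frame_expand[OF f, of x] null_frame_expand[OF f, of y] by simp
  also have "\<dots> = - p d c x y * A a b z w - p d b x y * A a c z w + p d a x y * A a d z w
    + p c b x y * A b c z w - p c a x y * A b d z w - p b a x y * A c d z w"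
    using A_swap12[of b a z w] A_swap12[of c a z w] A_swap12[of d a z w] A_swap12[of c b z w]
      A_swap12[of d b z w] A_swap12[of d c z w]
    unfolding p_def by (simp add: algebra_simps)
  finally show ?thesis .
qed

text \<open>
  The numbers \<open>p, q, r\<close> are the diagonal coefficients of the quadratic form; \<open>s, t, u\<close> are the mixed
  coefficients of the pairs \<open>(I, J)\<close>, \<open>(I, K)\<close> and \<open>(J, K)\<close>. By \<open>curvature_determined\<close> such a description
  determines the tensor.
\<close>

definition jacobi_form :: "('a \<Rightarrow> 'a) \<Rightarrow> ('a \<Rightarrow> 'a) \<Rightarrow> ('a \<Rightarrow> 'a) \<Rightarrow>
    real \<Rightarrow> real \<Rightarrow> real \<Rightarrow> real \<Rightarrow> real \<Rightarrow> real \<Rightarrow> bool" where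
  "jacobi_form I J K p q r s t u \<longleftrightarrow> paraquaternionic_structure g I J K \<and>
     (\<forall>x y. A y x x y = p * (g y (I x))\<^sup>2 + q * (g y (J x))\<^sup>2 + r * (g y (K x))\<^sup>2
        + 2 * s * (g y (I x) * g y (J x)) + 2 * t * (g y (I x) * g y (K x)) + 2 * u * (g y (J x) * g y (K x)))"

text \<open>
  Bivectors split into the span of \<open>a \<and> b\<close>, \<open>a \<and> d - b \<and> c\<close>, \<open>c \<and> d\<close> and that of \<open>a \<and> c\<close>,
  \<open>a \<and> d + b \<and> c\<close>, \<open>b \<and> d\<close>. The hypotheses \<open>mixed\<close> say that \<open>A\<close> does not mix the two summands, and
  \<open>weyl\<close> says that on the second one \<open>A\<close> is a multiple of the quadratic form of exterior multiplication. The Pluecker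
  relation moves this multiple to the first summand, whose coordinates are linear in \<open>g y (I x)\<close>,
  \<open>g y (J x)\<close>, \<open>g y (K x)\<close>.
\<close>

lemma half_curvature:
  assumes f: "null_frame a b c d"
    and mixed: "A a b a c = 0" "A a b b d = 0" "A a b a d + A a b b c = 0"
      "A c d a c = 0" "A c d b d = 0" "A c d a d + A c d b c = 0"
      "A a d a c - A b c a c = 0" "A a d b d - A b c b d = 0" "A a d a d - A b c b c = 0"
    and weyl: "A a c a c = 0" "A a c a d + A a c b c = 0" "2 * A a c b d + A a d a d + 2 * A a d b c + A b c b c = 0"
      "A b d a d + A b d b c = 0" "A b d b d = 0"
  shows "\<exists>I J K p q r s t u. jacobi_form I J K p q r s t u"
proof -
  define I J K where "I = (\<lambda>x. g x d *\<^sub>R c - g x c *\<^sub>R d + g x b *\<^sub>R a - g x a *\<^sub>R b)"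
    and "J = (\<lambda>x. g x d *\<^sub>R a - g x c *\<^sub>R b + g x b *\<^sub>R c - g x a *\<^sub>R d)"
    and "K = (\<lambda>x. g x d *\<^sub>R c - g x c *\<^sub>R d - g x b *\<^sub>R a + g x a *\<^sub>R b)"
  define N1 N2 N3 N4 N5 N6 N7 where N: "N1 = A a b a b" "N2 = A c d c d" "N3 = A a b c d" "N4 = A a b a d"
    "N5 = A c d a d" "N6 = A a d a d" "N7 = A a d b c"
  have vals: "A a b b c = - N4" "A c d b c = - N5" "A b c b c = N6" "A a c b d = - N6 - N7"
    "A a d a c = 0" "A b c a c = 0" "A a d b d = 0" "A b c b d = 0" "A a c a d = 0" "A a c b c = 0"
    "A b d a d = 0" "A b d b c = 0" "A b c a d = N7" "A a d a b = N4" "A b c a b = - N4" "A a d c d = N5"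
    "A b c c d = - N5" "A c d a b = N3" "A b d a c = - N6 - N7" "A a c a b = 0" "A a c c d = 0"
    "A b d a b = 0" "A b d c d = 0"
    using mixed weyl A_pair[of a d a c] A_pair[of b c a c] A_pair[of a d b d] A_pair[of b c b d]
      A_pair[of b c a d] A_pair[of a d a b] A_pair[of b c a b] A_pair[of a d c d] A_pair[of b c c d]
      A_pair[of c d a b] A_pair[of b d a c] A_pair[of a c a b] A_pair[of a c c d] A_pair[of b d a b] A_pair[of b d c d]
    unfolding N by linarith+
  \<comment> \<open>The coefficients result from expressing the coordinates \<open>p d c\<close>, \<open>p b a\<close> and \<open>p d a - p c b\<close> below through \<open>g y (I x)\<close>, \<open>g y (J x)\<close> and \<open>g y (K x)\<close>.\<close>
  have "A y x x y = (- (N1 / 4 + N2 / 4 + (N3 - N6 - N7) / 2)) * (g y (I x))\<^sup>2 + (- N6) * (g y (J x))\<^sup>2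
      + (- (N1 / 4 + N2 / 4 - (N3 - N6 - N7) / 2)) * (g y (K x))\<^sup>2
      + 2 * ((N4 + N5) / 2) * (g y (I x) * g y (J x)) + 2 * (- (N1 - N2) / 4) * (g y (I x) * g y (K x))
      + 2 * ((N4 - N5) / 2) * (g y (J x) * g y (K x))" for x y
  proof -
    define p where "p e e' = g x e * g y e' - g x e' * g y e" for e e'
    \<comment> \<open>The Pluecker relation.\<close>
    have pl: "p d c * p b a = p d b * p c a - p d a * p c b"
      unfolding p_def by (simp add: algebra_simps)
    have u: "g y (I x) = p d c + p b a" "g y (J x) = p d a - p c b" "g y (K x) = p d c - p b a"
      unfolding I_def J_def K_def p_def by (simp_all add: algebra_simps)
    note b = bivector_expand[OF f, of x y, folded p_def]
    have "A y x x y = - A x y x y" by (rule A_swap12)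
    also have "A x y x y = N1 * (p d c)\<^sup>2 + N2 * (p b a)\<^sup>2 + 2 * N3 * (p d c * p b a)
        - 2 * N4 * p d c * (p d a - p c b) - 2 * N5 * p b a * (p d a - p c b)
        + N6 * ((p d a)\<^sup>2 + (p c b)\<^sup>2) + 2 * N7 * (p d a * p c b)
        - 2 * (N6 + N7) * (p d b * p c a)"
      unfolding b[of x y] unfolding A_pair[of _ _ x y] unfolding b N[symmetric] vals
      by (simp add: mixed weyl N[symmetric] power2_eq_square algebra_simps)
    also have "p d b * p c a = p d c * p b a + p d a * p c b" using pl by simp
    finally show ?thesis unfolding u by (simp add: power2_eq_square field_simps)
  qed
  moreover have "paraquaternionic_structure g I J K"
    using frame_structure[OF f] unfolding I_def J_def K_def .
  ultimately show ?thesis unfolding jacobi_form_def by blast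
qed

end

text \<open>
  Five points of the projective line determine a binary quartic. The factors \<open>2\<close> fit the symmetric
  coefficients that occur below.
\<close>

lemma quartic_coefficients_zero:
  fixes k0 k1 k2 k3 k4 :: real
  assumes "\<forall>s1 s2. s1 \<noteq> 0 \<or> s2 \<noteq> 0 \<longrightarrow>
    s1 ^ 4 * k0 + s1 ^ 3 * s2 * (2 * k1) + s1\<^sup>2 * s2\<^sup>2 * k2 + s1 * s2 ^ 3 * (2 * k3) + s2 ^ 4 * k4 = 0"
  shows "k0 = 0" "k1 = 0" "k2 = 0" "k3 = 0" "k4 = 0"
  using assms[rule_format, of 1 0] assms[rule_format, of 0 1] assms[rule_format, of 1 1] assms[rule_format, of 1 "-1"] assms[rule_format, of 1 2]
  by simp_all

lemma determinant_one_completion: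
  fixes s1 s2 :: real
  assumes "s1 \<noteq> 0 \<or> s2 \<noteq> 0"
  obtains s2' s1' where "s1 * s2' - s2 * s1' = 1"
proof (cases "s1 = 0")
  case True
  then show ?thesis using assms that[of "0" "- 1 / s2"] by simp
next
  case False
  then show ?thesis using that[of "1 / s1" 0] by simp
qed

context curvature_model
begin

text \<open>
  The bivector \<open>(s \<otimes> t) \<and> (s' \<otimes> t)\<close> does not depend on the unimodular pair \<open>s, s'\<close>, and it is quadratic
  in \<open>t\<close>.
\<close>

lemma second_factor_wedge:
  assumes s: "s1 * s2' - s2 * s1' = 1"
  shows "A ((s1 * t1) *\<^sub>R a + (s1 * t2) *\<^sub>R b + (s2 * t1) *\<^sub>R c + (s2 * t2) *\<^sub>R d)
      ((s1' * t1) *\<^sub>R a + (s1' * t2) *\<^sub>R b + (s2' * t1) *\<^sub>R c + (s2' * t2) *\<^sub>R d) z w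
    = t1\<^sup>2 * A a c z w + t1 * t2 * (A a d z w + A b c z w) + t2\<^sup>2 * A b d z w" (is "?L = ?R")
proof -
  have "?L = (s1 * s2' - s2 * s1') * ?R"
    using A_swap12[of b a z w] A_swap12[of c a z w] A_swap12[of d a z w] A_swap12[of c b z w]
      A_swap12[of d b z w] A_swap12[of d c z w]
    by (simp add: power2_eq_square algebra_simps)
  then show ?thesis using s by simp
qed

lemma null_jordan_osserman_frame:
  assumes "null_jordan_osserman g A" and f: "null_frame a b c d"
  shows "A b a a c = 0" "A b a a b * A c a a c = 0"
proof -
  obtain n_as where n: "\<And>v. v \<noteq> 0 \<Longrightarrow> g v v = 0 \<Longrightarrow> has_jordan_nf (jacobi g A v) n_as"
    using assms(1) unfolding null_jordan_osserman_def by blast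
  have a: "a \<noteq> 0" "g a a = 0" using null_frame_simps[OF f] by auto
  have "jacobi g A (2 *\<^sub>R a) = (\<lambda>x. 4 *\<^sub>R jacobi g A a x)"
    by (simp add: fun_eq_iff jacobi_scale)
  then have "has_jordan_nf (\<lambda>x. 4 *\<^sub>R jacobi g A a x) n_as"
    using n[of "2 *\<^sub>R a"] a by simp
  then have "(jacobi g A a ^^ 4) x = 0" for x
    using jordan_nf_scaling_nilpotent[OF jacobi_linear dim_four n[OF a]] by blast
  then show "A b a a c = 0" "A b a a b * A c a a c = 0"
    using nilpotent_frame[OF f] by blast+
qed

text \<open>
  The two conditions of \<open>nilpotent_frame\<close>, written out for the null frame of the pure tensor \<open>s \<otimes> t\<close>. In the
  second one the factors depend on \<open>s\<close> alone and on \<open>t\<close> alone.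
\<close>

lemma null_jordan_osserman_polynomials:
  fixes s1 s2 t1 t2 :: real
  assumes njo: "null_jordan_osserman g A" and f: "null_frame a b c d"
    and s: "s1 \<noteq> 0 \<or> s2 \<noteq> 0" and t: "t1 \<noteq> 0 \<or> t2 \<noteq> 0"
  shows "s1\<^sup>2 * (t1\<^sup>2 * A a b a c + t1 * t2 * (A a b a d + A a b b c) + t2\<^sup>2 * A a b b d)
      + s1 * s2 * (t1\<^sup>2 * (A a d a c - A b c a c) + t1 * t2 * (A a d a d - A b c b c) + t2\<^sup>2 * (A a d b d - A b c b d))
      + s2\<^sup>2 * (t1\<^sup>2 * A c d a c + t1 * t2 * (A c d a d + A c d b c) + t2\<^sup>2 * A c d b d) = 0"
    and "(s1 ^ 4 * A a b a b + s1 ^ 3 * s2 * (2 * (A a b a d - A a b b c))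
        + s1\<^sup>2 * s2\<^sup>2 * (A a d a d - 2 * A a d b c + A b c b c + 2 * A a b c d)
        + s1 * s2 ^ 3 * (2 * (A c d a d - A c d b c)) + s2 ^ 4 * A c d c d)
      * (t1 ^ 4 * A a c a c + t1 ^ 3 * t2 * (2 * (A a c a d + A a c b c))
        + t1\<^sup>2 * t2\<^sup>2 * (A a d a d + 2 * A a d b c + A b c b c + 2 * A a c b d)
        + t1 * t2 ^ 3 * (2 * (A b d a d + A b d b c)) + t2 ^ 4 * A b d b d) = 0"
proof -
  obtain s2' s1' where s': "s1 * s2' - s2 * s1' = 1" by (rule determinant_one_completion[OF s])
  obtain t2' t1' where t': "t1 * t2' - t2 * t1' = 1" by (rule determinant_one_completion[OF t])
  define v where "v = (s1 * t1) *\<^sub>R a + (s1 * t2) *\<^sub>R b + (s2 * t1) *\<^sub>R c + (s2 * t2) *\<^sub>R d"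
  define m where "m = (s1 * t1') *\<^sub>R a + (s1 * t2') *\<^sub>R b + (s2 * t1') *\<^sub>R c + (s2 * t2') *\<^sub>R d"
  define n where "n = (s1' * t1) *\<^sub>R a + (s1' * t2) *\<^sub>R b + (s2' * t1) *\<^sub>R c + (s2' * t2) *\<^sub>R d"
  obtain w where fr: "null_frame v m n w"
    using null_frame_tensor[OF f s' t'] unfolding v_def m_def n_def by blast
  note vm = first_factor_wedge[OF t', of s1 a b s2 c d, folded v_def m_def]
  note vn = second_factor_wedge[OF s', of t1 a t2 b c d, folded v_def n_def]
  note pairs = A_pair[of b c a d] A_pair[of a d a b] A_pair[of b c a b] A_pair[of a d c d]
    A_pair[of b c c d] A_pair[of c d a b] A_pair[of a d a c] A_pair[of b c a c] A_pair[of a d b d] A_pair[of b c b d]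
    A_pair[of b d a c] A_pair[of a c a b] A_pair[of a c c d] A_pair[of b d a b] A_pair[of b d c d]
  have "A m v v n = - A v m v n" by (rule A_swap12)
  then have z: "A v m v n = 0" using null_jordan_osserman_frame(1)[OF njo fr] by simp
  have e: "A v m v n = s1\<^sup>2 * A v n a b + s1 * s2 * (A v n a d - A v n b c) + s2\<^sup>2 * A v n c d"
    using vm[of v n] A_pair[of a b v n] A_pair[of a d v n] A_pair[of b c v n] A_pair[of c d v n] by simp
  show "s1\<^sup>2 * (t1\<^sup>2 * A a b a c + t1 * t2 * (A a b a d + A a b b c) + t2\<^sup>2 * A a b b d)
      + s1 * s2 * (t1\<^sup>2 * (A a d a c - A b c a c) + t1 * t2 * (A a d a d - A b c b c) + t2\<^sup>2 * (A a d b d - A b c b d))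
      + s2\<^sup>2 * (t1\<^sup>2 * A c d a c + t1 * t2 * (A c d a d + A c d b c) + t2\<^sup>2 * A c d b d) = 0" (is "?R = 0")
  proof -
    have "A v m v n = ?R"
      unfolding e vn using pairs by (simp add: algebra_simps)
    then show ?thesis using z by simp
  qed
  have "A m v v m = - A v m v m" "A n v v n = - A v n v n" by (rule A_swap12)+
  then have z2: "A v m v m * A v n v n = 0" using null_jordan_osserman_frame(2)[OF njo fr] by simp
  have e2: "A v m v m = s1\<^sup>2 * A v m a b + s1 * s2 * (A v m a d - A v m b c) + s2\<^sup>2 * A v m c d"
    using vm[of v m] A_pair[of a b v m] A_pair[of a d v m] A_pair[of b c v m] A_pair[of c d v m] by simp
  have e3: "A v n v n = t1\<^sup>2 * A v n a c + t1 * t2 * (A v n a d + A v n b c) + t2\<^sup>2 * A v n b d"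
    using vn[of v n] A_pair[of a c v n] A_pair[of a d v n] A_pair[of b c v n] A_pair[of b d v n] by simp
  have "A v m v m = s1 ^ 4 * A a b a b + s1 ^ 3 * s2 * (2 * (A a b a d - A a b b c))
        + s1\<^sup>2 * s2\<^sup>2 * (A a d a d - 2 * A a d b c + A b c b c + 2 * A a b c d)
        + s1 * s2 ^ 3 * (2 * (A c d a d - A c d b c)) + s2 ^ 4 * A c d c d"
    unfolding e2 unfolding vm using pairs by (simp add: algebra_simps power2_eq_square power3_eq_cube power4_eq_xxxx)
  moreover have "A v n v n = t1 ^ 4 * A a c a c + t1 ^ 3 * t2 * (2 * (A a c a d + A a c b c))
        + t1\<^sup>2 * t2\<^sup>2 * (A a d a d + 2 * A a d b c + A b c b c + 2 * A a c b d)
        + t1 * t2 ^ 3 * (2 * (A b d a d + A b d b c)) + t2 ^ 4 * A b d b d"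
    unfolding e3 unfolding vn using pairs by (simp add: algebra_simps power2_eq_square power3_eq_cube power4_eq_xxxx)
  ultimately show "(s1 ^ 4 * A a b a b + s1 ^ 3 * s2 * (2 * (A a b a d - A a b b c))
        + s1\<^sup>2 * s2\<^sup>2 * (A a d a d - 2 * A a d b c + A b c b c + 2 * A a b c d)
        + s1 * s2 ^ 3 * (2 * (A c d a d - A c d b c)) + s2 ^ 4 * A c d c d)
      * (t1 ^ 4 * A a c a c + t1 ^ 3 * t2 * (2 * (A a c a d + A a c b c))
        + t1\<^sup>2 * t2\<^sup>2 * (A a d a d + 2 * A a d b c + A b c b c + 2 * A a c b d)
        + t1 * t2 ^ 3 * (2 * (A b d a d + A b d b c)) + t2 ^ 4 * A b d b d) = 0"
    using z2 by simp
qed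

text \<open>
  If the quartic form in \<open>s\<close> is nonzero somewhere, then the one in \<open>t\<close> vanishes everywhere and
  \<open>half_curvature\<close> applies. Otherwise exchange the tensor factors, that is, use the null frame \<open>a, c, b, d\<close>.
\<close>

lemma null_jordan_osserman_jacobi_form:
  assumes njo: "null_jordan_osserman g A"
  shows "\<exists>I J K p q r s t u. jacobi_form I J K p q r s t u"
proof -
  obtain a b c d where f: "null_frame a b c d" by (rule null_frame_exists)
  note P = null_jordan_osserman_polynomials[OF njo f]
  have mixed: "A a b a c = 0" "A a b b d = 0" "A a b a d + A a b b c = 0"
      "A c d a c = 0" "A c d b d = 0" "A c d a d + A c d b c = 0"
      "A a d a c - A b c a c = 0" "A a d b d - A b c b d = 0" "A a d a d - A b c b c = 0"
    using P(1)[of 1 0 1 0] P(1)[of 1 0 0 1] P(1)[of 1 0 1 1] P(1)[of 0 1 1 0] P(1)[of 0 1 0 1] P(1)[of 0 1 1 1]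
      P(1)[of 1 1 1 0] P(1)[of 1 1 0 1] P(1)[of 1 1 1 1] by simp_all
  let ?W = "\<lambda>s1 s2. s1 ^ 4 * A a b a b + s1 ^ 3 * s2 * (2 * (A a b a d - A a b b c))
        + s1\<^sup>2 * s2\<^sup>2 * (A a d a d - 2 * A a d b c + A b c b c + 2 * A a b c d)
        + s1 * s2 ^ 3 * (2 * (A c d a d - A c d b c)) + s2 ^ 4 * A c d c d"
  show ?thesis
  proof (cases "\<exists>s1 s2. (s1 \<noteq> 0 \<or> s2 \<noteq> 0) \<and> ?W s1 s2 \<noteq> 0")
    case True
    then obtain s1 s2 where s: "s1 \<noteq> 0 \<or> s2 \<noteq> 0" "?W s1 s2 \<noteq> 0" by blast
    have "t1 ^ 4 * A a c a c + t1 ^ 3 * t2 * (2 * (A a c a d + A a c b c))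
        + t1\<^sup>2 * t2\<^sup>2 * (A a d a d + 2 * A a d b c + A b c b c + 2 * A a c b d)
        + t1 * t2 ^ 3 * (2 * (A b d a d + A b d b c)) + t2 ^ 4 * A b d b d = 0" if "t1 \<noteq> 0 \<or> t2 \<noteq> 0" for t1 t2
      using P(2)[OF s(1) that] s(2) by (metis mult_eq_0_iff)
    then have "\<forall>t1 t2. t1 \<noteq> 0 \<or> t2 \<noteq> 0 \<longrightarrow> t1 ^ 4 * A a c a c + t1 ^ 3 * t2 * (2 * (A a c a d + A a c b c))
        + t1\<^sup>2 * t2\<^sup>2 * (A a d a d + 2 * A a d b c + A b c b c + 2 * A a c b d)
        + t1 * t2 ^ 3 * (2 * (A b d a d + A b d b c)) + t2 ^ 4 * A b d b d = 0" by blast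
    note Z = quartic_coefficients_zero[OF this]
    show ?thesis
      by (rule half_curvature[OF f mixed]; use Z in linarith)
  next
    case False
    then have "\<forall>s1 s2. s1 \<noteq> 0 \<or> s2 \<noteq> 0 \<longrightarrow> ?W s1 s2 = 0" by blast
    note Z = quartic_coefficients_zero[OF this]
    have f': "null_frame a c b d"
      by (rule null_frameI) (simp_all add: null_frame_simps[OF f])
    note swaps = A_pair[of b c a d] A_pair[of a d a b] A_pair[of b c a b] A_pair[of a d c d]
      A_pair[of b c c d] A_pair[of c d a b] A_pair[of a d a c] A_pair[of b c a c] A_pair[of a d b d] A_pair[of b c b d]
      A_pair[of b d a c] A_pair[of a c a b] A_pair[of a c c d] A_pair[of b d a b] A_pair[of b d c d]
      A_swap34[of a c c b] A_swap34[of b d c b] A_swap34[of a d c b] A_swap34[of a b c b] A_swap34[of c d c b]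
      A_swap12[of c b a b] A_swap12[of c b c d] A_swap12[of c b c b] A_swap34[of b c c b]
    show ?thesis
      by (rule half_curvature[OF f']; use Z mixed swaps in linarith)
  qed
qed

end

section \<open>The rank of the null Jacobi operators\<close>

text \<open>
  For a null vector \<open>v\<close> with \<open>I v = \<sigma> J v + \<tau> K v\<close>, substituting this relation into the quadratic form gives
  the Jacobi operator of \<open>v\<close> as a symmetric \<open>2 \<times> 2\<close> matrix in \<open>J v\<close> and \<open>K v\<close>
  (\<open>jacobi_null_direction\<close>). The predicates \<open>degenerate\<close> and \<open>vanishing\<close> say that this matrix has rank at most
  one, respectively rank zero.
\<close>

definition degenerate :: "real \<Rightarrow> real \<Rightarrow> real \<Rightarrow> real \<Rightarrow> real \<Rightarrow> real \<Rightarrow> real \<Rightarrow> real \<Rightarrow> bool" where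
  "degenerate p q r s t u \<sigma> \<tau> \<longleftrightarrow>
     (q + 2 * \<sigma> * s + \<sigma>\<^sup>2 * p) * (r + 2 * \<tau> * t + \<tau>\<^sup>2 * p) = (u + \<sigma> * t + \<tau> * s + \<sigma> * \<tau> * p)\<^sup>2"

definition vanishing :: "real \<Rightarrow> real \<Rightarrow> real \<Rightarrow> real \<Rightarrow> real \<Rightarrow> real \<Rightarrow> real \<Rightarrow> real \<Rightarrow> bool" where
  "vanishing p q r s t u \<sigma> \<tau> \<longleftrightarrow>
     q + 2 * \<sigma> * s + \<sigma>\<^sup>2 * p = 0 \<and> r + 2 * \<tau> * t + \<tau>\<^sup>2 * p = 0 \<and> u + \<sigma> * t + \<tau> * s + \<sigma> * \<tau> * p = 0"

definition constant_rank :: "real \<Rightarrow> real \<Rightarrow> real \<Rightarrow> real \<Rightarrow> real \<Rightarrow> real \<Rightarrow> bool" where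
  "constant_rank p q r s t u \<longleftrightarrow> (\<forall>\<sigma> \<tau> \<sigma>' \<tau>'. \<sigma>\<^sup>2 + \<tau>\<^sup>2 = 1 \<longrightarrow> \<sigma>'\<^sup>2 + \<tau>'\<^sup>2 = 1 \<longrightarrow>
     (degenerate p q r s t u \<sigma> \<tau> \<longleftrightarrow> degenerate p q r s t u \<sigma>' \<tau>') \<and>
     (vanishing p q r s t u \<sigma> \<tau> \<longleftrightarrow> vanishing p q r s t u \<sigma>' \<tau>'))"

context curvature_model
begin

lemma jacobi_form_polar:
  assumes "jacobi_form I J K p q r s t u"
  shows "A y x x z = p * (g y (I x) * g z (I x)) + q * (g y (J x) * g z (J x)) + r * (g y (K x) * g z (K x))
        + s * (g y (I x) * g z (J x) + g z (I x) * g y (J x))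
        + t * (g y (I x) * g z (K x) + g z (I x) * g y (K x))
        + u * (g y (J x) * g z (K x) + g z (J x) * g y (K x))"
proof -
  have Q: "A y x x y = p * (g y (I x))\<^sup>2 + q * (g y (J x))\<^sup>2 + r * (g y (K x))\<^sup>2
        + 2 * s * (g y (I x) * g y (J x)) + 2 * t * (g y (I x) * g y (K x)) + 2 * u * (g y (J x) * g y (K x))" for y
    using assms unfolding jacobi_form_def by blast
  have "A z x x y = A y x x z"
    using A_swap12[of z x x y] A_pair[of x z x y] A_swap12[of x y x z] by linarith
  then have "2 * A y x x z = A (y + z) x x (y + z) - A y x x y - A z x x z" by simp
  then show ?thesis unfolding Q by (simp add: power2_eq_square algebra_simps)
qed

lemma jacobi_null_direction:
  assumes jf: "jacobi_form I J K p q r s t u" and v: "I v = \<sigma> *\<^sub>R J v + \<tau> *\<^sub>R K v"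
  shows "jacobi g A v y =
    ((q + 2 * \<sigma> * s + \<sigma>\<^sup>2 * p) * g y (J v) + (u + \<sigma> * t + \<tau> * s + \<sigma> * \<tau> * p) * g y (K v)) *\<^sub>R J v +
    ((u + \<sigma> * t + \<tau> * s + \<sigma> * \<tau> * p) * g y (J v) + (r + 2 * \<tau> * t + \<tau>\<^sup>2 * p) * g y (K v)) *\<^sub>R K v"
  by (rule g_eqI) (simp add: jacobi_char jacobi_form_polar[OF jf] v sym[of "J v"] sym[of "K v"] power2_eq_square algebra_simps)

text \<open>
  Every point of the circle is the direction of some null vector, and the ranks of the Jacobi operators of
  any two null vectors agree since their Jordan forms do.
\<close>

lemma null_jordan_osserman_constant_rank:
  assumes njo: "null_jordan_osserman g A" and jf: "jacobi_form I J K p q r s t u"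
  shows "constant_rank p q r s t u"
proof -
  interpret paraquaternionic g I J K
    by unfold_locales (use jf in \<open>simp add: jacobi_form_def\<close>)
  obtain n_as where n: "\<And>v. v \<noteq> 0 \<Longrightarrow> g v v = 0 \<Longrightarrow> has_jordan_nf (jacobi g A v) n_as"
    using njo unfolding null_jordan_osserman_def by blast
  let ?a = "\<lambda>\<sigma>. q + 2 * \<sigma> * s + \<sigma>\<^sup>2 * p"
  let ?b = "\<lambda>\<sigma> \<tau>. u + \<sigma> * t + \<tau> * s + \<sigma> * \<tau> * p"
  let ?c = "\<lambda>\<tau>. r + 2 * \<tau> * t + \<tau>\<^sup>2 * p"
  have key: "(degenerate p q r s t u \<sigma> \<tau> \<longrightarrow> degenerate p q r s t u \<sigma>' \<tau>') \<and>
      (vanishing p q r s t u \<sigma> \<tau> \<longrightarrow> vanishing p q r s t u \<sigma>' \<tau>')"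
    if st: "\<sigma>\<^sup>2 + \<tau>\<^sup>2 = 1" "\<sigma>'\<^sup>2 + \<tau>'\<^sup>2 = 1" for \<sigma> \<tau> \<sigma>' \<tau>'
  proof -
    obtain v where v: "v \<noteq> 0" "g v v = 0" "I v = \<sigma> *\<^sub>R J v + \<tau> *\<^sub>R K v"
      by (rule null_vector_with_direction[OF st(1)])
    obtain v' where v': "v' \<noteq> 0" "g v' v' = 0" "I v' = \<sigma>' *\<^sub>R J v' + \<tau>' *\<^sub>R K v'"
      by (rule null_vector_with_direction[OF st(2)])
    note T = jacobi_null_direction[OF jf v(3)] and T' = jacobi_null_direction[OF jf v'(3)]
    note jn = n[OF v(1,2)] n[OF v'(1,2)]
    obtain y1 where y1: "g y1 (J v') = 1" "g y1 (K v') = 0"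
      using dual_vector_exists JK_independent[OF v'(1)] by metis
    obtain y2 where y2: "g y2 (K v') = 1" "g y2 (J v') = 0"
      using dual_vector_exists[of "K v'" "J v'"] JK_independent[OF v'(1)] by (metis add.commute)
    note y = y1 y2 y1[THEN trans[OF sym]] y2[THEN trans[OF sym]]
    have "degenerate p q r s t u \<sigma>' \<tau>'" if deg: "degenerate p q r s t u \<sigma> \<tau>"
    proof -
      define \<alpha> \<beta> \<gamma> where abc: "\<alpha> = ?a \<sigma>" "\<beta> = ?b \<sigma> \<tau>" "\<gamma> = ?c \<tau>"
      note Tv = T[folded abc]
      have det: "\<alpha> * \<gamma> = \<beta> * \<beta>"
        using deg unfolding degenerate_def abc by (simp add: power2_eq_square)
      have "\<exists>l w. \<forall>y. jacobi g A v y = l y *\<^sub>R w"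
      proof (cases "\<alpha> = 0")
        case True
        then have "jacobi g A v y = (\<gamma> * g y (K v)) *\<^sub>R K v" for y
          using det unfolding Tv by simp
        then show ?thesis
          by (intro exI[of _ "\<lambda>y. \<gamma> * g y (K v)"] exI[of _ "K v"] allI)
      next
        case False
        then have "jacobi g A v y = (\<alpha> * g y (J v) + \<beta> * g y (K v)) *\<^sub>R (J v + (\<beta> / \<alpha>) *\<^sub>R K v)" for y
        proof -
          have "(\<alpha> * g y (J v) + \<beta> * g y (K v)) * (\<beta> / \<alpha>) = \<beta> * g y (J v) + (\<beta> * \<beta>) / \<alpha> * g y (K v)"
            using False by (simp add: field_simps)
          also have "(\<beta> * \<beta>) / \<alpha> = \<gamma>" using False by (simp add: det[symmetric])
          finally show ?thesis unfolding Tv scaleR_add_right scaleR_scaleR by (simp only:)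
        qed
        then show ?thesis
          by (intro exI[of _ "\<lambda>y. \<alpha> * g y (J v) + \<beta> * g y (K v)"]
              exI[of _ "J v + (\<beta> / \<alpha>) *\<^sub>R K v"] allI)
      qed
      then obtain l w where lw: "\<And>y. jacobi g A v y = l y *\<^sub>R w" by blast
      have "g (jacobi g A v' y1) y1 * g (jacobi g A v' y2) y2 = g (jacobi g A v' y2) y1 * g (jacobi g A v' y1) y2"
        by (rule jordan_nf_rank_le_one[OF jacobi_linear jn lw, of "\<lambda>x. g x y1" "\<lambda>x. g x y2"]) (rule g_linear)+
      then show ?thesis
        unfolding T' degenerate_def using y by (simp add: power2_eq_square)
    qed
    moreover have "vanishing p q r s t u \<sigma>' \<tau>'" if van: "vanishing p q r s t u \<sigma> \<tau>"
    proof -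
      have "jacobi g A v y = 0" for y unfolding T using van unfolding vanishing_def by simp
      then have z: "jacobi g A v' y = 0" for y by (rule jordan_nf_zero[OF jacobi_linear jn])
      have "g (jacobi g A v' y1) y1 = 0" "g (jacobi g A v' y2) y2 = 0" "g (jacobi g A v' y1) y2 = 0"
        unfolding z by simp_all
      then show ?thesis
        unfolding T' vanishing_def using y by simp
    qed
    ultimately show ?thesis by blast
  qed
  then show ?thesis unfolding constant_rank_def by blast
qed

end

section \<open>Diagonalisation of the quadratic form\<close>

lemma sign_change_zero:
  fixes f :: "real \<Rightarrow> real"
  assumes "continuous_on {-1..1} f" "f (-1) * f 1 < 0"
  obtains x where "-1 < x" "x < 1" "f x = 0"
proof -
  have "\<exists>x\<ge>-1. x \<le> 1 \<and> f x = 0"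
  proof (cases "f (-1) < 0")
    case True
    then have "f 1 > 0" using assms(2) by (auto simp: mult_less_0_iff)
    then show ?thesis using IVT'[of f "-1" 0 1] True assms(1) by auto
  next
    case False
    then have "f (-1) > 0" "f 1 < 0" using assms(2) by (auto simp: mult_less_0_iff)
    then show ?thesis using IVT2'[of f 1 0 "-1"] assms(1) by auto
  qed
  then obtain x where x: "x \<ge> -1" "x \<le> 1" "f x = 0" by blast
  then have "x \<noteq> -1" "x \<noteq> 1" using assms(2) by auto
  with x show ?thesis by (intro that[of x]) auto
qed

lemma cubic_root:
  fixes a b c :: real
  obtains x where "x ^ 3 + a * x\<^sup>2 + b * x + c = 0"
proof -
  define f where "f x = x ^ 3 + a * x\<^sup>2 + b * x + c" for x
  \<comment> \<open>At this distance from the origin the leading term dominates the others.\<close>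
  define k where "k = 1 + \<bar>a\<bar> + \<bar>b\<bar> + \<bar>c\<bar>"
  have k: "k \<ge> 1" by (simp add: k_def)
  have k2: "k\<^sup>2 \<ge> k" "k\<^sup>2 \<ge> 1" using k by (simp_all add: power2_eq_square mult_le_cancel_left1 mult_ge1_I)
  have bound: "\<bar>a * k\<^sup>2\<bar> + \<bar>b * k\<bar> + \<bar>c\<bar> < k ^ 3"
  proof -
    have "\<bar>a * k\<^sup>2\<bar> + \<bar>b * k\<bar> + \<bar>c\<bar> \<le> \<bar>a\<bar> * k\<^sup>2 + \<bar>b\<bar> * k\<^sup>2 + \<bar>c\<bar> * k\<^sup>2"
      using k k2 mult_left_mono[of k "k\<^sup>2" "\<bar>b\<bar>"] mult_left_mono[of 1 "k\<^sup>2" "\<bar>c\<bar>"] by (simp add: abs_mult)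
    also have "\<dots> = (k - 1) * k\<^sup>2" by (simp add: k_def algebra_simps)
    also have "\<dots> < k ^ 3" using k2 by (simp add: power3_eq_cube power2_eq_square algebra_simps)
    finally show ?thesis .
  qed
  have "f k > 0" "f (- k) < 0"
    using bound unfolding f_def by (simp_all add: power3_eq_cube)
  moreover have "continuous_on {-k..k} f" unfolding f_def by (intro continuous_intros)
  ultimately obtain x where "f x = 0"
    using IVT'[of f "-k" 0 k] k by auto
  then show ?thesis by (intro that[of x]) (simp add: f_def)
qed

text \<open>
  A nonzero cross product of two rows is orthogonal to the third row as well, because the determinant vanishes. If all
  cross products are zero, any vector orthogonal to a nonzero row will do.
\<close>

lemma singular_kernel_3:
  fixes a1 a2 a3 b1 b2 b3 c1 c2 c3 :: real
  assumes det: "a1 * (b2 * c3 - b3 * c2) - a2 * (b1 * c3 - b3 * c1) + a3 * (b1 * c2 - b2 * c1) = 0"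
  obtains x y z where "x \<noteq> 0 \<or> y \<noteq> 0 \<or> z \<noteq> 0"
    "a1 * x + a2 * y + a3 * z = 0" "b1 * x + b2 * y + b3 * z = 0" "c1 * x + c2 * y + c3 * z = 0"
proof -
  have one: "\<exists>x y z. (x \<noteq> 0 \<or> y \<noteq> 0 \<or> z \<noteq> 0) \<and> a1 * x + a2 * y + a3 * z = 0
      \<and> b1 * x + b2 * y + b3 * z = 0 \<and> c1 * x + c2 * y + c3 * z = 0"
    if "a1 * b2 = a2 * b1" "a1 * b3 = a3 * b1" "a2 * b3 = a3 * b2"
      "a1 * c2 = a2 * c1" "a1 * c3 = a3 * c1" "a2 * c3 = a3 * c2" "a1 \<noteq> 0 \<or> a2 \<noteq> 0 \<or> a3 \<noteq> 0"
    for a1 a2 a3 b1 b2 b3 c1 c2 c3 :: real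
  proof (cases "a1 = 0 \<and> a2 = 0")
    case True
    with that show ?thesis by (intro exI[of _ 1] exI[of _ 0]) auto
  next
    case False
    with that show ?thesis by (intro exI[of _ "- a2"] exI[of _ a1] exI[of _ 0]) (auto simp: algebra_simps)
  qed
  have "\<exists>x y z. (x \<noteq> 0 \<or> y \<noteq> 0 \<or> z \<noteq> 0) \<and> a1 * x + a2 * y + a3 * z = 0
      \<and> b1 * x + b2 * y + b3 * z = 0 \<and> c1 * x + c2 * y + c3 * z = 0"
  proof -
    consider
      (ab) "a2 * b3 - a3 * b2 \<noteq> 0 \<or> a3 * b1 - a1 * b3 \<noteq> 0 \<or> a1 * b2 - a2 * b1 \<noteq> 0"
      | (ac) "a2 * c3 - a3 * c2 \<noteq> 0 \<or> a3 * c1 - a1 * c3 \<noteq> 0 \<or> a1 * c2 - a2 * c1 \<noteq> 0"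
      | (bc) "b2 * c3 - b3 * c2 \<noteq> 0 \<or> b3 * c1 - b1 * c3 \<noteq> 0 \<or> b1 * c2 - b2 * c1 \<noteq> 0"
      | (par) "a1 * b2 = a2 * b1" "a1 * b3 = a3 * b1" "a2 * b3 = a3 * b2"
        "a1 * c2 = a2 * c1" "a1 * c3 = a3 * c1" "a2 * c3 = a3 * c2"
        "b1 * c2 = b2 * c1" "b1 * c3 = b3 * c1" "b2 * c3 = b3 * c2"
      by linarith
    then show ?thesis
    proof cases
      case ab
      then show ?thesis using det
        by (intro exI[of _ "a2 * b3 - a3 * b2"] exI[of _ "a3 * b1 - a1 * b3"] exI[of _ "a1 * b2 - a2 * b1"])
          (auto simp: algebra_simps)
    next
      case ac
      then show ?thesis using det
        by (intro exI[of _ "a2 * c3 - a3 * c2"] exI[of _ "a3 * c1 - a1 * c3"] exI[of _ "a1 * c2 - a2 * c1"])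
          (auto simp: algebra_simps)
    next
      case bc
      then show ?thesis using det
        by (intro exI[of _ "b2 * c3 - b3 * c2"] exI[of _ "b3 * c1 - b1 * c3"] exI[of _ "b1 * c2 - b2 * c1"])
          (auto simp: algebra_simps)
    next
      case par
      consider "a1 \<noteq> 0 \<or> a2 \<noteq> 0 \<or> a3 \<noteq> 0" | "b1 \<noteq> 0 \<or> b2 \<noteq> 0 \<or> b3 \<noteq> 0" | "c1 \<noteq> 0 \<or> c2 \<noteq> 0 \<or> c3 \<noteq> 0"
        | "a1 = 0" "a2 = 0" "a3 = 0" "b1 = 0" "b2 = 0" "b3 = 0" "c1 = 0" "c2 = 0" "c3 = 0" by blast
      then show ?thesis
      proof cases
        case 1
        show ?thesis by (rule one[OF par(1-6) 1])
      next
        case 2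
        show ?thesis using one[of b1 a2 b2 a1 a3 b3 c2 c1 c3] one[OF _ _ _ par(7-9) 2, of a2 a1 a3] par(1-3)
          by (metis mult.commute)
      next
        case 3
        show ?thesis using one[OF _ _ _ _ _ _ 3, of a2 a1 a3 b2 b1 b3] par(4-9)
          by (metis mult.commute)
      next
        case 4
        then show ?thesis by (intro exI[of _ 1]) simp
      qed
    qed
  qed
  then show ?thesis using that by blast
qed

text \<open>
  The mixed coefficient changes sign under a quarter turn.
\<close>

lemma symmetric_rotation:
  fixes q r u :: real
  obtains c e where "c\<^sup>2 + e\<^sup>2 = 1" "- c * e * q + (c\<^sup>2 - e\<^sup>2) * u + c * e * r = 0"
proof (cases "u = 0")
  case True
  then show ?thesis by (intro that[of 1 0]) auto
next
  case False
  define f where "f x = - cos x * sin x * q + ((cos x)\<^sup>2 - (sin x)\<^sup>2) * u + cos x * sin x * r" for x :: real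
  have cont: "continuous_on {0..pi/2} f" unfolding f_def by (intro continuous_intros)
  have f: "f 0 = u" "f (pi/2) = - u" by (simp_all add: f_def)
  have "\<exists>x. f x = 0"
  proof (cases "u < 0")
    case True
    then show ?thesis using IVT'[of f 0 0 "pi/2"] cont f by auto
  next
    case False
    then show ?thesis using IVT2'[of f "pi/2" 0 0] cont f by auto
  qed
  then obtain x where "f x = 0" by blast
  then show ?thesis by (intro that[of "cos x" "sin x"]) (simp_all add: f_def)
qed

text \<open>
  The third direction is split off, so the determinant at \<open>(\<sigma>, 0)\<close> with \<open>\<sigma> = 1\<close> or \<open>\<sigma> = -1\<close> is
  \<open>(p + q + 2 \<sigma> s) r\<close>. If the inequality failed, these two values would have opposite signs or one of them would
  vanish. For \<open>r \<noteq> 0\<close> the first possibility gives a zero of the determinant elsewhere on the circle, and in the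
  second both values would vanish, contrary to \<open>s \<noteq> 0\<close>. For \<open>r = 0\<close> the determinant is identically zero,
  and the matrix turns out to vanish at exactly one of the two points.
\<close>

lemma constant_rank_hyperbolic_bound:
  assumes cr: "constant_rank p q r s 0 0" and s: "s \<noteq> 0"
  shows "(p + q)\<^sup>2 > 4 * s\<^sup>2"
proof (rule ccontr)
  assume "\<not> (p + q)\<^sup>2 > 4 * s\<^sup>2"
  then have le: "(p + q + 2 * s) * (p + q - 2 * s) \<le> 0"
    by (simp add: power2_eq_square algebra_simps)
  let ?deg = "degenerate p q r s 0 0" and ?van = "vanishing p q r s 0 0"
  have D: "?deg \<sigma> \<tau> \<longleftrightarrow> ?deg \<sigma>' \<tau>'" and V: "?van \<sigma> \<tau> \<longleftrightarrow> ?van \<sigma>' \<tau>'"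
    if "\<sigma>\<^sup>2 + \<tau>\<^sup>2 = 1" "\<sigma>'\<^sup>2 + \<tau>'\<^sup>2 = 1" for \<sigma> \<tau> \<sigma>' \<tau>'
    using cr that unfolding constant_rank_def by blast+
  have deg1: "?deg 1 0 \<longleftrightarrow> (p + q + 2 * s) * r = 0" "?deg (-1) 0 \<longleftrightarrow> (p + q - 2 * s) * r = 0"
    by (auto simp: degenerate_def algebra_simps)
  have D1: "?deg 1 0 \<longleftrightarrow> ?deg (-1) 0" by (rule D) auto
  show False
  proof (cases "r = 0")
    case True
    have "?deg 0 1" using D[of 1 0 0 1] deg1(1) True by simp
    then have pq: "p * q = s\<^sup>2" using True by (simp add: degenerate_def power2_eq_square mult.commute)
    have "(p - q)\<^sup>2 \<le> 0" using le pq by (simp add: power2_eq_square algebra_simps)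
    then have "p = q" by simp
    have V1: "?van 1 0 \<longleftrightarrow> ?van (-1) 0" by (rule V) auto
    have "(p + s) * (p - s) = 0" using pq \<open>p = q\<close> by (simp add: power2_eq_square algebra_simps)
    then consider "s = p" | "s = - p" by auto
    then show False
      by cases (use V1 True \<open>p = q\<close> s in \<open>auto simp: vanishing_def\<close>)
  next
    case False
    have "(p + q + 2 * s) * (p + q - 2 * s) \<noteq> 0"
    proof
      assume "(p + q + 2 * s) * (p + q - 2 * s) = 0"
      then have "p + q + 2 * s = 0 \<and> p + q - 2 * s = 0" using D1 deg1 False by auto
      then show False using s by linarith
    qed
    with le have lt: "(p + q + 2 * s) * (p + q - 2 * s) < 0" by linarith
    define f where "f x = (q + 2 * x * s + x\<^sup>2 * p) * (r + (1 - x\<^sup>2) * p) - (1 - x\<^sup>2) * (s + x * p)\<^sup>2" for x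
    have "f (-1) * f 1 = r\<^sup>2 * ((p + q + 2 * s) * (p + q - 2 * s))"
      by (simp add: f_def power2_eq_square algebra_simps)
    then have neg: "f (-1) * f 1 < 0" using lt False by (simp add: mult_less_0_iff)
    have "continuous_on {-1..1} f" unfolding f_def by (intro continuous_intros)
    then obtain x where x: "-1 < x" "x < 1" "f x = 0" by (rule sign_change_zero[OF _ neg])
    define y where "y = sqrt (1 - x\<^sup>2)"
    have "x\<^sup>2 \<le> 1" using x by (simp add: abs_square_le_1)
    then have y: "y\<^sup>2 = 1 - x\<^sup>2" by (simp add: y_def)
    have "(0 + x * 0 + y * s + x * y * p)\<^sup>2 = y\<^sup>2 * (s + x * p)\<^sup>2"
      by (simp add: power2_eq_square algebra_simps)
    then have "?deg x y" using x(3) unfolding degenerate_def f_def y by simp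
    then have "?deg 1 0" using D[of x y 1 0] y by simp
    then show False using deg1(1) lt False by auto
  qed
qed

context curvature_model
begin

lemma jacobi_form_rotate:
  assumes jf: "jacobi_form I J K p q r s t u" and ce: "c\<^sup>2 + e\<^sup>2 = 1"
  shows "jacobi_form I (\<lambda>x. c *\<^sub>R J x + e *\<^sub>R K x) (\<lambda>x. c *\<^sub>R K x - e *\<^sub>R J x)
    p (c\<^sup>2 * q + 2 * (c * e * u) + e\<^sup>2 * r) (e\<^sup>2 * q - 2 * (c * e * u) + c\<^sup>2 * r)
    (c * s + e * t) (c * t - e * s) (- c * e * q + (c\<^sup>2 - e\<^sup>2) * u + c * e * r)"
proof -
  interpret paraquaternionic g I J K
    by unfold_locales (use jf in \<open>simp add: jacobi_form_def\<close>)
  let ?J = "\<lambda>x. c *\<^sub>R J x + e *\<^sub>R K x" and ?K = "\<lambda>x. c *\<^sub>R K x - e *\<^sub>R J x"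
  have "skew_adjoint g ?J" "skew_adjoint g ?K"
    unfolding skew_adjoint_def by (auto intro!: linearI simp: algebra_simps skew)
  moreover have "?J (?J x) = (c\<^sup>2 + e\<^sup>2) *\<^sub>R x" "?K (?K x) = (c\<^sup>2 + e\<^sup>2) *\<^sub>R x" for x
    by (simp_all add: power2_eq_square algebra_simps)
  moreover have "I (?J x) + ?J (I x) = 0" "I (?K x) + ?K (I x) = 0" "?J (?K x) + ?K (?J x) = 0" for x
    by (simp_all add: algebra_simps)
  moreover have "skew_adjoint g I" using triple unfolding paraquaternionic_structure_def by blast
  ultimately have "paraquaternionic_structure g I ?J ?K"
    unfolding paraquaternionic_structure_def by (simp add: ce)
  moreover have "A y x x y = p * (g y (I x))\<^sup>2 + (c\<^sup>2 * q + 2 * (c * e * u) + e\<^sup>2 * r) * (g y (?J x))\<^sup>2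
      + (e\<^sup>2 * q - 2 * (c * e * u) + c\<^sup>2 * r) * (g y (?K x))\<^sup>2
      + 2 * (c * s + e * t) * (g y (I x) * g y (?J x)) + 2 * (c * t - e * s) * (g y (I x) * g y (?K x))
      + 2 * (- c * e * q + (c\<^sup>2 - e\<^sup>2) * u + c * e * r) * (g y (?J x) * g y (?K x))" for x y
  proof -
    define X Y where "X = g y (?J x)" and "Y = g y (?K x)"
    have "c * X - e * Y = (c\<^sup>2 + e\<^sup>2) * g y (J x)" "e * X + c * Y = (c\<^sup>2 + e\<^sup>2) * g y (K x)"
      by (simp_all add: X_def Y_def power2_eq_square algebra_simps)
    then have XY: "g y (J x) = c * X - e * Y" "g y (K x) = e * X + c * Y" using ce by simp_all
    have "A y x x y = p * (g y (I x))\<^sup>2 + q * (c * X - e * Y)\<^sup>2 + r * (e * X + c * Y)\<^sup>2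
        + 2 * s * (g y (I x) * (c * X - e * Y)) + 2 * t * (g y (I x) * (e * X + c * Y)) + 2 * u * ((c * X - e * Y) * (e * X + c * Y))"
      unfolding XY[symmetric] using jf unfolding jacobi_form_def by blast
    then show ?thesis unfolding X_def[symmetric] Y_def[symmetric]
      by (simp add: power2_eq_square algebra_simps)
  qed
  ultimately show ?thesis unfolding jacobi_form_def by blast
qed

text \<open>
  The form \<open>- u\<^sup>2 + v\<^sup>2 + w\<^sup>2\<close> is preserved; \<open>c\<close> and \<open>e\<close> play the role of hyperbolic cosine and sine, where \<open>c\<close>
  may also be negative.
\<close>

lemma jacobi_form_boost:
  assumes jf: "jacobi_form I J K p q r s t u" and ch: "c\<^sup>2 - e\<^sup>2 = 1"
  shows "jacobi_form (\<lambda>x. c *\<^sub>R I x + e *\<^sub>R J x) (\<lambda>x. e *\<^sub>R I x + c *\<^sub>R J x) K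
    (c\<^sup>2 * p - 2 * (c * e * s) + e\<^sup>2 * q) (e\<^sup>2 * p - 2 * (c * e * s) + c\<^sup>2 * q) r
    ((c\<^sup>2 + e\<^sup>2) * s - c * e * (p + q)) (c * t - e * u) (c * u - e * t)"
proof -
  interpret paraquaternionic g I J K
    by unfold_locales (use jf in \<open>simp add: jacobi_form_def\<close>)
  let ?I = "\<lambda>x. c *\<^sub>R I x + e *\<^sub>R J x" and ?J = "\<lambda>x. e *\<^sub>R I x + c *\<^sub>R J x"
  have "skew_adjoint g ?I" "skew_adjoint g ?J"
    unfolding skew_adjoint_def by (auto intro!: linearI simp: algebra_simps skew)
  moreover have "?I (?I x) = - ((c\<^sup>2 - e\<^sup>2) *\<^sub>R x)" "?J (?J x) = (c\<^sup>2 - e\<^sup>2) *\<^sub>R x" for x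
    by (simp_all add: power2_eq_square algebra_simps)
  moreover have "?I (?J x) + ?J (?I x) = 0" "?I (K x) + K (?I x) = 0" "?J (K x) + K (?J x) = 0" for x
    by (simp_all add: algebra_simps)
  moreover have "skew_adjoint g K" using triple unfolding paraquaternionic_structure_def by blast
  ultimately have "paraquaternionic_structure g ?I ?J K"
    unfolding paraquaternionic_structure_def by (simp add: ch)
  moreover have "A y x x y = (c\<^sup>2 * p - 2 * (c * e * s) + e\<^sup>2 * q) * (g y (?I x))\<^sup>2
      + (e\<^sup>2 * p - 2 * (c * e * s) + c\<^sup>2 * q) * (g y (?J x))\<^sup>2 + r * (g y (K x))\<^sup>2
      + 2 * ((c\<^sup>2 + e\<^sup>2) * s - c * e * (p + q)) * (g y (?I x) * g y (?J x))
      + 2 * (c * t - e * u) * (g y (?I x) * g y (K x)) + 2 * (c * u - e * t) * (g y (?J x) * g y (K x))" for x y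
  proof -
    define X Y where "X = g y (?I x)" and "Y = g y (?J x)"
    have "c * X - e * Y = (c\<^sup>2 - e\<^sup>2) * g y (I x)" "c * Y - e * X = (c\<^sup>2 - e\<^sup>2) * g y (J x)"
      by (simp_all add: X_def Y_def power2_eq_square algebra_simps)
    then have XY: "g y (I x) = c * X - e * Y" "g y (J x) = c * Y - e * X" using ch by simp_all
    have "A y x x y = p * (c * X - e * Y)\<^sup>2 + q * (c * Y - e * X)\<^sup>2 + r * (g y (K x))\<^sup>2
        + 2 * s * ((c * X - e * Y) * (c * Y - e * X)) + 2 * t * ((c * X - e * Y) * g y (K x)) + 2 * u * ((c * Y - e * X) * g y (K x))"
      unfolding XY[symmetric] using jf unfolding jacobi_form_def by blast
    then show ?thesis unfolding X_def[symmetric] Y_def[symmetric]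
      by (simp add: power2_eq_square algebra_simps)
  qed
  ultimately show ?thesis unfolding jacobi_form_def by blast
qed

definition diagonal_form :: bool where
  "diagonal_form \<longleftrightarrow> (\<exists>I J K p q r. jacobi_form I J K p q r 0 0 0)"

lemma diagonal_formI: "jacobi_form I J K p q r 0 0 0 \<Longrightarrow> diagonal_form"
  unfolding diagonal_form_def by blast

lemma diagonal_if_first_split:
  assumes jf: "jacobi_form I J K p q r 0 0 u"
  shows diagonal_form
proof -
  obtain c e where ce: "c\<^sup>2 + e\<^sup>2 = 1" "- c * e * q + (c\<^sup>2 - e\<^sup>2) * u + c * e * r = 0"
    by (rule symmetric_rotation)
  show ?thesis
    using jacobi_form_rotate[OF jf ce(1)] unfolding ce(2) by (simp add: diagonal_formI)
qed

text \<open>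
  A boost with velocity \<open>x\<close> removes \<open>s\<close> when \<open>(1 + x\<^sup>2) s = x (p + q)\<close>. This has a solution with
  \<open>\<bar>x\<bar> < 1\<close> exactly because of \<open>constant_rank_hyperbolic_bound\<close>.
\<close>

lemma diagonal_if_third_split:
  assumes jf: "jacobi_form I J K p q r s 0 0" and njo: "null_jordan_osserman g A"
  shows diagonal_form
proof (cases "s = 0")
  case True
  then show ?thesis using jf unfolding diagonal_form_def by blast
next
  case False
  have gt: "(p + q)\<^sup>2 > 4 * s\<^sup>2"
    by (rule constant_rank_hyperbolic_bound[OF null_jordan_osserman_constant_rank[OF njo jf] False])
  define f where "f x = (1 + x\<^sup>2) * s - x * (p + q)" for x :: real
  have "f (-1) * f 1 = 4 * s\<^sup>2 - (p + q)\<^sup>2" by (simp add: f_def power2_eq_square algebra_simps)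
  then have neg: "f (-1) * f 1 < 0" using gt by simp
  have "continuous_on {-1..1} f" unfolding f_def by (intro continuous_intros)
  then obtain x where x: "-1 < x" "x < 1" "f x = 0" by (rule sign_change_zero[OF _ neg])
  have x2: "1 - x\<^sup>2 > 0" using x by (simp add: abs_square_less_1)
  define c where "c = 1 / sqrt (1 - x\<^sup>2)"
  have c2: "c\<^sup>2 = 1 / (1 - x\<^sup>2)" using x2 by (simp add: c_def power_divide)
  have ch: "c\<^sup>2 - (c * x)\<^sup>2 = 1"
    using x2 by (simp add: power_mult_distrib c2 diff_divide_distrib[symmetric])
  have "(c\<^sup>2 + (c * x)\<^sup>2) * s - c * (c * x) * (p + q) = c\<^sup>2 * f x"
    by (simp add: f_def power2_eq_square algebra_simps)
  then have "(c\<^sup>2 + (c * x)\<^sup>2) * s - c * (c * x) * (p + q) = 0" using x by simp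
  from jacobi_form_boost[OF jf ch, unfolded this] show ?thesis
    by (simp add: diagonal_formI)
qed

text \<open>
  The equations say that \<open>(x, y, z)\<close> is an eigenvector of the quadratic form relative to \<open>- u\<^sup>2 + v\<^sup>2 + w\<^sup>2\<close>. A
  rotation brings it to \<open>(x, w, 0)\<close>; the sign of \<open>w\<close> is left open.
\<close>

lemma eigenvector_rotate:
  assumes jf: "jacobi_form I J K p q r s t u"
    and ev: "p * x + s * y + t * z = - m * x" "s * x + q * y + u * z = m * y" "t * x + u * y + r * z = m * z"
    and w: "w\<^sup>2 = y\<^sup>2 + z\<^sup>2"
  obtains J' K' q' r' s' t' u' where "jacobi_form I J' K' p q' r' s' t' u'"
    "p * x + s' * w = - m * x" "s' * x + q' * w = m * w" "t' * x + u' * w = 0"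
proof (cases "w = 0")
  case True
  then have "y = 0" "z = 0" using w by (simp_all add: sum_power2_eq_zero_iff)
  then show ?thesis using jf ev True by (intro that[of J K q r s t u]) auto
next
  case False
  define c e where "c = y / w" and "e = z / w"
  have ce: "c\<^sup>2 + e\<^sup>2 = 1" and yz: "y = c * w" "z = e * w"
    using False by (simp_all add: c_def e_def power_divide add_divide_distrib[symmetric] w[symmetric])
  have "s * x + q * (c * w) + u * (e * w) = m * (c * w)" "t * x + u * (c * w) + r * (e * w) = m * (e * w)"
    using ev yz by simp_all
  note ev' = this
  show ?thesis
  proof (rule that[OF jacobi_form_rotate[OF jf ce]])
    show "p * x + (c * s + e * t) * w = - m * x"
      using ev(1) unfolding yz by (simp add: algebra_simps)
    have "(c * s + e * t) * x + (c\<^sup>2 * q + 2 * (c * e * u) + e\<^sup>2 * r) * w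
      = c * (s * x + q * (c * w) + u * (e * w)) + e * (t * x + u * (c * w) + r * (e * w))"
      by (simp add: power2_eq_square algebra_simps)
    also have "\<dots> = m * w * (c\<^sup>2 + e\<^sup>2)" unfolding ev' by (simp add: power2_eq_square algebra_simps)
    finally show "(c * s + e * t) * x + (c\<^sup>2 * q + 2 * (c * e * u) + e\<^sup>2 * r) * w = m * w" by (simp add: ce)
    have "(c * t - e * s) * x + (- c * e * q + (c\<^sup>2 - e\<^sup>2) * u + c * e * r) * w
      = c * (t * x + u * (c * w) + r * (e * w)) - e * (s * x + q * (c * w) + u * (e * w))"
      by (simp add: power2_eq_square algebra_simps)
    also have "\<dots> = 0" unfolding ev' by (simp add: algebra_simps)
    finally show "(c * t - e * s) * x + (- c * e * q + (c\<^sup>2 - e\<^sup>2) * u + c * e * r) * w = 0" .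
  qed
qed

text \<open>
  After a rotation, a boost takes the eigenvector to the first axis if it is timelike and to the second axis if it
  is spacelike. That axis then splits off.
\<close>

lemma diagonal_if_nonnull_eigenvector:
  assumes njo: "null_jordan_osserman g A" and jf: "jacobi_form I J K p q r s t u"
    and ev: "p * x + s * y + t * z = - m * x" "s * x + q * y + u * z = m * y" "t * x + u * y + r * z = m * z"
    and nn: "y\<^sup>2 + z\<^sup>2 \<noteq> x\<^sup>2"
  shows diagonal_form
proof -
  define w where "w = sqrt (y\<^sup>2 + z\<^sup>2)"
  have w: "w\<^sup>2 = y\<^sup>2 + z\<^sup>2" by (simp add: w_def)
  obtain J K q r s t u where jf: "jacobi_form I J K p q r s t u"
    and ev: "p * x + s * w = - m * x" "s * x + q * w = m * w" "t * x + u * w = 0"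
    by (rule eigenvector_rotate[OF jf ev w])
  have off: "(x\<^sup>2 + w\<^sup>2) * s + x * w * (p + q) = 0"
  proof -
    have "(x\<^sup>2 + w\<^sup>2) * s + x * w * (p + q) = w * (p * x + s * w) + x * (s * x + q * w)"
      by (simp add: power2_eq_square algebra_simps)
    then show ?thesis unfolding ev by simp
  qed
  show ?thesis
  proof (cases "x\<^sup>2 > w\<^sup>2")
    case True
    define n where "n = sqrt (x\<^sup>2 - w\<^sup>2)"
    have n: "n\<^sup>2 = x\<^sup>2 - w\<^sup>2" "n \<noteq> 0" using True by (simp_all add: n_def)
    have ch: "(x / n)\<^sup>2 - (- w / n)\<^sup>2 = 1"
      using n True by (simp add: power_divide diff_divide_distrib[symmetric])
    have "((x / n)\<^sup>2 + (- w / n)\<^sup>2) * s - (x / n) * (- w / n) * (p + q) = ((x\<^sup>2 + w\<^sup>2) * s + x * w * (p + q)) / n\<^sup>2"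
      using n by (simp add: power_divide field_simps power2_eq_square)
    then have 1: "((x / n)\<^sup>2 + (- w / n)\<^sup>2) * s - (x / n) * (- w / n) * (p + q) = 0" unfolding off by simp
    have 2: "x / n * t - (- w / n) * u = 0" using ev(3) n by (simp add: field_simps)
    show ?thesis
      by (rule diagonal_if_first_split[OF jacobi_form_boost[OF jf ch, unfolded 1 2]])
  next
    case False
    then have lt: "w\<^sup>2 > x\<^sup>2" using nn w by linarith
    define n where "n = sqrt (w\<^sup>2 - x\<^sup>2)"
    have n: "n\<^sup>2 = w\<^sup>2 - x\<^sup>2" "n \<noteq> 0" using lt by (simp_all add: n_def)
    have ch: "(w / n)\<^sup>2 - (- x / n)\<^sup>2 = 1"
      using n lt by (simp add: power_divide diff_divide_distrib[symmetric])
    have "((w / n)\<^sup>2 + (- x / n)\<^sup>2) * s - (w / n) * (- x / n) * (p + q) = ((x\<^sup>2 + w\<^sup>2) * s + x * w * (p + q)) / n\<^sup>2"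
      using n by (simp add: power_divide field_simps power2_eq_square)
    then have 1: "((w / n)\<^sup>2 + (- x / n)\<^sup>2) * s - (w / n) * (- x / n) * (p + q) = 0" unfolding off by simp
    have 2: "w / n * u - (- x / n) * t = 0" using ev(3) n by (simp add: field_simps)
    note b = jacobi_form_boost[OF jf ch, unfolded 1 2]
    have "(0::real)\<^sup>2 + 1\<^sup>2 = 1" by simp
    from jacobi_form_rotate[OF b this] show ?thesis
      by (simp add: diagonal_if_third_split[OF _ njo])
  qed
qed

text \<open>
  The eigenvector is \<open>(1, 1, 0)\<close>, and the matrix is degenerate at \<open>(1, 0)\<close>, hence on the whole circle. The values at
  \<open>(-1, 0)\<close> and \<open>(0, 1)\<close>, \<open>(0, -1)\<close> then leave only diagonal forms, if \<open>u = 0\<close>, and multiples of the square of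
  a linear form. The latter have the spacelike eigenvector \<open>(u, u, r)\<close>.
\<close>

lemma diagonal_if_null_eigenvector:
  assumes njo: "null_jordan_osserman g A" and jf: "jacobi_form I J K p q r s t u"
    and ev: "p + s = - m" "s + q = m" "t + u = 0"
  shows diagonal_form
proof -
  let ?deg = "degenerate p q r s t u" and ?van = "vanishing p q r s t u"
  have D: "?deg \<sigma> \<tau> \<longleftrightarrow> ?deg \<sigma>' \<tau>'" and V: "?van \<sigma> \<tau> \<longleftrightarrow> ?van \<sigma>' \<tau>'"
    if "\<sigma>\<^sup>2 + \<tau>\<^sup>2 = 1" "\<sigma>'\<^sup>2 + \<tau>'\<^sup>2 = 1" for \<sigma> \<tau> \<sigma>' \<tau>'
    using null_jordan_osserman_constant_rank[OF njo jf] that unfolding constant_rank_def by blast+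
  have qp: "q + 2 * s + p = 0" "q - 2 * s + p = - 4 * s" and t: "t = - u" using ev by linarith+
  have "?deg 1 0" using qp t by (simp add: degenerate_def)
  then have d: "?deg (-1) 0" "?deg 0 1" "?deg 0 (-1)" using D[of 1 0] by auto
  have e1: "- (r * s) = u * u"
    using d(1) qp(2) t by (simp add: degenerate_def power2_eq_square)
  have e2: "q * (r - 2 * u + p) = (u + s) * (u + s)" "q * (r + 2 * u + p) = (u - s) * (u - s)"
    using d(2,3) t by (simp_all add: degenerate_def power2_eq_square)
  show ?thesis
  proof (cases "u = 0")
    case True
    have "s = 0"
    proof (cases "r = 0")
      case r: True
      then have "?van 1 0" using qp t True by (simp add: vanishing_def)
      then have "?van (-1) 0" using V[of 1 0 "-1" 0] by simp
      then show ?thesis using qp(2) by (simp add: vanishing_def)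
    next
      case False
      then show ?thesis using e1 True by simp
    qed
    then show ?thesis using jf True t by (simp add: diagonal_formI)
  next
    case False
    have "q * u + u * s = 0" using e2 by (simp add: algebra_simps)
    then have "u * (q + s) = 0" by (simp add: algebra_simps)
    then have qs: "q = - s" using False by simp
    have "s \<noteq> 0" using e1 False by auto
    moreover have "s * (p + s) = 0" using e1 e2(1) qs by (simp add: algebra_simps)
    ultimately have ps: "p = - s" by simp
    \<comment> \<open>The spacelike eigenvector \<open>(u, u, r)\<close> has eigenvalue \<open>r\<close>.\<close>
    show ?thesis
    proof (rule diagonal_if_nonnull_eigenvector[OF njo jf])
      show "p * u + s * u + t * r = - r * u" "s * u + q * u + u * r = r * u" "t * u + u * u + r * r = r * r"
        using ps qs t by (simp_all add: algebra_simps)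
      have "r \<noteq> 0" using e1 False by auto
      then show "u\<^sup>2 + r\<^sup>2 \<noteq> u\<^sup>2" by simp
    qed
  qed
qed

text \<open>
  The characteristic polynomial of the quadratic form relative to \<open>- u\<^sup>2 + v\<^sup>2 + w\<^sup>2\<close> is a cubic, so there
  is a real eigenvector.
\<close>

lemma null_jordan_osserman_diagonal:
  assumes njo: "null_jordan_osserman g A"
  shows diagonal_form
proof -
  obtain I J K p q r s t u where jf: "jacobi_form I J K p q r s t u"
    using null_jordan_osserman_jacobi_form[OF njo] by blast
  \<comment> \<open>The determinant in the next step, expanded in powers of \<open>m\<close>.\<close>
  obtain m where m: "m ^ 3 + (p - q - r) * m\<^sup>2 + (q * r - u\<^sup>2 - p * q - p * r + s\<^sup>2 + t\<^sup>2) * m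
      + (p * (q * r - u\<^sup>2) - s * (s * r - u * t) + t * (s * u - t * q)) = 0"
    by (rule cubic_root)
  have "(p + m) * ((q - m) * (r - m) - u * u) - s * (s * (r - m) - u * t) + t * (s * u - (q - m) * t) = 0"
    using m by (simp add: power2_eq_square power3_eq_cube algebra_simps)
  then obtain x y z where k: "x \<noteq> 0 \<or> y \<noteq> 0 \<or> z \<noteq> 0" "(p + m) * x + s * y + t * z = 0"
    "s * x + (q - m) * y + u * z = 0" "t * x + u * y + (r - m) * z = 0"
    by (rule singular_kernel_3)
  have ev: "p * x + s * y + t * z = - m * x" "s * x + q * y + u * z = m * y" "t * x + u * y + r * z = m * z"
    using k by (simp_all add: algebra_simps)
  show ?thesis
  proof (cases "y\<^sup>2 + z\<^sup>2 = x\<^sup>2")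
    case True
    obtain J K q r s t u where jf: "jacobi_form I J K p q r s t u"
      and ev: "p * x + s * x = - m * x" "s * x + q * x = m * x" "t * x + u * x = 0"
      by (rule eigenvector_rotate[OF jf ev True[symmetric]])
    have "x \<noteq> 0"
    proof
      assume "x = 0"
      with True have "y = 0" "z = 0" by (simp_all add: sum_power2_eq_zero_iff)
      with \<open>x = 0\<close> k(1) show False by simp
    qed
    moreover have "(p + s) * x = (- m) * x" "(s + q) * x = m * x" "(t + u) * x = 0 * x"
      using ev by (simp_all only: distrib_right mult_zero_left)
    ultimately have "p + s = - m" "s + q = m" "t + u = 0"
      using mult_right_cancel by blast+
    then show ?thesis by (rule diagonal_if_null_eigenvector[OF njo jf])
  next
    case False
    then show ?thesis by (rule diagonal_if_nonnull_eigenvector[OF njo jf ev])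
  qed
qed

end

section \<open>The standard curvature tensors\<close>

lemma curvature_tensorI:
  assumes "\<And>y z v. linear (\<lambda>x. A x y z v)" "\<And>x z v. linear (\<lambda>y. A x y z v)"
    "\<And>x y v. linear (\<lambda>z. A x y z v)" "\<And>x y z. linear (\<lambda>v. A x y z v)"
    and "\<And>x y z v. A x y z v = - A y x z v" "\<And>x y z v. A x y z v = A z v x y"
    "\<And>x y z v. A x y z v + A y z x v + A z x y v = 0"
  shows "algebraic_curvature_tensor A"
  unfolding algebraic_curvature_tensor_def multilinear4_def using assms by blast

lemma curvature_tensor_combination:
  assumes A: "algebraic_curvature_tensor A" and B: "algebraic_curvature_tensor B"
  shows "algebraic_curvature_tensor (\<lambda>x y z v. k * A x y z v + l * B x y z v)"
proof (rule curvature_tensorI)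
  note lin = curvature_tensor_linear[OF A] curvature_tensor_linear[OF B]
  show "linear (\<lambda>x. k * A x y z v + l * B x y z v)" "linear (\<lambda>y. k * A x y z v + l * B x y z v)"
    "linear (\<lambda>z. k * A x y z v + l * B x y z v)" "linear (\<lambda>v. k * A x y z v + l * B x y z v)" for x y z v
    using lin[THEN linear_add] lin[THEN linear_scale] by (auto intro!: linearI simp: algebra_simps)
  fix x y z v
  note a = curvature_tensor_symmetries[OF A] and b = curvature_tensor_symmetries[OF B]
  show "k * A x y z v + l * B x y z v = - (k * A y x z v + l * B y x z v)"
    unfolding a(1)[of x y] b(1)[of x y] by simp
  show "k * A x y z v + l * B x y z v = k * A z v x y + l * B z v x y"
    unfolding a(2)[of x y z v] b(2)[of x y z v] by simp
  have "k * A x y z v + l * B x y z v + (k * A y z x v + l * B y z x v) + (k * A z x y v + l * B z x y v)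
    = k * (A x y z v + A y z x v + A z x y v) + l * (B x y z v + B y z x v + B z x y v)"
    by (simp add: algebra_simps)
  then show "k * A x y z v + l * B x y z v + (k * A y z x v + l * B y z x v) + (k * A z x y v + l * B z x y v) = 0"
    unfolding a(3) b(3) by simp
qed

context neutral_form
begin

lemma curv0_curvature_tensor: "algebraic_curvature_tensor (curv0 g)"
proof (rule curvature_tensorI)
  fix x y z v
  show "linear (\<lambda>x. curv0 g x y z v)" "linear (\<lambda>y. curv0 g x y z v)"
    "linear (\<lambda>z. curv0 g x y z v)" "linear (\<lambda>v. curv0 g x y z v)"
    by (auto intro!: linearI simp: curv0_def algebra_simps)
  show "curv0 g x y z v = - curv0 g y x z v" "curv0 g x y z v = curv0 g z v x y"
    "curv0 g x y z v + curv0 g y z x v + curv0 g z x y v = 0"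
    using sym[of x y] sym[of x z] sym[of x v] sym[of y z] sym[of y v] sym[of z v]
    by (simp_all add: curv0_def)
qed

lemma curv_endo_curvature_tensor:
  assumes "skew_adjoint g F"
  shows "algebraic_curvature_tensor (curv_endo g F)"
proof (rule curvature_tensorI)
  fix x y z v
  have F: "F (x + y) = F x + F y" "F (c *\<^sub>R x) = c *\<^sub>R F x" for x y c
    using assms unfolding skew_adjoint_def by (simp_all add: linear_add linear_scale)
  have s: "g (F x) y = - g (F y) x" for x y
    using assms unfolding skew_adjoint_def by (metis sym)
  show "linear (\<lambda>x. curv_endo g F x y z v)" "linear (\<lambda>y. curv_endo g F x y z v)"
    "linear (\<lambda>z. curv_endo g F x y z v)" "linear (\<lambda>v. curv_endo g F x y z v)"
    by (auto intro!: linearI simp: curv_endo_def F algebra_simps)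
  show "curv_endo g F x y z v = - curv_endo g F y x z v" "curv_endo g F x y z v = curv_endo g F z v x y"
    "curv_endo g F x y z v + curv_endo g F y z x v + curv_endo g F z x y v = 0"
    using s[of y x] s[of z x] s[of v x] s[of z y] s[of v y] s[of v z]
    by (simp_all add: curv_endo_def algebra_simps)
qed

lemma curv0_diagonal: "curv0 g y x x y = g x x * g y y - (g y x)\<^sup>2"
  by (simp add: curv0_def sym[of x y] power2_eq_square)

lemma curv_endo_diagonal:
  assumes "skew_adjoint g F"
  shows "curv_endo g F y x x y = 3 * (g y (F x))\<^sup>2"
proof -
  have s: "g (F x) y = - g x (F y)" for x y using assms unfolding skew_adjoint_def by blast
  have "g (F x) x = 0" using s[of x x] sym[of "F x" x] by simp
  moreover have "g (F y) x = - g y (F x)" "g (F x) y = g y (F x)" using s[of y x] sym[of "F x" y] by auto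
  ultimately show ?thesis by (simp add: curv_endo_def power2_eq_square)
qed

end

section \<open>The four cases\<close>

text \<open>
  On the unit circle the determinant is \<open>\<sigma>\<^sup>2 X + \<tau>\<^sup>2 Y\<close> with \<open>X = r (q + p)\<close> and \<open>Y = q (r + p)\<close>. It
  has zeros but is not identically zero if \<open>X\<close> and \<open>Y\<close> have opposite signs or exactly one of them is \<open>0\<close>.
\<close>

lemma constant_rank_diagonal:
  assumes cr: "constant_rank p q r 0 0 0"
  shows "q * r * (q + p) * (r + p) > 0 \<or> (r * (q + p) = 0 \<and> q * (r + p) = 0)"
proof -
  let ?deg = "degenerate p q r 0 0 0"
  have D: "?deg \<sigma> \<tau> \<longleftrightarrow> ?deg \<sigma>' \<tau>'"
    if "\<sigma>\<^sup>2 + \<tau>\<^sup>2 = 1" "\<sigma>'\<^sup>2 + \<tau>'\<^sup>2 = 1" for \<sigma> \<tau> \<sigma>' \<tau>'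
    using cr that unfolding constant_rank_def by blast
  define X Y where "X = r * (q + p)" and "Y = q * (r + p)"
  have deg: "?deg \<sigma> \<tau> \<longleftrightarrow> \<sigma>\<^sup>2 * X + \<tau>\<^sup>2 * Y = 0" if "\<sigma>\<^sup>2 + \<tau>\<^sup>2 = 1" for \<sigma> \<tau>
  proof -
    have "\<sigma>\<^sup>2 * X + \<tau>\<^sup>2 * Y - ((q + \<sigma>\<^sup>2 * p) * (r + \<tau>\<^sup>2 * p) - (\<sigma> * \<tau> * p)\<^sup>2) = (\<sigma>\<^sup>2 + \<tau>\<^sup>2 - 1) * (q * r)"
      by (simp add: X_def Y_def power2_eq_square algebra_simps)
    then show ?thesis unfolding degenerate_def using that by simp
  qed
  have XY: "X = 0 \<longleftrightarrow> Y = 0" using D[of 1 0 0 1] deg[of 1 0] deg[of 0 1] by simp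
  have "\<not> X * Y < 0"
  proof
    assume lt: "X * Y < 0"
    then have ne: "Y - X \<noteq> 0" by (auto simp: mult_less_0_iff)
    have pos: "Y / (Y - X) \<ge> 0" "- X / (Y - X) \<ge> 0"
      using lt by (auto simp: mult_less_0_iff zero_le_divide_iff divide_le_0_iff)
    \<comment> \<open>The point of the circle at which \<open>\<sigma>\<^sup>2 X + \<tau>\<^sup>2 Y\<close> vanishes.\<close>
    define \<sigma> \<tau> where "\<sigma> = sqrt (Y / (Y - X))" and "\<tau> = sqrt (- X / (Y - X))"
    have sq: "\<sigma>\<^sup>2 = Y / (Y - X)" "\<tau>\<^sup>2 = - X / (Y - X)"
      unfolding \<sigma>_def \<tau>_def using pos by (simp_all only: real_sqrt_pow2)
    have 1: "\<sigma>\<^sup>2 + \<tau>\<^sup>2 = 1" unfolding sq using ne by (simp add: add_divide_distrib[symmetric] diff_divide_distrib[symmetric])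
    have "\<sigma>\<^sup>2 * X + \<tau>\<^sup>2 * Y = 0" unfolding sq by (simp add: mult.commute)
    then have "?deg \<sigma> \<tau>" using deg[OF 1] by simp
    then have "?deg 1 0" using D[OF 1, of 1 0] by simp
    then show False using deg[of 1 0] lt by simp
  qed
  then have "X * Y > 0 \<or> (X = 0 \<and> Y = 0)" using XY by (metis linorder_neqE_linordered_idom mult_eq_0_iff)
  then show ?thesis by (simp add: X_def Y_def mult_ac)
qed

context curvature_model
begin

lemma jacobi_form_type_Ia:
  assumes njo: "null_jordan_osserman g A" and jf: "jacobi_form I J K p q r 0 0 0"
  shows "type_Ia g A"
  unfolding type_Ia_def
proof (intro conjI allI impI)
  show "spacelike_osserman g A \<or> timelike_osserman g A \<or> null_osserman g A"
    using njo has_jordan_nf_eigenvalues unfolding null_jordan_osserman_def null_osserman_def by metis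
next
  interpret paraquaternionic g I J K
    by unfold_locales (use jf in \<open>simp add: jacobi_form_def\<close>)
  fix x assume "g x x = 1 \<or> g x x = - 1"
  then have nn: "g x x \<noteq> 0" by auto
  note ob = nonnull_expansion[OF nn]
  show "diagonalizable_on (jacobi g A x) {y. g x y = 0}"
    unfolding diagonalizable_on_def
  proof (intro exI conjI)
    show "independent {I x, J x, K x}"
      by (rule independent_mono[of "{x, I x, J x, K x}"]) (use ob in \<open>auto simp: ordered_basis_def\<close>)
    show "span {I x, J x, K x} = {y. g x y = 0}"
    proof
      show "span {I x, J x, K x} \<subseteq> {y. g x y = 0}"
        by (rule span_minimal) (auto simp: subspace_def)
      show "{y. g x y = 0} \<subseteq> span {I x, J x, K x}"
      proof
        fix y assume "y \<in> {y. g x y = 0}"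
        then have "g x x *\<^sub>R y = g y (I x) *\<^sub>R I x - g y (J x) *\<^sub>R J x - g y (K x) *\<^sub>R K x"
          using ob(2)[of y] by (simp add: sym[of y x])
        also have "\<dots> \<in> span {I x, J x, K x}"
          by (intro span_diff span_scale span_base) auto
        finally have "(1 / g x x) *\<^sub>R (g x x *\<^sub>R y) \<in> span {I x, J x, K x}" by (rule span_scale)
        then show "y \<in> span {I x, J x, K x}" using nn by simp
      qed
    qed
    have "g (jacobi g A x (I x)) z = g ((p * g x x) *\<^sub>R I x) z"
      "g (jacobi g A x (J x)) z = g ((- q * g x x) *\<^sub>R J x) z"
      "g (jacobi g A x (K x)) z = g ((- r * g x x) *\<^sub>R K x) z" for z
      by (simp_all add: jacobi_char jacobi_form_polar[OF jf] sym[of z "I x"] sym[of z "J x"] sym[of z "K x"])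
    then have "jacobi g A x (I x) = (p * g x x) *\<^sub>R I x" "jacobi g A x (J x) = (- q * g x x) *\<^sub>R J x"
      "jacobi g A x (K x) = (- r * g x x) *\<^sub>R K x"
      by (blast intro: g_eqI)+
    then show "\<forall>b\<in>{I x, J x, K x}. \<exists>c. jacobi g A x b = c *\<^sub>R b" by blast
  qed
qed

text \<open>
  If the determinant has no zero and \<open>q \<noteq> r\<close>, this is the case of three distinct eigenvalues; for \<open>q = r\<close> the Lagrange
  identity combines the last two squares with the first into the tensor of constant curvature. If the
  determinant is identically zero, at most one of \<open>p\<close>, \<open>q\<close>, \<open>r\<close> is nonzero, or \<open>q = r = - p\<close>.
\<close>

lemma diagonal_form_cases:
  assumes njo: "null_jordan_osserman g A" and jf: "jacobi_form I J K p q r 0 0 0"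
  shows "(\<exists>\<kappa>0. \<forall>x y z v. A x y z v = \<kappa>0 * curv0 g x y z v) \<or>
     (\<exists>\<kappa>0 \<kappa>J J. \<kappa>J \<noteq> 0 \<and> orthogonal_complex_structure g J \<and>
        (\<forall>x y z v. A x y z v = \<kappa>0 * curv0 g x y z v + \<kappa>J * curv_endo g J x y z v)) \<or>
     (\<exists>\<kappa>P P. \<kappa>P \<noteq> 0 \<and> adapted_paracomplex_structure g P \<and>
        (\<forall>x y z v. A x y z v = \<kappa>P * curv_endo g P x y z v)) \<or>
     (\<exists>\<kappa>1 \<kappa>2 \<kappa>3 \<Psi>1 \<Psi>2 \<Psi>3.
        \<kappa>2 * \<kappa>3 * (\<kappa>2 + \<kappa>1) * (\<kappa>3 + \<kappa>1) > 0 \<and>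
        distinct [3 * \<kappa>1, -3 * \<kappa>2, -3 * \<kappa>3] \<and>
        paraquaternionic_structure g \<Psi>1 \<Psi>2 \<Psi>3 \<and>
        (\<forall>x y z v. A x y z v =
           \<kappa>1 * curv_endo g \<Psi>1 x y z v + \<kappa>2 * curv_endo g \<Psi>2 x y z v +
           \<kappa>3 * curv_endo g \<Psi>3 x y z v))" (is "?D1 \<or> ?D2 \<or> ?D3 \<or> ?D4")
proof -
  interpret paraquaternionic g I J K
    by unfold_locales (use jf in \<open>simp add: jacobi_form_def\<close>)
  have sk: "skew_adjoint g I" "skew_adjoint g J" "skew_adjoint g K"
    using triple unfolding paraquaternionic_structure_def by blast+
  have ocs: "orthogonal_complex_structure g I" and aps: "adapted_paracomplex_structure g J" "adapted_paracomplex_structure g K"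
    using sk by (simp_all add: orthogonal_complex_structure_def adapted_paracomplex_structure_def)
  have diag: "A y x x y = p * (g y (I x))\<^sup>2 + q * (g y (J x))\<^sup>2 + r * (g y (K x))\<^sup>2" for x y
    using jf unfolding jacobi_form_def by simp
  note tens = curv0_curvature_tensor sk[THEN curv_endo_curvature_tensor]
  note diags = curv0_diagonal sk[THEN curv_endo_diagonal]
  have D1: ?D1 if "q = - p" "r = - p"
  proof -
    have "A y x x y = p * curv0 g y x x y + 0 * curv0 g y x x y" for x y
      by (simp add: diag diags lagrange_identity that algebra_simps)
    from curvature_determined[OF curv curvature_tensor_combination[OF tens(1) tens(1)] this]
    show ?thesis by auto
  qed
  have D2: ?D2 if "q = r" "p + q \<noteq> 0"
  proof -
    have "A y x x y = (- q) * curv0 g y x x y + ((p + q) / 3) * curv_endo g I y x x y" for x y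
      by (simp add: diag diags lagrange_identity that algebra_simps add_divide_distrib)
    from curvature_determined[OF curv curvature_tensor_combination[OF tens(1) tens(2)] this] that ocs
    show ?thesis by (intro exI[of _ "- q"] exI[of _ "(p + q) / 3"] exI[of _ I]) auto
  qed
  have D3J: ?D3 if "p = 0" "r = 0" "q \<noteq> 0"
  proof -
    have "A y x x y = (q / 3) * curv_endo g J y x x y + 0 * curv_endo g J y x x y" for x y
      using that by (simp add: diag diags)
    from curvature_determined[OF curv curvature_tensor_combination[OF tens(3) tens(3)] this] that aps
    show ?thesis by (intro exI[of _ "q / 3"] exI[of _ J]) auto
  qed
  have D3K: ?D3 if "p = 0" "q = 0" "r \<noteq> 0"
  proof -
    have "A y x x y = (r / 3) * curv_endo g K y x x y + 0 * curv_endo g K y x x y" for x y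
      using that by (simp add: diag diags)
    from curvature_determined[OF curv curvature_tensor_combination[OF tens(4) tens(4)] this] that aps
    show ?thesis by (intro exI[of _ "r / 3"] exI[of _ K]) auto
  qed
  from constant_rank_diagonal[OF null_jordan_osserman_constant_rank[OF njo jf]]
  show ?thesis
  proof
    assume pos: "q * r * (q + p) * (r + p) > 0"
    then have ne: "q + p \<noteq> 0" "r + p \<noteq> 0" by auto
    show ?thesis
    proof (cases "q = r")
      case True
      then show ?thesis using D2 ne by (simp add: add.commute)
    next
      case False
      have "A y x x y = 1 * ((p / 3) * curv_endo g I y x x y + (q / 3) * curv_endo g J y x x y)
          + (r / 3) * curv_endo g K y x x y" for x y
        by (simp add: diag diags)
      from curvature_determined[OF curv curvature_tensor_combination[OF curvature_tensor_combination[OF tens(2) tens(3)] tens(4)] this]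
      have "\<forall>x y z v. A x y z v = p / 3 * curv_endo g I x y z v + q / 3 * curv_endo g J x y z v + r / 3 * curv_endo g K x y z v"
        by simp
      moreover have "(q / 3) * (r / 3) * (q / 3 + p / 3) * (r / 3 + p / 3) > 0"
      proof -
        have e: "(q / 3) * (r / 3) * (q / 3 + p / 3) * (r / 3 + p / 3) = (q * r * (q + p) * (r + p)) / 81"
          by (simp add: field_simps)
        show ?thesis unfolding e using pos by simp
      qed
      moreover have "distinct [3 * (p / 3), - 3 * (q / 3), - 3 * (r / 3)]"
        using False ne by auto
      ultimately have ?D4 using triple by blast
      then show ?thesis by blast
    qed
  next
    assume z: "r * (q + p) = 0 \<and> q * (r + p) = 0"
    show ?thesis
    proof (cases "r = 0")
      case r: True
      then have "q = 0 \<or> p = 0" using z by auto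
      then consider "q = 0" "p = 0" | "q = 0" "p \<noteq> 0" | "p = 0" "q \<noteq> 0" by blast
      then show ?thesis
      proof cases
        case 1
        then show ?thesis using D1 r by simp
      next
        case 2
        then have ?D2 using D2 r by simp
        then show ?thesis by blast
      next
        case 3
        then have ?D3 using D3J r by simp
        then show ?thesis by blast
      qed
    next
      case False
      then have qp: "q = - p" using z by auto
      show ?thesis
      proof (cases "q = 0")
        case True
        then have ?D3 using D3K qp False by simp
        then show ?thesis by blast
      next
        case False
        then have "r = - p" using z by auto
        then show ?thesis using D1 qp by blast
      qed
    qed
  qed
qed

end

section \<open>Jordan forms of the null Jacobi operators in the four cases\<close>

context neutral_form
begin

text \<open>
  Here \<open>y\<close> with \<open>g w y = 1\<close>, divided by \<open>k\<close>, starts the Jordan chain of length two.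
\<close>

lemma rank_one_jordan_nf:
  assumes w: "w \<noteq> 0" "g w w = 0" "k \<noteq> 0" and T: "\<And>y. T y = (k * g y w) *\<^sub>R w"
  shows "has_jordan_nf T [(2, 0), (1, 0), (1, 0)]"
proof -
  obtain y where y: "g w y = 1" by (rule null_partner_exists[OF w(1,2)])
  show ?thesis
  proof (rule jordan_nf_square_zero_rank_one[OF dim_four _ _ _ w(1) T])
    show "linear (\<lambda>y. k * g y w)" by (rule linearI) (simp_all add: algebra_simps)
    show "k * g ((1 / k) *\<^sub>R y) w = 1" using y w by (simp add: sym[of y w])
  qed (use w in simp)
qed

lemma rank_two_jordan_nf:
  assumes ind: "\<And>a b. a *\<^sub>R p + b *\<^sub>R r = 0 \<Longrightarrow> a = 0 \<and> b = 0"
    and iso: "g p p = 0" "g p r = 0" "g r r = 0" and det: "a * c \<noteq> b\<^sup>2"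
    and T: "\<And>y. T y = (a * g y p + b * g y r) *\<^sub>R p + (b * g y p + c * g y r) *\<^sub>R r"
  shows "has_jordan_nf T [(2, 0), (2, 0)]"
proof -
  obtain y1 where y1: "g y1 p = 1" "g y1 r = 0" by (rule dual_vector_exists[OF ind])
  obtain y2 where y2: "g y2 r = 1" "g y2 p = 0"
    by (rule dual_vector_exists[of r p]) (use ind in \<open>metis add.commute\<close>)
  have iso': "g r p = 0" using iso(2) sym[of r p] by simp
  show ?thesis
  proof (rule jordan_nf_square_zero_rank_two[OF dim_four])
    show "linear T" by (rule linearI) (simp_all add: T algebra_simps)
    show "T (T x) = 0" for x by (simp add: T iso iso')
    fix l m assume "l *\<^sub>R T y1 + m *\<^sub>R T y2 = 0"
    then have "(l * a + m * b) *\<^sub>R p + (l * b + m * c) *\<^sub>R r = 0"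
      by (simp add: T y1 y2 algebra_simps)
    then have e: "l * a + m * b = 0" "l * b + m * c = 0" using ind by blast+
    have "l * (a * c - b\<^sup>2) = c * (l * a + m * b) - b * (l * b + m * c)"
      "m * (a * c - b\<^sup>2) = a * (l * b + m * c) - b * (l * a + m * b)"
      by (simp_all add: algebra_simps power2_eq_square)
    then show "l = 0 \<and> m = 0" unfolding e using det by simp
  qed
qed

end

context curvature_model
begin

lemma constant_curvature_null_jordan_osserman:
  assumes A: "\<forall>x y z v. A x y z v = k * curv0 g x y z v"
  shows "null_jordan_osserman g A"
proof -
  have T: "jacobi g A v y = (- k * g y v) *\<^sub>R v" if "g v v = 0" for v y
    by (rule g_eqI) (simp add: jacobi_char A curv0_def that)
  show ?thesis
  proof (cases "k = 0")
    case True
    then have "jacobi g A v = (\<lambda>x. 0)" if "g v v = 0" for v using T[OF that] by auto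
    then show ?thesis using jordan_nf_zero_map[OF dim_four] unfolding null_jordan_osserman_def by metis
  next
    case False
    have "has_jordan_nf (jacobi g A v) [(2, 0), (1, 0), (1, 0)]" if v: "v \<noteq> 0" "g v v = 0" for v
      by (rule rank_one_jordan_nf[OF v _ T[OF v(2)]]) (use False in simp)
    then show ?thesis unfolding null_jordan_osserman_def by blast
  qed
qed

lemma complex_null_jordan_osserman:
  assumes k: "k \<noteq> 0" and J: "orthogonal_complex_structure g J"
    and A: "\<forall>x y z v. A x y z v = k0 * curv0 g x y z v + k * curv_endo g J x y z v"
  shows "null_jordan_osserman g A"
proof -
  have sk: "g (J x) y = - g x (J y)" and lin: "linear J" and JJ: "J (J x) = - x" for x y
    using J unfolding orthogonal_complex_structure_def skew_adjoint_def by blast+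
  have self: "g (J x) x = 0" "g x (J x) = 0" for x using sk[of x x] sym[of "J x" x] by auto
  have T: "jacobi g A v y = (- k0 * g y v) *\<^sub>R v + (3 * k * g y (J v)) *\<^sub>R J v" if "g v v = 0" for v y
    by (rule g_eqI) (simp add: jacobi_char A curv0_def curv_endo_def that self sk[of y] sym[of "J v"])
  have ind: "a = 0 \<and> b = 0" if v: "v \<noteq> 0" "a *\<^sub>R v + b *\<^sub>R J v = 0" for a b v
  proof -
    have "(a * a + b * b) *\<^sub>R v = a *\<^sub>R (a *\<^sub>R v + b *\<^sub>R J v) - b *\<^sub>R J (a *\<^sub>R v + b *\<^sub>R J v)"
      using lin by (simp add: linear_add linear_scale JJ algebra_simps)
    then have "(a * a + b * b) *\<^sub>R v = 0" unfolding v(2) using lin by (simp add: linear_0)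
    then show ?thesis using v(1) sum_squares_eq_zero_iff[of a b] by simp
  qed
  have iso: "g (J v) (J v) = 0" if "g v v = 0" for v using that by (simp add: sk JJ)
  show ?thesis
  proof (cases "k0 = 0")
    case True
    have "has_jordan_nf (jacobi g A v) [(2, 0), (1, 0), (1, 0)]" if v: "v \<noteq> 0" "g v v = 0" for v
    proof (rule rank_one_jordan_nf)
      show "J v \<noteq> 0" using ind[OF v(1), of 0 1] by auto
      show "jacobi g A v y = (3 * k * g y (J v)) *\<^sub>R J v" for y using T[OF v(2)] True by simp
    qed (use iso v k in auto)
    then show ?thesis unfolding null_jordan_osserman_def by blast
  next
    case False
    have "has_jordan_nf (jacobi g A v) [(2, 0), (2, 0)]" if v: "v \<noteq> 0" "g v v = 0" for v
    proof (rule rank_two_jordan_nf[where p = v and r = "J v" and a = "- k0" and b = 0 and c = "3 * k"])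
      show "jacobi g A v y = (- k0 * g y v + 0 * g y (J v)) *\<^sub>R v + (0 * g y v + 3 * k * g y (J v)) *\<^sub>R J v" for y
        using T[OF v(2)] by simp
    qed (use ind[OF v(1)] iso v k False self in auto)
    then show ?thesis unfolding null_jordan_osserman_def by blast
  qed
qed

lemma paracomplex_null_jordan_osserman:
  assumes k: "k \<noteq> 0" and P: "adapted_paracomplex_structure g P"
    and A: "\<forall>x y z v. A x y z v = k * curv_endo g P x y z v"
  shows "null_jordan_osserman g A"
proof -
  have sk: "g (P x) y = - g x (P y)" and lin: "linear P" and PP: "P (P x) = x" for x y
    using P unfolding adapted_paracomplex_structure_def skew_adjoint_def by blast+
  have self: "g (P x) x = 0" for x using sk[of x x] sym[of "P x" x] by auto
  have T: "jacobi g A v y = (3 * k * g y (P v)) *\<^sub>R P v" for v y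
    by (rule g_eqI) (simp add: jacobi_char A curv_endo_def self sk[of y] sym[of "P v"])
  have "has_jordan_nf (jacobi g A v) [(2, 0), (1, 0), (1, 0)]" if v: "v \<noteq> 0" "g v v = 0" for v
  proof (rule rank_one_jordan_nf[OF _ _ _ T])
    show "P v \<noteq> 0" using v(1) PP[of v] linear_0[OF lin] by auto
    show "g (P v) (P v) = 0" using v by (simp add: sk PP)
  qed (use k in simp)
  then show ?thesis unfolding null_jordan_osserman_def by blast
qed

text \<open>
  The hypothesis says that \<open>X = k3 (k2 + k1)\<close> and \<open>Y = k2 (k3 + k1)\<close> have the same strict sign, so the
  determinant \<open>9 (s\<^sup>2 X + t\<^sup>2 Y)\<close> is nonzero on the whole circle.
\<close>

lemma paraquaternionic_null_jordan_osserman: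
  assumes pos: "k2 * k3 * (k2 + k1) * (k3 + k1) > 0" and S: "paraquaternionic_structure g I J K"
    and A: "\<forall>x y z v. A x y z v = k1 * curv_endo g I x y z v + k2 * curv_endo g J x y z v + k3 * curv_endo g K x y z v"
  shows "null_jordan_osserman g A"
proof -
  interpret paraquaternionic g I J K by unfold_locales (rule S)
  have "skew_adjoint g I" "skew_adjoint g J" "skew_adjoint g K"
    using S unfolding paraquaternionic_structure_def by blast+
  note diags = this[THEN curv_endo_diagonal]
  have jf: "jacobi_form I J K (3 * k1) (3 * k2) (3 * k3) 0 0 0"
    unfolding jacobi_form_def using S by (simp add: A diags)
  have "has_jordan_nf (jacobi g A v) [(2, 0), (2, 0)]" if v: "v \<noteq> 0" "g v v = 0" for v
  proof -
    obtain s t where st: "s\<^sup>2 + t\<^sup>2 = 1" "I v = s *\<^sub>R J v + t *\<^sub>R K v" by (rule null_direction[OF v])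
    define X Y where "X = k3 * (k2 + k1)" and "Y = k2 * (k3 + k1)"
    have XY: "X * Y > 0" using pos by (simp add: X_def Y_def mult_ac)
    have "s\<^sup>2 * X + t\<^sup>2 * Y \<noteq> 0"
    proof
      assume "s\<^sup>2 * X + t\<^sup>2 * Y = 0"
      then have "s\<^sup>2 * X\<^sup>2 + t\<^sup>2 * (X * Y) = 0"
        by (metis (no_types, opaque_lifting) distrib_left mult.assoc mult.left_commute mult_zero_right power2_eq_square)
      moreover have "s\<^sup>2 * X\<^sup>2 \<ge> 0" "t\<^sup>2 * (X * Y) \<ge> 0" using XY by simp_all
      ultimately have "s\<^sup>2 * X\<^sup>2 = 0" "t\<^sup>2 * (X * Y) = 0" by linarith+
      then have "s = 0" "t = 0" using XY by auto
      then show False using st(1) by simp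
    qed
    moreover have "(3 * k2 + s\<^sup>2 * (3 * k1)) * (3 * k3 + t\<^sup>2 * (3 * k1)) - (s * t * (3 * k1))\<^sup>2
        = 9 * (s\<^sup>2 * X + t\<^sup>2 * Y) + 9 * k2 * k3 * (1 - (s\<^sup>2 + t\<^sup>2))"
      by (simp add: X_def Y_def power2_eq_square algebra_simps)
    ultimately have det: "(3 * k2 + s\<^sup>2 * (3 * k1)) * (3 * k3 + t\<^sup>2 * (3 * k1)) \<noteq> (s * t * (3 * k1))\<^sup>2"
      using st(1) by auto
    show ?thesis
      by (rule rank_two_jordan_nf[OF JK_independent[OF v(1)] _ _ _ det])
        (use v jacobi_null_direction[OF jf st(2)] in simp_all)
  qed
  then show ?thesis unfolding null_jordan_osserman_def by blast
qed

end

section \<open>The characterisation of null Jordan Osserman models\<close>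

theorem theorem1p3:
  fixes g :: "'a::real_vector \<Rightarrow> 'a \<Rightarrow> real"
    and A :: "'a \<Rightarrow> 'a \<Rightarrow> 'a \<Rightarrow> 'a \<Rightarrow> real"
  assumes "model22 g A"
  shows "null_jordan_osserman g A \<longleftrightarrow>
    type_Ia g A \<and>
    ((\<exists>\<kappa>0. \<forall>x y z v. A x y z v = \<kappa>0 * curv0 g x y z v) \<or>
     (\<exists>\<kappa>0 \<kappa>J J. \<kappa>J \<noteq> 0 \<and> orthogonal_complex_structure g J \<and>
        (\<forall>x y z v. A x y z v = \<kappa>0 * curv0 g x y z v + \<kappa>J * curv_endo g J x y z v)) \<or>
     (\<exists>\<kappa>P P. \<kappa>P \<noteq> 0 \<and> adapted_paracomplex_structure g P \<and>
        (\<forall>x y z v. A x y z v = \<kappa>P * curv_endo g P x y z v)) \<or>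
     (\<exists>\<kappa>1 \<kappa>2 \<kappa>3 \<Psi>1 \<Psi>2 \<Psi>3.
        \<kappa>2 * \<kappa>3 * (\<kappa>2 + \<kappa>1) * (\<kappa>3 + \<kappa>1) > 0 \<and>
        distinct [3 * \<kappa>1, -3 * \<kappa>2, -3 * \<kappa>3] \<and>
        paraquaternionic_structure g \<Psi>1 \<Psi>2 \<Psi>3 \<and>
        (\<forall>x y z v. A x y z v =
           \<kappa>1 * curv_endo g \<Psi>1 x y z v + \<kappa>2 * curv_endo g \<Psi>2 x y z v +
           \<kappa>3 * curv_endo g \<Psi>3 x y z v)))"
proof -
  interpret curvature_model g A
    by unfold_locales (use assms in \<open>unfold model22_def, blast+\<close>)
  show ?thesis
  proof
    assume njo: "null_jordan_osserman g A"
    then obtain I J K p q r where jf: "jacobi_form I J K p q r 0 0 0"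
      using null_jordan_osserman_diagonal unfolding diagonal_form_def by blast
    show "type_Ia g A \<and>
    ((\<exists>\<kappa>0. \<forall>x y z v. A x y z v = \<kappa>0 * curv0 g x y z v) \<or>
     (\<exists>\<kappa>0 \<kappa>J J. \<kappa>J \<noteq> 0 \<and> orthogonal_complex_structure g J \<and>
        (\<forall>x y z v. A x y z v = \<kappa>0 * curv0 g x y z v + \<kappa>J * curv_endo g J x y z v)) \<or>
     (\<exists>\<kappa>P P. \<kappa>P \<noteq> 0 \<and> adapted_paracomplex_structure g P \<and>
        (\<forall>x y z v. A x y z v = \<kappa>P * curv_endo g P x y z v)) \<or>
     (\<exists>\<kappa>1 \<kappa>2 \<kappa>3 \<Psi>1 \<Psi>2 \<Psi>3.
        \<kappa>2 * \<kappa>3 * (\<kappa>2 + \<kappa>1) * (\<kappa>3 + \<kappa>1) > 0 \<and>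
        distinct [3 * \<kappa>1, -3 * \<kappa>2, -3 * \<kappa>3] \<and>
        paraquaternionic_structure g \<Psi>1 \<Psi>2 \<Psi>3 \<and>
        (\<forall>x y z v. A x y z v =
           \<kappa>1 * curv_endo g \<Psi>1 x y z v + \<kappa>2 * curv_endo g \<Psi>2 x y z v +
           \<kappa>3 * curv_endo g \<Psi>3 x y z v)))"
      by (rule conjI[OF jacobi_form_type_Ia[OF njo jf] diagonal_form_cases[OF njo jf]])
  qed (elim conjE disjE exE; blast intro: constant_curvature_null_jordan_osserman complex_null_jordan_osserman
      paracomplex_null_jordan_osserman paraquaternionic_null_jordan_osserman)
qed

end
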